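(* Let $J\subseteq\Delta^d_n$ be an M-convex set. Let $\mathrm{B}\subseteq V_J/\mathbb{R}\mathbf{1}$ be the closed unit ball with respect to some norm, and let $X=\mathrm{B}\setminus(\mathrm{Dr}_J\cap\partial\mathrm{B})$. Then the space $\mathbb{P}\mathrm{L}_J$ is homeomorphic to $X$.
   Context: $\Delta^d_n=\{\alpha\in\mathbb{Z}^n_{\ge0}:\sum\alpha_i=d\}$; $J$ is M-convex if nonempty and for all $\alpha,\beta\in J$, $i$ with $\alpha_i<\beta_i$ there is $j$ with $\alpha_j>\beta_j$ and $\alpha+e_i-e_j,\beta-e_i+e_j\in J$; $\delta^\pm_J$ are coordinatewise max/min over $J$. A nonzero homogeneous polynomial $f=\sum c_\alpha x^\alpha/\alpha!$ of degree $d$ with $c_\alpha\ge0$ is Lorentzian if its support $\{\alpha:c_\alpha\ne0\}$ is M-convex and $\partial^\alpha f$ has Hessian with at most one positive eigenvalue for all $\alpha\in\Delta^{d-2}_n$. $\mathrm{L}_J$ is the set of Lorentzian polynomials with support $J$ (Euclidean topology on coefficients) and $\mathbb{P}\mathrm{L}_J=\mathrm{L}_J/\mathbb{R}_{>0}$ (quotient by positive scalars). A list $b_1,\dots,b_k\ge0$ is $0$-null if all are zero or the maximum is attained at least twice, and $\infty$-null if all are zero, the maximum is attained at least twice, or at least three are nonzero. For $q\in\{0,\infty\}$, a strong $\mathbb{T}_q$-representation of $J$ is $\rho\colon\Delta^d_n\to\mathbb{R}_{\ge0}$ with support $J$ such that for all $2\le s\le d$, $\alpha\in\Delta^{d-s}_n$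 with $\delta^-_J\le\alpha$, $i_0\le\dots\le i_s$, $j_2\le\dots\le j_s$ with $\alpha+\sum e_{i_m}+\sum e_{j_m}\le\delta^+_J$, the numbers $\rho(\alpha+\sum_{m\ne k}e_{i_m})\rho(\alpha+e_{i_k}+e_{j_2}+\dots+e_{j_s})$, $k=0,\dots,s$, are $q$-null. $V_J=\{(\log\rho(\alpha))_{\alpha\in J}:\rho$ a strong $\mathbb{T}_\infty$-representation$\}\subseteq\mathbb{R}^J$ is a linear subspace containing the all-ones vector $\mathbf{1}$. The Dressian $\mathrm{Dr}_J\subseteq V_J/\mathbb{R}\mathbf{1}$ is the image of the set of strong $\mathbb{T}_0$-representations of $J$ under coordinatewise logarithm followed by the quotient map. *)

theory Defs
  imports "HOL-Analysis.Analysis" "HOL-Analysis.Finite_Function_Topology"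
    "Jordan_Normal_Form.Char_Poly"
begin

section \<open>M-convex sets\<close>

text \<open>
  Vectors in \<open>\<int>\<^sup>n\<^sub>\<ge>\<^sub>0\<close> are finitely supported functions on the natural numbers whose support lies
  in \<open>{..<n}\<close>, so coordinates are numbered from \<open>0\<close> to \<open>n - 1\<close>. The library order on
  \<open>nat \<Rightarrow>\<^sub>0 nat\<close> is lexicographic; coordinatewise comparisons are therefore always spelled out.
\<close>

type_synonym expo = "nat \<Rightarrow>\<^sub>0 nat"

definition discrete_simplex :: "nat \<Rightarrow> nat \<Rightarrow> expo set" where
  "discrete_simplex n d =
     {\<alpha>. Poly_Mapping.keys \<alpha> \<subseteq> {..<n} \<and> (\<Sum>i<n. Poly_Mapping.lookup \<alpha> i) = d}"

definition unit_expo :: "nat \<Rightarrow> expo" where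
  "unit_expo i = Poly_Mapping.single i 1"

text \<open>
  The truncated subtractions are harmless: the coordinate decreased is positive. For
  \<open>J \<subseteq> discrete_simplex n d\<close>, the indices \<open>i\<close> and \<open>j\<close> are automatically less than \<open>n\<close>.
\<close>

definition M_convex :: "expo set \<Rightarrow> bool" where
  "M_convex J \<longleftrightarrow> J \<noteq> {} \<and>
     (\<forall>\<alpha>\<in>J. \<forall>\<beta>\<in>J. \<forall>i. Poly_Mapping.lookup \<alpha> i < Poly_Mapping.lookup \<beta> i \<longrightarrow>
        (\<exists>j. Poly_Mapping.lookup \<alpha> j > Poly_Mapping.lookup \<beta> j \<and>
             \<alpha> + unit_expo i - unit_expo j \<in> J \<and>
             \<beta> - unit_expo i + unit_expo j \<in> J))"

definition delta_max :: "expo set \<Rightarrow> nat \<Rightarrow> nat" where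
  "delta_max J i = Max ((\<lambda>\<alpha>. Poly_Mapping.lookup \<alpha> i) ` J)"

definition delta_min :: "expo set \<Rightarrow> nat \<Rightarrow> nat" where
  "delta_min J i = Min ((\<lambda>\<alpha>. Poly_Mapping.lookup \<alpha> i) ` J)"

section \<open>Lorentzian polynomials\<close>

type_synonym real_mpoly = "expo \<Rightarrow>\<^sub>0 real"

text \<open>The \<open>c\<^sub>\<alpha>\<close> in \<open>f = \<Sum>\<^sub>\<alpha> c\<^sub>\<alpha> x\<^sup>\<alpha> / \<alpha>!\<close>, whereas \<open>lookup f \<alpha>\<close> is the plain coefficient \<open>c\<^sub>\<alpha> / \<alpha>!\<close>.\<close>

definition norm_coeff :: "real_mpoly \<Rightarrow> expo \<Rightarrow> real" where
  "norm_coeff f \<alpha> =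
     Poly_Mapping.lookup f \<alpha> * (\<Prod>i\<in>Poly_Mapping.keys \<alpha>. fact (Poly_Mapping.lookup \<alpha> i))"

definition poly_support :: "real_mpoly \<Rightarrow> expo set" where
  "poly_support f = {\<alpha>. norm_coeff f \<alpha> \<noteq> 0}"

definition partial_deriv :: "nat \<Rightarrow> real_mpoly \<Rightarrow> real_mpoly" where
  "partial_deriv i f =
     (\<Sum>\<mu>\<in>Poly_Mapping.keys f. Poly_Mapping.single (\<mu> - unit_expo i)
        (of_nat (Poly_Mapping.lookup \<mu> i) * Poly_Mapping.lookup f \<mu>))"

definition multi_deriv :: "expo \<Rightarrow> real_mpoly \<Rightarrow> real_mpoly" where
  "multi_deriv \<alpha> =
     fold (\<lambda>i. partial_deriv i ^^ Poly_Mapping.lookup \<alpha> i) (sorted_list_of_set (Poly_Mapping.keys \<alpha>))"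

definition hessian :: "nat \<Rightarrow> real_mpoly \<Rightarrow> real_mpoly mat" where
  "hessian n f = mat n n (\<lambda>(i, j). partial_deriv i (partial_deriv j f))"

text \<open>Used for quadratic forms, whose Hessian has constant entries.\<close>

definition const_hessian :: "nat \<Rightarrow> real_mpoly \<Rightarrow> real mat" where
  "const_hessian n f = map_mat (\<lambda>p. Poly_Mapping.lookup p 0) (hessian n f)"

text \<open>Eigenvalues are counted with multiplicity.\<close>

definition num_pos_eigenvalues :: "real mat \<Rightarrow> nat" where
  "num_pos_eigenvalues A = size (filter_mset (\<lambda>x. x > 0) (proots (char_poly A)))"

text \<open>
  The set \<open>\<Delta>\<^sup>d\<^sup>-\<^sup>2\<^sub>n\<close> is empty for \<open>d < 2\<close>; since subtraction on \<^typ>\<open>nat\<close> truncates, the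
  condition on \<open>\<alpha>\<close> is guarded by \<open>2 \<le> d\<close>.
\<close>

definition lorentzian :: "nat \<Rightarrow> nat \<Rightarrow> real_mpoly \<Rightarrow> bool" where
  "lorentzian n d f \<longleftrightarrow>
     f \<noteq> 0 \<and> Poly_Mapping.keys f \<subseteq> discrete_simplex n d \<and> (\<forall>\<alpha>. norm_coeff f \<alpha> \<ge> 0) \<and>
     M_convex (poly_support f) \<and>
     (2 \<le> d \<longrightarrow> (\<forall>\<alpha>\<in>discrete_simplex n (d - 2).
        num_pos_eigenvalues (const_hessian n (multi_deriv \<alpha> f)) \<le> 1))"

definition lorentzian_set :: "nat \<Rightarrow> nat \<Rightarrow> expo set \<Rightarrow> real_mpoly set" where
  "lorentzian_set n d J = {f. lorentzian n d f \<and> poly_support f = J}"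

section \<open>Quotient spaces\<close>

definition quotient_topology :: "'a topology \<Rightarrow> ('a \<times> 'a) set \<Rightarrow> 'a set topology" where
  "quotient_topology X r =
     topology (\<lambda>U. U \<subseteq> topspace X // r \<and> openin X {x \<in> topspace X. r `` {x} \<in> U})"

lemma openin_quotient_topology:
  "openin (quotient_topology X r) U \<longleftrightarrow>
     U \<subseteq> topspace X // r \<and> openin X {x \<in> topspace X. r `` {x} \<in> U}"
proof -
  have "istopology (\<lambda>U. U \<subseteq> topspace X // r \<and> openin X {x \<in> topspace X. r `` {x} \<in> U})"
    unfolding istopology_def
  proof (intro conjI allI impI; (elim conjE)?)
    fix S T
    assume *: "S \<subseteq> topspace X // r" "T \<subseteq> topspace X // r"
      "openin X {x \<in> topspace X. r `` {x} \<in> S}" "openin X {x \<in> topspace X. r `` {x} \<in> T}"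
    show "S \<inter> T \<subseteq> topspace X // r" using * by blast
    have "{x \<in> topspace X. r `` {x} \<in> S \<inter> T} =
        {x \<in> topspace X. r `` {x} \<in> S} \<inter> {x \<in> topspace X. r `` {x} \<in> T}" by blast
    then show "openin X {x \<in> topspace X. r `` {x} \<in> S \<inter> T}"
      using openin_Int[OF *(3,4)] by (simp only:)
  next
    fix K
    assume *: "\<forall>S\<in>K. S \<subseteq> topspace X // r \<and> openin X {x \<in> topspace X. r `` {x} \<in> S}"
    show "\<Union>K \<subseteq> topspace X // r" using * by blast
    have "{x \<in> topspace X. r `` {x} \<in> \<Union>K} = \<Union> ((\<lambda>S. {x \<in> topspace X. r `` {x} \<in> S}) ` K)"
      by blast
    then show "openin X {x \<in> topspace X. r `` {x} \<in> \<Union>K}" using * by auto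
  qed
  then show ?thesis by (simp add: quotient_topology_def)
qed

lemma topspace_quotient_topology: "topspace (quotient_topology X r) = topspace X // r"
proof
  show "topspace (quotient_topology X r) \<subseteq> topspace X // r"
    by (metis openin_quotient_topology openin_topspace)
  have "{x \<in> topspace X. r `` {x} \<in> topspace X // r} = topspace X"
    by (auto intro: quotientI)
  then have "openin (quotient_topology X r) (topspace X // r)"
    by (simp add: openin_quotient_topology)
  then show "topspace X // r \<subseteq> topspace (quotient_topology X r)"
    by (rule openin_subset)
qed

lemma quotient_map_quotient_topology:
  "quotient_map X (quotient_topology X r) (\<lambda>x. r `` {x})"
  by (auto simp: quotient_map_def topspace_quotient_topology openin_quotient_topology quotient_def)

text \<open>
  Both polynomials and vectors of \<open>\<real>\<^sup>J\<close> are elements of \<open>expo \<Rightarrow>\<^sub>0 real\<close>, which the library makes a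
  real normed vector space with the \<open>\<ell>\<^sup>1\<close>-norm. On the finite-dimensional coordinate subspaces used
  here its topology is the Euclidean topology on coefficients.
\<close>

definition pos_scaling_rel :: "'a::real_vector set \<Rightarrow> ('a \<times> 'a) set" where
  "pos_scaling_rel S = {(f, g). f \<in> S \<and> g \<in> S \<and> (\<exists>c>0. g = c *\<^sub>R f)}"

definition proj_lorentzian :: "nat \<Rightarrow> nat \<Rightarrow> expo set \<Rightarrow> real_mpoly set topology" where
  "proj_lorentzian n d J =
     quotient_topology (top_of_set (lorentzian_set n d J)) (pos_scaling_rel (lorentzian_set n d J))"

definition line_rel :: "'a::real_vector set \<Rightarrow> 'a \<Rightarrow> ('a \<times> 'a) set" where
  "line_rel V u = {(v, w). v \<in> V \<and> w \<in> V \<and> (\<exists>t. w = v + t *\<^sub>R u)}"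

text \<open>
  \<open>N\<close> is a norm on the quotient \<open>V / \<real>u\<close> of a linear subspace \<open>V\<close> by the line through \<open>u \<in> V\<close>; the
  vector space operations on classes are expressed through representatives.
\<close>

definition is_quotient_norm :: "'a::real_vector set \<Rightarrow> 'a \<Rightarrow> ('a set \<Rightarrow> real) \<Rightarrow> bool" where
  "is_quotient_norm V u N \<longleftrightarrow>
     (\<forall>v\<in>V. N (line_rel V u `` {v}) \<ge> 0) \<and>
     (\<forall>v\<in>V. N (line_rel V u `` {v}) = 0 \<longleftrightarrow> line_rel V u `` {v} = line_rel V u `` {0}) \<and>
     (\<forall>v\<in>V. \<forall>c. N (line_rel V u `` {c *\<^sub>R v}) = \<bar>c\<bar> * N (line_rel V u `` {v})) \<and>
     (\<forall>v\<in>V. \<forall>w\<in>V. N (line_rel V u `` {v + w}) \<le>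
        N (line_rel V u `` {v}) + N (line_rel V u `` {w}))"

section \<open>Strong representations and the Dressian\<close>

definition zero_null :: "real list \<Rightarrow> bool" where
  "zero_null bs \<longleftrightarrow> (\<forall>b\<in>set bs. b = 0) \<or> count_list bs (Max (set bs)) \<ge> 2"

definition infty_null :: "real list \<Rightarrow> bool" where
  "infty_null bs \<longleftrightarrow>
     (\<forall>b\<in>set bs. b = 0) \<or> count_list bs (Max (set bs)) \<ge> 2 \<or> length (filter (\<lambda>b. b \<noteq> 0) bs) \<ge> 3"

text \<open>
  The parameter \<open>null\<close> is \<^const>\<open>zero_null\<close> for representations over \<open>\<bbbT>\<^sub>0\<close> and \<^const>\<open>infty_null\<close>
  for representations over \<open>\<bbbT>\<^sub>\<infinity>\<close>. Only the values of \<open>\<rho>\<close> on \<open>discrete_simplex n d\<close> matter.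
\<close>

definition strong_rep ::
    "(real list \<Rightarrow> bool) \<Rightarrow> nat \<Rightarrow> nat \<Rightarrow> expo set \<Rightarrow> (expo \<Rightarrow> real) \<Rightarrow> bool" where
  "strong_rep null n d J \<rho> \<longleftrightarrow>
     (\<forall>\<alpha>\<in>discrete_simplex n d. \<rho> \<alpha> \<ge> 0) \<and>
     {\<alpha> \<in> discrete_simplex n d. \<rho> \<alpha> \<noteq> 0} = J \<and>
     (\<forall>s \<alpha> i j.
        2 \<le> s \<and> s \<le> d \<and> \<alpha> \<in> discrete_simplex n (d - s) \<and>
        (\<forall>l<n. delta_min J l \<le> Poly_Mapping.lookup \<alpha> l) \<and>
        i ` {0..s} \<subseteq> {..<n} \<and> mono_on {0..s} i \<and>
        j ` {2..s} \<subseteq> {..<n} \<and> mono_on {2..s} j \<and>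
        (\<forall>l<n. Poly_Mapping.lookup
            (\<alpha> + (\<Sum>m\<in>{0..s}. unit_expo (i m)) + (\<Sum>m\<in>{2..s}. unit_expo (j m))) l
          \<le> delta_max J l) \<longrightarrow>
        null (map (\<lambda>k. \<rho> (\<alpha> + (\<Sum>m\<in>{0..s} - {k}. unit_expo (i m))) *
                       \<rho> (\<alpha> + unit_expo (i k) + (\<Sum>m\<in>{2..s}. unit_expo (j m))))
                  [0..<Suc s]))"

definition ones_vec :: "expo set \<Rightarrow> expo \<Rightarrow>\<^sub>0 real" where
  "ones_vec J = (\<Sum>\<alpha>\<in>J. Poly_Mapping.single \<alpha> 1)"

definition log_vec :: "expo set \<Rightarrow> (expo \<Rightarrow> real) \<Rightarrow> expo \<Rightarrow>\<^sub>0 real" where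
  "log_vec J \<rho> = (\<Sum>\<alpha>\<in>J. Poly_Mapping.single \<alpha> (ln (\<rho> \<alpha>)))"

definition V_space :: "nat \<Rightarrow> nat \<Rightarrow> expo set \<Rightarrow> (expo \<Rightarrow>\<^sub>0 real) set" where
  "V_space n d J = {log_vec J \<rho> | \<rho>. strong_rep infty_null n d J \<rho>}"

definition V_quotient :: "nat \<Rightarrow> nat \<Rightarrow> expo set \<Rightarrow> (expo \<Rightarrow>\<^sub>0 real) set topology" where
  "V_quotient n d J =
     quotient_topology (top_of_set (V_space n d J)) (line_rel (V_space n d J) (ones_vec J))"

definition dressian :: "nat \<Rightarrow> nat \<Rightarrow> expo set \<Rightarrow> (expo \<Rightarrow>\<^sub>0 real) set set" where
  "dressian n d J =
     {line_rel (V_space n d J) (ones_vec J) `` {log_vec J \<rho>} | \<rho>. strong_rep zero_null n d J \<rho>}"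

end

(*
  In logarithmic coordinates the Lorentzian polynomials with support J form a closed subset S of V_J,
  cut out by quadratic forms of Lorentzian signature: three-term inequalities for such forms give the
  two-term relations defining V_J, and the strong relations follow from the three-term ones by exchange
  arguments that decrease the distance of two points. By Schoenberg's theorem (entrywise powers B^t,
  0 < t < 1, of conditionally negative definite kernels are again such), S is star-shaped; it is strictly
  so about the point c(x) = - sum x_l^2, because adding c shrinks the diagonals of all the forms, whereas
  the origin may lie on the boundary of S (for instance for J = {2e_1, e_1 + e_2, 2e_2}). The directions
  in which S - c is unbounded are exactly those of the Dressian, since a form whose entries satisfy the
  tropical three-term relations becomes ultrametric after rescaling and is therefore Lorentzian, while
  conversely the inequalities for all powers tend to the tropical relations. With g the Minkowski
  functional of S - c and N the given norm, x |-> x / (1 + N x - g x) maps S - c onto the ball without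
  the Dressian part of its boundary; its inverse is y |-> y / (1 - N y + g y).
*)
theory Submission
  imports Defs
begin

section \<open>Exchange in M-convex sets\<close>

text \<open>Strong relations compare points of J at any distance, while the Lorentzian condition
  sees only the matrices c(\<alpha> + e_i + e_j), that is s = 2; hence local relations must first be
  shown to imply global ones. Interior points of S are the harder obstacle. A singular form with one
  positive eigenvalue can acquire a second one under an arbitrarily small perturbation, so interior
  is meant relative to V_J: there a zero entry forces the two rows involved to be proportional
  unless one of them vanishes, at the given form and nearby alike. Everything is then determined by
  a block without off-diagonal zeros, on which the powers 0 < t < 1 and the shrunk diagonal give
  strict negativity on a hyperplane. The exponent t and the point c enter together, because t x + (1
  - t) c has as matrices, up to diagonal congruence, the t-th powers with the diagonal multiplied by
  exp(-2(1 - t)). This strictness and closedness of S make the gauge g continuous although S is only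
  known to be star-shaped. All maps are built on V_J, with g and N constant along the all-ones
  vector, and descend to the quotients at the end.\<close>

abbreviation lk :: "('a \<Rightarrow>\<^sub>0 'b::zero) \<Rightarrow> 'a \<Rightarrow> 'b" where "lk \<equiv> Poly_Mapping.lookup"
abbreviation ee :: "nat \<Rightarrow> expo" where "ee \<equiv> unit_expo"

lemma lookup_unit_expo [simp]: "lk (ee i) k = (if k = i then 1 else 0)"
  by (auto simp: unit_expo_def lookup_single when_def)

lemma expo_minus_plus_unit: "0 < lk x i \<Longrightarrow> x - ee i + ee i = x"
  by (rule poly_mapping_eqI) (auto simp: lookup_add lookup_minus)

lemma expo_plus_minus_unit [simp]: "x + ee i - ee i = x"
  by (rule poly_mapping_eqI) (auto simp: lookup_add lookup_minus)

lemma discrete_simplex_plus_unit_iff: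
  "x + ee i \<in> discrete_simplex n (Suc d) \<longleftrightarrow> i < n \<and> x \<in> discrete_simplex n d"
proof -
  have k: "Poly_Mapping.keys (x + ee i) = Poly_Mapping.keys x \<union> {i}"
    by (auto simp: in_keys_iff lookup_add split: if_splits)
  have "(\<Sum>k<n. lk (x + ee i) k) = Suc (\<Sum>k<n. lk x k)" if "i < n"
    using that by (simp add: lookup_add sum.distrib)
  then show ?thesis unfolding discrete_simplex_def mem_Collect_eq k by auto
qed

lemma discrete_simplex_lookup_less: "x \<in> discrete_simplex n d \<Longrightarrow> 0 < lk x i \<Longrightarrow> i < n"
  by (auto simp: discrete_simplex_def in_keys_iff subset_iff)

lemma discrete_simplex_eqI:
  assumes "x \<in> discrete_simplex n d" "y \<in> discrete_simplex n d" "\<And>i. lk x i \<le> lk y i"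
  shows "x = y"
proof (rule poly_mapping_eqI)
  fix k
  show "lk x k = lk y k"
  proof (cases "k < n")
    case True
    have "(\<Sum>k<n. lk x k) = (\<Sum>k<n. lk y k)"
      using assms(1,2) by (simp add: discrete_simplex_def)
    from sum_mono_inv[OF this, of k] True assms(3) show ?thesis by auto
  next
    case False
    then show ?thesis
      using assms(1,2) discrete_simplex_lookup_less by (metis gr0I)
  qed
qed

lemma finite_discrete_simplex: "finite (discrete_simplex n d)"
proof (rule finite_imageD)
  let ?f = "\<lambda>x::expo. \<lambda>i. if i < n then lk x i else undefined"
  have "?f ` discrete_simplex n d \<subseteq> ({..<n} \<rightarrow>\<^sub>E {..d})"
  proof (clarsimp simp: PiE_iff extensional_def)
    fix x i assume x: "x \<in> discrete_simplex n d" and i: "i < n"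
    have "lk x i \<le> (\<Sum>k<n. lk x k)" using i by (intro member_le_sum) auto
    then show "lk x i \<le> d" using x by (simp add: discrete_simplex_def)
  qed
  then show "finite (?f ` discrete_simplex n d)"
    by (rule finite_subset) (auto intro: finite_PiE)
  show "inj_on ?f (discrete_simplex n d)"
  proof (rule inj_onI)
    fix x y assume *: "x \<in> discrete_simplex n d" "y \<in> discrete_simplex n d" "?f x = ?f y"
    have "lk x i \<le> lk y i" for i
    proof (cases "i < n")
      case True
      then show ?thesis using fun_cong[OF *(3), of i] by simp
    next
      case False
      then show ?thesis using discrete_simplex_lookup_less[OF *(1), of i] by (cases "lk x i = 0") auto
    qed
    then show "x = y" using discrete_simplex_eqI[OF *(1,2)] by blast
  qed
qed

locale M_convex_subset =
  fixes n d :: nat and J :: "expo set"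
  assumes J_sub: "J \<subseteq> discrete_simplex n d" and J_conv: "M_convex J"
begin

lemma finite_J: "finite J"
  using J_sub finite_discrete_simplex finite_subset by blast

lemma J_nonempty: "J \<noteq> {}"
  using J_conv by (simp add: M_convex_def)

text \<open>Writing x = X + e_u and y = Y + e_v keeps truncated subtraction out of later
  computations. The axiom is used for the pair (y, x), since u is a coordinate where y is the
  smaller one.\<close>

lemma exchange:
  assumes x: "x \<in> J" and y: "y \<in> J" and u: "lk y u < lk x u"
  obtains v X Y where "x = X + ee u" "y = Y + ee v" "lk x v < lk y v" "X + ee v \<in> J" "Y + ee u \<in> J"
proof -
  from J_conv x y u obtain v where v: "lk y v > lk x v"
    "y + ee u - ee v \<in> J" "x - ee u + ee v \<in> J"
    unfolding M_convex_def by blast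
  have uv: "u \<noteq> v" using u v(1) by auto
  have "y + ee u - ee v = y - ee v + ee u"
    using v(1) by (intro poly_mapping_eqI) (auto simp: lookup_add lookup_minus uv)
  with v u show ?thesis
    by (intro that[of "x - ee u" "y - ee v" v]) (auto simp: expo_minus_plus_unit)
qed

text \<open>Exchange at a between the two points has to return c or f; if a already equals c or f,
  the given points themselves form one of the alternatives.\<close>

lemma support_three_term:
  assumes "g + ee a + ee b \<in> J" "g + ee c + ee f \<in> J"
  shows "(g + ee a + ee c \<in> J \<and> g + ee b + ee f \<in> J) \<or> (g + ee a + ee f \<in> J \<and> g + ee b + ee c \<in> J)"
proof (cases "a = c \<or> a = f")
  case True
  then show ?thesis using assms by (auto simp: ac_simps)
next
  case False
  let ?x = "g + ee a + ee b" and ?y = "g + ee c + ee f"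
  have "lk ?y a < lk ?x a" using False by (auto simp: lookup_add)
  with assms obtain v X Y where *: "?x = X + ee a" "?y = Y + ee v" "lk ?x v < lk ?y v"
    "X + ee v \<in> J" "Y + ee a \<in> J" by (metis exchange)
  have X: "X = g + ee b"
    by (rule add_right_imp_eq[of _ "ee a"]) (use *(1) in \<open>simp add: ac_simps\<close>)
  have v: "v = c \<or> v = f" using *(3) by (auto simp: lookup_add split: if_splits)
  have Y: "Y = g + ee f" if "v = c"
    by (rule add_right_imp_eq[of _ "ee c"]) (use *(2) that in \<open>simp add: ac_simps\<close>)
  have Y': "Y = g + ee c" if "v = f"
    by (rule add_right_imp_eq[of _ "ee f"]) (use *(2) that in \<open>simp add: ac_simps\<close>)
  from v show ?thesis
  proof
    assume "v = c"
    with Y *(4,5) show ?thesis by (simp add: X ac_simps)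
  next
    assume "v = f"
    with Y' *(4,5) show ?thesis by (simp add: X ac_simps)
  qed
qed

text \<open>Representations extended by zero to all exponents, so that relations can be written
  without membership conditions.\<close>

definition supported :: "(expo \<Rightarrow> real) \<Rightarrow> bool" where
  "supported \<rho> \<longleftrightarrow> (\<forall>x. \<rho> x \<ge> 0) \<and> (\<forall>x. \<rho> x \<noteq> 0 \<longleftrightarrow> x \<in> J)"

text \<open>The relations with s = 2 over T_0. Permuting b, c and f bounds each of the three
  products by the larger of the other two, so the maximum is attained twice.\<close>

definition weak_zero :: "(expo \<Rightarrow> real) \<Rightarrow> bool" where
  "weak_zero \<rho> \<longleftrightarrow> (\<forall>g a b c f. \<rho> (g + ee a + ee b) * \<rho> (g + ee c + ee f) \<le>
     max (\<rho> (g + ee a + ee c) * \<rho> (g + ee b + ee f)) (\<rho> (g + ee a + ee f) * \<rho> (g + ee b + ee c)))"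

text \<open>The relations with s = 2 over T_infinity: when one of the three products vanishes, the
  other two must agree; permuting indices covers every choice.\<close>

definition weak_infty :: "(expo \<Rightarrow> real) \<Rightarrow> bool" where
  "weak_infty \<rho> \<longleftrightarrow> (\<forall>g a b c f. \<rho> (g + ee a + ee f) * \<rho> (g + ee b + ee c) = 0 \<longrightarrow>
     \<rho> (g + ee a + ee b) * \<rho> (g + ee c + ee f) = \<rho> (g + ee a + ee c) * \<rho> (g + ee b + ee f))"

text \<open>Truncated subtraction makes this the sum of the positive parts of x - y, half the
  l1-distance for points of equal degree. It is the induction measure of both exchange
  arguments.\<close>

definition excess :: "expo \<Rightarrow> expo \<Rightarrow> nat" where
  "excess x y = (\<Sum>i<n. lk x i - lk y i)"

lemma excess_less:
  assumes "\<And>i. lk x' i - lk y' i \<le> lk x i - lk y i" "k < n" "lk x' k - lk y' k < lk x k - lk y k"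
  shows "excess x' y' < excess x y"
  unfolding excess_def using assms by (intro sum_strict_mono_ex1) auto

(* The weights w encode simultaneously that all products rho(x - e_u + e_v) rho(y - e_v + e_u) are
   smaller than rho(x) rho(y); unlike that condition, they survive replacing y by a point closer to x. *)
definition exchange_failure :: "(expo \<Rightarrow> real) \<Rightarrow> expo \<Rightarrow> expo \<Rightarrow> nat \<Rightarrow> (nat \<Rightarrow> real) \<Rightarrow> bool" where
  "exchange_failure \<rho> x y u w \<longleftrightarrow> x \<in> J \<and> y \<in> J \<and> lk y u < lk x u \<and>
     (\<forall>v. lk x v < lk y v \<longrightarrow> w v > 0 \<and>
        w v * \<rho> (x - ee u + ee v) \<le> \<rho> x \<and> \<rho> (y - ee v + ee u) < w v * \<rho> y)"

lemma J_add_unitD: "X + ee i \<in> J \<Longrightarrow> i < n \<and> X \<in> discrete_simplex n (d - 1) \<and> 0 < d"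
proof -
  assume "X + ee i \<in> J"
  then have *: "X + ee i \<in> discrete_simplex n d" using J_sub by auto
  then have "i < n" using discrete_simplex_lookup_less[of "X + ee i" n d i] by (auto simp: lookup_add)
  then have "0 < d" using * by (auto simp: discrete_simplex_def lookup_add sum.distrib)
  with * show ?thesis using discrete_simplex_plus_unit_iff[of X i n "d - 1"] by auto
qed

text \<open>Local-to-global principle: a failure for (x, y) is passed on to a point y' closer to x,
  until x and y differ by a single exchange, where the two inequalities for w contradict each
  other.\<close>

lemma no_exchange_failure:
  assumes sup: "supported \<rho>" and wz: "weak_zero \<rho>"
  shows "\<not> exchange_failure \<rho> x y u w"
proof (induction "excess x y" arbitrary: y rule: less_induct)
  case less
  note pos = sup[unfolded supported_def]
  show ?case
  proof
    assume F: "exchange_failure \<rho> x y u w"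
    then have x: "x \<in> J" and y: "y \<in> J" and u: "lk y u < lk x u"
      and w: "\<And>v. lk x v < lk y v \<Longrightarrow> w v > 0"
      and w1: "\<And>v. lk x v < lk y v \<Longrightarrow> w v * \<rho> (x - ee u + ee v) \<le> \<rho> x"
      and w2: "\<And>v. lk x v < lk y v \<Longrightarrow> \<rho> (y - ee v + ee u) < w v * \<rho> y"
      by (auto simp: exchange_failure_def)
    show False
    \<comment> \<open>The coordinate u itself qualifies only with a surplus of at least 2, so that x
      still exceeds the new point there.\<close>
    proof (cases "\<exists>u0. lk y u0 < lk x u0 \<and> (u0 = u \<longrightarrow> lk y u + 2 \<le> lk x u)")
      case False
      then have le: "lk x i \<le> lk y i" if "i \<noteq> u" for i using that by (meson not_le)
      have xu: "lk x u = lk y u + 1" using False u by (metis Suc_leI add_2_eq_Suc' le_neq_implies_less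
        not_less_eq_eq Suc_eq_plus1)
      obtain v X Y where *: "x = X + ee u" "y = Y + ee v" "lk x v < lk y v" "X + ee v \<in> J" "Y + ee u \<in> J"
        using exchange[OF x y u] by metis
      have "X = Y"
      proof (rule discrete_simplex_eqI)
        show "X \<in> discrete_simplex n (d - 1)" using J_add_unitD *(1) x by auto
        show "Y \<in> discrete_simplex n (d - 1)" using J_add_unitD *(2) y by auto
        have "u \<noteq> v" using *(3) u by auto
        then have "lk X i = lk x i - (if i = u then 1 else 0)" "lk Y i = lk y i - (if i = v then 1 else 0)" for i
          by (simp_all add: *(1,2) lookup_add)
        then show "lk X i \<le> lk Y i" for i
          using le[of i] xu *(3) \<open>u \<noteq> v\<close> by (cases "i = u") auto
      qed
      then show False using w1[OF *(3)] w2[OF *(3)] *(1,2) by simp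
    next
      case True
      then obtain u0 where u0: "lk y u0 < lk x u0" "u0 = u \<Longrightarrow> lk y u + 2 \<le> lk x u" by blast
      define V where "V = {v. lk x v < lk y v \<and> y - ee v + ee u0 \<in> J}"
      have "V \<subseteq> {..<n}"
      proof
        fix v assume "v \<in> V"
        then have "0 < lk y v" by (auto simp: V_def)
        then show "v \<in> {..<n}" using discrete_simplex_lookup_less[of y n d v] y J_sub by auto
      qed
      then have finV: "finite V" by (rule finite_subset) simp
      obtain v1 where "v1 \<in> V"
      proof -
        obtain v X Y where "x = X + ee u0" "y = Y + ee v" "lk x v < lk y v" "X + ee v \<in> J" "Y + ee u0 \<in> J"
          using exchange[OF x y u0(1)] by metis
        then show ?thesis by (intro that[of v]) (auto simp: V_def)
      qed
      \<comment> \<open>Maximality of this ratio is what bounds the product of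
        \<open>\<rho> (y - ee v0 + ee u)\<close> and \<open>\<rho> (y - ee v + ee u0)\<close> in the
        three-term relation below.\<close>
      then obtain v0 where v0V: "v0 \<in> V"
        and v0max: "\<And>v. v \<in> V \<Longrightarrow> \<rho> (y - ee v + ee u0) / w v \<le> \<rho> (y - ee v0 + ee u0) / w v0"
        using ex_is_arg_min_if_finite[OF finV, of "\<lambda>v. - (\<rho> (y - ee v + ee u0) / w v)"]
        unfolding is_arg_min_def by (metis empty_iff linorder_not_less neg_less_iff_less)
      have v0: "lk x v0 < lk y v0" "y - ee v0 + ee u0 \<in> J" using v0V by (auto simp: V_def)
      have max: "w v0 * \<rho> (y - ee v + ee u0) \<le> w v * \<rho> (y - ee v0 + ee u0)" if "lk x v < lk y v" for v
      proof (cases "v \<in> V")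
        case True
        then show ?thesis using v0max[OF True] w[OF that] w[OF v0(1)] by (simp add: field_simps)
      next
        case False
        then have "\<rho> (y - ee v + ee u0) = 0" using that pos by (auto simp: V_def)
        then show ?thesis using w[OF that] pos by simp
      qed
      define y' where "y' = y - ee v0 + ee u0"
      have u0v0: "u0 \<noteq> v0" using u0 v0 by auto
      have ly': "lk y' i = (if i = v0 then lk y i - 1 else if i = u0 then lk y i + 1 else lk y i)" for i
        using u0v0 by (auto simp: y'_def lookup_add lookup_minus)
      have y'J: "y' \<in> J" using v0 by (simp add: y'_def)
      have py': "\<rho> y' > 0" using y'J pos by (metis order_le_less)
      have "exchange_failure \<rho> x y' u w"
        unfolding exchange_failure_def
      proof (intro conjI allI impI x y'J)
        show "lk y' u < lk x u" using u u0 by (auto simp: ly')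
        fix v assume v: "lk x v < lk y' v"
        then have vy: "lk x v < lk y v" using u0 by (auto simp: ly' split: if_splits)
        show "w v > 0" using w vy .
        show "w v * \<rho> (x - ee u + ee v) \<le> \<rho> x" using w1 vy .
        define S where "S = y - ee v0 - ee v"
        have vu0: "v \<noteq> u0" using u0 vy by auto
        have vu: "v \<noteq> u" using u vy by auto
        have "lk y v0 \<ge> (if v = v0 then 2 else 1)" "lk y v \<ge> 1" using v vy v0 by (auto simp: ly')
        then have S: "y = S + ee v + ee v0"
          by (intro poly_mapping_eqI) (auto simp: S_def lookup_add lookup_minus)
        have e1: "y - ee v0 = S + ee v" "y - ee v = S + ee v0"
          unfolding S by (auto intro!: poly_mapping_eqI simp: lookup_add lookup_minus)
        have e2: "y' - ee v + ee u = S + ee u + ee u0"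
          unfolding y'_def e1 by (auto intro!: poly_mapping_eqI simp: lookup_add lookup_minus)
        have "\<rho> (S + ee u + ee u0) * \<rho> (S + ee v + ee v0) \<le>
          max (\<rho> (S + ee u + ee v) * \<rho> (S + ee u0 + ee v0)) (\<rho> (S + ee u + ee v0) * \<rho> (S + ee u0 + ee v))"
          using wz unfolding weak_zero_def by blast
        also have "\<dots> < w v * \<rho> y' * \<rho> y"
        proof -
          have "\<rho> (S + ee u + ee v0) < w v * \<rho> y"
            using w2[OF vy] unfolding e1 by (simp add: ac_simps)
          then have A: "\<rho> (S + ee u + ee v0) * \<rho> (S + ee u0 + ee v) < w v * \<rho> y * \<rho> y'"
            using py' by (simp add: y'_def e1 ac_simps)
          have 1: "\<rho> (S + ee u + ee v) < w v0 * \<rho> y"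
            using w2[OF v0(1)] unfolding e1 by (simp add: ac_simps)
          have 2: "w v0 * \<rho> (S + ee u0 + ee v0) \<le> w v * \<rho> y'"
            using max[OF vy] unfolding y'_def e1 by (simp add: ac_simps)
          have "w v0 * (\<rho> (S + ee u + ee v) * \<rho> (S + ee u0 + ee v0)) \<le> \<rho> (S + ee u + ee v) * (w v * \<rho> y')"
            using mult_left_mono[OF 2, of "\<rho> (S + ee u + ee v)"] pos by (simp add: ac_simps)
          also have "\<dots> < w v0 * \<rho> y * (w v * \<rho> y')"
            using 1 w[OF vy] py' by (intro mult_strict_right_mono) auto
          finally have "\<rho> (S + ee u + ee v) * \<rho> (S + ee u0 + ee v0) < \<rho> y * (w v * \<rho> y')"
            using w[OF v0(1)] by (simp add: ac_simps)
          with A show ?thesis by (simp add: ac_simps)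
        qed
        finally have "\<rho> (S + ee u + ee u0) * \<rho> y < w v * \<rho> y' * \<rho> y" by (simp add: S)
        moreover have "\<rho> y \<ge> 0" using pos by auto
        ultimately show "\<rho> (y' - ee v + ee u) < w v * \<rho> y'"
          unfolding e2 by (metis mult_le_cancel_right linorder_not_less)
      qed
      moreover have "excess x y' < excess x y"
      proof (rule excess_less)
        show "u0 < n" using u0(1) x J_sub discrete_simplex_lookup_less[of x n d u0] by auto
      qed (use u0 v0 in \<open>auto simp: ly'\<close>)
      ultimately show False using less by blast
    qed
  qed
qed

lemma valuated_exchange:
  assumes sup: "supported \<rho>" and wz: "weak_zero \<rho>"
    and x: "x \<in> J" and y: "y \<in> J" and u: "lk y u < lk x u"
  obtains v where "lk x v < lk y v" "\<rho> x * \<rho> y \<le> \<rho> (x - ee u + ee v) * \<rho> (y - ee v + ee u)"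
proof (rule ccontr)
  assume "\<not> thesis"
  with that have *: "\<not> (\<exists>v. lk x v < lk y v \<and> \<rho> x * \<rho> y \<le> \<rho> (x - ee u + ee v) * \<rho> (y - ee v + ee u))"
    by blast
  have lt: "\<rho> (x - ee u + ee v) * \<rho> (y - ee v + ee u) < \<rho> x * \<rho> y" if "lk x v < lk y v" for v
    using that * by (meson linorder_not_less)
  note pos = sup[unfolded supported_def]
  have px: "\<rho> x > 0" and py: "\<rho> y > 0" using x y pos by (metis order_le_less)+
  \<comment> \<open>The weight must lie above \<open>\<rho> (y - ee v + ee u) / \<rho> y\<close> and
    must not exceed \<open>\<rho> x / \<rho> (x - ee u + ee v)\<close>. If the last denominator is
    zero only the lower bound matters, hence the summand 1.\<close>
  define w where "w v = (if \<rho> (x - ee u + ee v) = 0 then \<rho> (y - ee v + ee u) / \<rho> y + 1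
     else \<rho> x / \<rho> (x - ee u + ee v))" for v
  have "exchange_failure \<rho> x y u w"
    unfolding exchange_failure_def
  proof (intro conjI allI impI x y u)
    fix v assume v: "lk x v < lk y v"
    have nn: "\<rho> (x - ee u + ee v) \<ge> 0" "\<rho> (y - ee v + ee u) \<ge> 0" using pos by auto
    show "0 < w v" using px py nn by (auto simp: w_def divide_simps add_nonneg_pos)
    show "w v * \<rho> (x - ee u + ee v) \<le> \<rho> x" using px by (auto simp: w_def)
    show "\<rho> (y - ee v + ee u) < w v * \<rho> y"
    proof (cases "\<rho> (x - ee u + ee v) = 0")
      case True
      then show ?thesis using py by (simp add: w_def field_simps)
    next
      case False
      then have "\<rho> (x - ee u + ee v) > 0" using nn by linarith
      then show ?thesis using lt[OF v] by (simp add: w_def field_simps)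
    qed
  qed
  then show False using no_exchange_failure[OF sup wz] by blast
qed

end

section \<open>Weak and strong representations\<close>

lemma lookup_sum: "lk (\<Sum>m\<in>F. h m) l = (\<Sum>m\<in>F. lk (h m) l)"
  by (induction F rule: infinite_finite_induct) (auto simp: lookup_add)

lemma nth_map_upt_less: "i \<le> s \<Longrightarrow> map T [0..<Suc s] ! i = T i"
  by (simp add: nth_map_upt del: upt_Suc)

text \<open>Applied to a maximal term, the second hypothesis produces another maximal one.\<close>

lemma zero_null_mapI:
  assumes nn: "\<And>k. k \<le> s \<Longrightarrow> 0 \<le> T k"
    and ex: "\<And>k. k \<le> s \<Longrightarrow> T k \<noteq> 0 \<Longrightarrow> \<exists>k'\<le>s. k' \<noteq> k \<and> T k \<le> T k'"
  shows "zero_null (map T [0..<Suc s])"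
proof -
  let ?S = "set (map T [0..<Suc s])"
  have S: "?S = T ` {..s}" by (auto simp: atLeast0LessThan lessThan_Suc_atMost simp del: upt_Suc)
  have "Max ?S \<in> ?S" by (rule Max_in) auto
  then obtain k where k: "k \<le> s" "T k = Max ?S" unfolding S by (elim imageE) (metis atMost_iff)
  have le: "T j \<le> Max ?S" if "j \<le> s" for j using that unfolding S by (intro Max_ge) auto
  have cnt: "count_list (map T [0..<Suc s]) x = card {j. j \<le> s \<and> T j = x}" for x
  proof -
    have "count_list (map T [0..<Suc s]) x = card {i. i < Suc s \<and> x = map T [0..<Suc s] ! i}"
      by (simp add: count_list_eq_length_filter length_filter_conv_card del: upt_Suc)
    also have "{i. i < Suc s \<and> x = map T [0..<Suc s] ! i} = {j. j \<le> s \<and> T j = x}"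
      using nth_map_upt_less[of _ s T] by (intro Collect_cong) (metis less_Suc_eq_le)
    finally show ?thesis .
  qed
  show ?thesis
  proof (cases "T k = 0")
    case True
    have "T j = 0" if "j \<le> s" for j using le[OF that] nn[OF that] k True by simp
    then have "\<forall>b\<in>?S. b = 0" unfolding S by blast
    then show ?thesis by (simp add: zero_null_def)
  next
    case False
    then obtain k' where k': "k' \<le> s" "k' \<noteq> k" "T k \<le> T k'" using ex k by blast
    have "T k' = Max ?S" using le[OF k'(1)] k'(3)[unfolded k(2)] by (rule order_antisym)
    then have "card {k, k'} \<le> card {j. j \<le> s \<and> T j = Max ?S}"
      using k k' by (intro card_mono) (auto intro: finite_subset[of _ "{..s}"])
    then show ?thesis using k' by (simp add: zero_null_def cnt del: upt_Suc)
  qed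
qed

text \<open>With fewer than three nonzero terms there are none or exactly two, and in the latter
  case the third hypothesis makes them equal.\<close>

lemma infty_null_mapI:
  assumes nn: "\<And>k. k \<le> s \<Longrightarrow> 0 \<le> T k"
    and ex: "\<And>k. k \<le> s \<Longrightarrow> T k \<noteq> 0 \<Longrightarrow> \<exists>k'\<le>s. k' \<noteq> k \<and> T k' \<noteq> 0"
    and eq: "\<And>k k'. k \<le> s \<Longrightarrow> k' \<le> s \<Longrightarrow> k \<noteq> k' \<Longrightarrow> T k \<noteq> 0 \<Longrightarrow> T k' \<noteq> 0 \<Longrightarrow>
      (\<And>m. m \<le> s \<Longrightarrow> T m \<noteq> 0 \<Longrightarrow> m = k \<or> m = k') \<Longrightarrow> T k = T k'"
  shows "infty_null (map T [0..<Suc s])"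
proof (cases "length (filter (\<lambda>b. b \<noteq> 0) (map T [0..<Suc s])) \<ge> 3")
  case True
  then show ?thesis by (simp add: infty_null_def)
next
  case False
  have len: "length (filter (\<lambda>b. b \<noteq> 0) (map T [0..<Suc s])) = card {j. j \<le> s \<and> T j \<noteq> 0}"
  proof -
    have "length (filter (\<lambda>b. b \<noteq> 0) (map T [0..<Suc s])) = card {i. i < Suc s \<and> map T [0..<Suc s] ! i \<noteq> 0}"
      by (simp add: length_filter_conv_card del: upt_Suc)
    also have "{i. i < Suc s \<and> map T [0..<Suc s] ! i \<noteq> 0} = {j. j \<le> s \<and> T j \<noteq> 0}"
      using nth_map_upt_less[of _ s T] by (intro Collect_cong) (metis less_Suc_eq_le)
    finally show ?thesis .
  qed
  have fin: "finite {j. j \<le> s \<and> T j \<noteq> 0}" by (rule finite_subset[of _ "{..s}"]) auto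
  have "zero_null (map T [0..<Suc s])"
  proof (rule zero_null_mapI[OF nn])
    fix k assume k: "k \<le> s" "T k \<noteq> 0"
    then obtain k' where k': "k' \<le> s" "k' \<noteq> k" "T k' \<noteq> 0" using ex by blast
    have "m = k \<or> m = k'" if "m \<le> s" "T m \<noteq> 0" for m
    proof (rule ccontr)
      assume "\<not> ?thesis"
      then have "card {k, k', m} = 3" using k' by auto
      moreover have "card {k, k', m} \<le> card {j. j \<le> s \<and> T j \<noteq> 0}"
        using k k' that fin by (intro card_mono) auto
      ultimately show False using False len by simp
    qed
    then have "T k = T k'" using eq k k' by blast
    then show "\<exists>k'\<le>s. k' \<noteq> k \<and> T k \<le> T k'" using k' by auto
  qed
  then show ?thesis by (auto simp: infty_null_def zero_null_def)
qed

section \<open>From local relations to strong representations and back\<close>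

context M_convex_subset
begin

lemma supportedD:
  assumes "supported \<rho>"
  shows "0 \<le> \<rho> x" "\<rho> x = 0 \<longleftrightarrow> x \<notin> J" "x \<in> J \<Longrightarrow> 0 < \<rho> x"
  using assms unfolding supported_def by (auto simp: less_le)

lemma two_term_step:
  assumes sup: "supported \<rho>" and wi: "weak_infty \<rho>"
    and "g + ee a + ee f \<notin> J"
  shows "\<rho> (g + ee a + ee b) * \<rho> (g + ee c + ee f) = \<rho> (g + ee a + ee c) * \<rho> (g + ee b + ee f)"
  using assms unfolding weak_infty_def by (simp add: supportedD(2))

(* As long as A differs from B + e_l + e_l', an exchange at some x with B_x < A_x moves A towards B
   if A - e_x is not in J, and B towards A if B + e_x is not in J; one of the two holds by the last
   assumption. In matroid terms, the circuit in A and the hyperplane spanned by B are kept. *)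
lemma two_term_relation:
  assumes sup: "supported \<rho>" and wi: "weak_infty \<rho>"
    and "l \<noteq> l'" "lk A l = lk B l + 1" "lk A l' = lk B l' + 1"
    and "A - ee l \<in> J" "A - ee l' \<in> J" "B + ee l \<in> J" "B + ee l' \<in> J"
    and "\<And>k. lk B k < lk A k \<Longrightarrow> A - ee k \<in> J \<Longrightarrow> B + ee k \<in> J \<Longrightarrow> k = l \<or> k = l'"
  shows "\<rho> (A - ee l) * \<rho> (B + ee l) = \<rho> (A - ee l') * \<rho> (B + ee l')"
  using assms(3-)
proof (induction "excess A B" arbitrary: A B rule: less_induct)
  case less
  note pos = supportedD[OF sup]
  have Al: "A = A - ee l + ee l" "A = A - ee l' + ee l'" using less.prems(2,3)
    by (auto simp: expo_minus_plus_unit)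
  show ?case
  proof (cases "\<exists>x. x \<noteq> l \<and> x \<noteq> l' \<and> lk B x < lk A x")
    case False
    \<comment> \<open>The whole surplus of A over B is used up by l and l', so both sides are the
      same product.\<close>
    have "A = B + ee l + ee l'"
    proof (rule discrete_simplex_eqI)
      have l: "l < n" "0 < d" "A - ee l \<in> discrete_simplex n d" "l' < n" "B + ee l \<in> discrete_simplex n d"
        using J_add_unitD[OF less.prems(6)] J_add_unitD[OF less.prems(7)] less.prems(4,6) J_sub by auto
      from l show "A \<in> discrete_simplex n (Suc d)" by (subst Al(1)) (simp add: discrete_simplex_plus_unit_iff)
      show "B + ee l + ee l' \<in> discrete_simplex n (Suc d)"
        using l by (simp add: discrete_simplex_plus_unit_iff)
      show "lk A i \<le> lk (B + ee l + ee l') i" for i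
        using False less.prems(1-3) by (cases "i = l"; cases "i = l'") (auto simp: lookup_add not_less)
    qed
    then have "A - ee l = B + ee l'" "A - ee l' = B + ee l"
      by (simp_all, auto intro!: poly_mapping_eqI simp: lookup_add lookup_minus)
    then show ?thesis by simp
  next
    case True
    then obtain x where x: "x \<noteq> l" "x \<noteq> l'" "lk B x < lk A x" by blast
    have "lk (B + ee l) x < lk (A - ee l) x" using x by (simp add: lookup_add lookup_minus)
    with less.prems(4,6) obtain y X Y where ex: "A - ee l = X + ee x" "B + ee l = Y + ee y"
      "lk (A - ee l) y < lk (B + ee l) y" "X + ee y \<in> J" "Y + ee x \<in> J" by (metis exchange)
    have xn: "x < n" using J_add_unitD less.prems(4) ex(1) by metis
    have yx: "y \<noteq> x" using ex(3) x by (auto simp: lookup_add lookup_minus)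
    have yl': "y \<noteq> l'" using ex(3) less.prems(1,3) by (auto simp: lookup_add lookup_minus)
    show ?thesis
    proof (cases "A - ee x \<in> J")
      case False
      have "y \<noteq> l"
      proof
        assume "y = l"
        then have "A - ee l + ee l = X + ee y + ee x" using ex(1) by (simp add: ac_simps)
        then have "X + ee y = A - ee x" using Al(1) by simp
        then show False using False ex(4) by simp
      qed
      then have y: "lk A y < lk B y" using ex(3) by (simp add: lookup_add lookup_minus)
      define S where "S = A - ee l - ee l' - ee x"
      have A: "A = S + ee l + ee l' + ee x"
        using x less.prems(1-3) unfolding S_def
        by (intro poly_mapping_eqI) (auto simp: lookup_add lookup_minus)
      have Am: "A - ee l = S + ee l' + ee x" "A - ee l' = S + ee l + ee x" "A - ee x = S + ee l + ee l'"
        unfolding A by (auto intro!: poly_mapping_eqI simp: lookup_add lookup_minus)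
      have X: "X = S + ee l'" using ex(1) unfolding Am by simp
      \<comment> \<open>\<open>A2\<close> replaces x by y in A. Because \<open>A - ee x\<close> is
        outside J, the support relation has only one alternative left and the two-term step
        applies.\<close>
      define A2 where "A2 = S + ee l + ee l' + ee y"
      have A2m: "A2 - ee l = S + ee l' + ee y" "A2 - ee l' = S + ee l + ee y"
        unfolding A2_def by (auto intro!: poly_mapping_eqI simp: lookup_add lookup_minus)
      have J1: "A2 - ee l \<in> J" using ex(4) unfolding A2m X by simp
      have J2: "A2 - ee l' \<in> J"
        using support_three_term[of S l x l' y] less.prems(5) J1 False unfolding A2m Am by (auto simp: ac_simps)
      have lA2: "lk A2 i = (if i = y then lk A i + 1 else if i = x then lk A i - 1 else lk A i)" for i
        using yx unfolding A2_def A by (auto simp: lookup_add)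
      have IH: "\<rho> (A2 - ee l) * \<rho> (B + ee l) = \<rho> (A2 - ee l') * \<rho> (B + ee l')"
      proof (rule less.hyps)
        show "excess A2 B < excess A B"
          by (rule excess_less[OF _ xn]) (use x y yx in \<open>auto simp: lA2\<close>)
        show "l \<noteq> l'" "B + ee l \<in> J" "B + ee l' \<in> J" using less.prems by auto
        show "lk A2 l = lk B l + 1" "lk A2 l' = lk B l' + 1"
          using less.prems(2,3) x \<open>y \<noteq> l\<close> yl' by (auto simp: lA2)
        show "A2 - ee l \<in> J" "A2 - ee l' \<in> J" by (fact J1 J2)+
        fix k assume k: "lk B k < lk A2 k" "A2 - ee k \<in> J" "B + ee k \<in> J"
        show "k = l \<or> k = l'"
        proof (rule ccontr)
          assume n: "\<not> ?thesis"
          have ky: "k \<noteq> y" using k(1) y by (auto simp: lA2)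
          have "lk B k < lk A k" using k(1) ky by (auto simp: lA2 split: if_splits)
          with less.prems(8) k(3) n have Ak: "A - ee k \<notin> J" by blast
          have "lk S k > 0" using k(1) n ky unfolding A2_def by (auto simp: lookup_add)
          then obtain T where S: "S = T + ee k" by (metis expo_minus_plus_unit)
          have a: "A2 - ee k = T + ee l' + ee l + ee y" "A - ee k = T + ee l' + ee x + ee l"
            unfolding A2_def A S by (auto intro!: poly_mapping_eqI simp: lookup_add lookup_minus)
          have b: "A - ee x = T + ee l' + ee k + ee l" "A - ee l = T + ee l' + ee k + ee x"
            unfolding Am S by (simp_all add: ac_simps)
          \<comment> \<open>Exchange between \<open>A - ee l\<close> and \<open>A2 - ee k\<close>
            would put \<open>A - ee x\<close> or \<open>A - ee k\<close> into J.\<close>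
          show False
            using support_three_term[of "T + ee l'" k x l y] less.prems(4) k(2) Ak False
            unfolding a b by (auto simp: ac_simps)
        qed
      qed
      have "\<rho> (S + ee l + ee x) * \<rho> (S + ee y + ee l') = \<rho> (S + ee l + ee y) * \<rho> (S + ee x + ee l')"
        by (rule two_term_step[OF sup wi]) (use False Am in simp)
      then have "\<rho> (A - ee l') * \<rho> (A2 - ee l) = \<rho> (A2 - ee l') * \<rho> (A - ee l)"
        unfolding Am A2m by (simp add: ac_simps)
      then have "\<rho> (A2 - ee l') * (\<rho> (A - ee l) * \<rho> (B + ee l)) = \<rho> (A - ee l') * (\<rho> (A2 - ee l) * \<rho> (B + ee l))"
        by (simp add: mult.assoc[symmetric])
      also have "\<dots> = \<rho> (A2 - ee l') * (\<rho> (A - ee l') * \<rho> (B + ee l'))" by (simp add: IH)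
      finally show ?thesis using pos(3)[OF J2] by simp
    next
      case True
      then have Bx: "B + ee x \<notin> J" using less.prems(8) x by blast
      have "y \<noteq> l"
      proof
        assume "y = l"
        then have "Y = B" using ex(2) by simp
        then show False using Bx ex(5) by simp
      qed
      then have y: "lk A y < lk B y" using ex(3) by (simp add: lookup_add lookup_minus)
      then have "B - ee y + ee y = B" by (intro expo_minus_plus_unit) simp
      then obtain S where B: "B = S + ee y" by metis
      have Y: "Y = S + ee l"
        by (rule add_right_imp_eq[of _ "ee y"]) (use ex(2) in \<open>simp add: B ac_simps\<close>)
      \<comment> \<open>Dually, \<open>B2\<close> replaces y by x in B, and \<open>B + ee x\<close>
        plays the role that \<open>A - ee x\<close> had before.\<close>
      define B2 where "B2 = S + ee x"
      have J1: "B2 + ee l \<in> J" using ex(5) unfolding B2_def Y by (simp add: ac_simps)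
      have J2: "B2 + ee l' \<in> J"
        using support_three_term[of S l x y l'] less.prems(7) J1 Bx unfolding B2_def B by (auto simp: ac_simps)
      have lB2: "lk B2 i = (if i = y then lk B i - 1 else if i = x then lk B i + 1 else lk B i)" for i
        using yx unfolding B2_def B by (auto simp: lookup_add)
      have IH: "\<rho> (A - ee l) * \<rho> (B2 + ee l) = \<rho> (A - ee l') * \<rho> (B2 + ee l')"
      proof (rule less.hyps)
        show "excess A B2 < excess A B"
          by (rule excess_less[OF _ xn]) (use x y yx in \<open>auto simp: lB2\<close>)
        show "l \<noteq> l'" "A - ee l \<in> J" "A - ee l' \<in> J" using less.prems by auto
        show "lk A l = lk B2 l + 1" "lk A l' = lk B2 l' + 1"
          using less.prems(2,3) x \<open>y \<noteq> l\<close> yl' by (auto simp: lB2)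
        show "B2 + ee l \<in> J" "B2 + ee l' \<in> J" by (fact J1 J2)+
        fix k assume k: "lk B2 k < lk A k" "A - ee k \<in> J" "B2 + ee k \<in> J"
        show "k = l \<or> k = l'"
        proof (rule ccontr)
          assume n: "\<not> ?thesis"
          have ky: "k \<noteq> y" using k(1) y by (auto simp: lB2)
          have "lk B k < lk A k" using k(1) ky by (auto simp: lB2 split: if_splits)
          with less.prems(8) k(2) n have Bk: "B + ee k \<notin> J" by blast
          show False
            using support_three_term[of S x k y l] less.prems(6) k(3) Bk Bx
            unfolding B2_def B by (auto simp: ac_simps)
        qed
      qed
      have "\<rho> (S + ee x + ee l) * \<rho> (S + ee l' + ee y) = \<rho> (S + ee x + ee l') * \<rho> (S + ee l + ee y)"
        by (rule two_term_step[OF sup wi]) (use Bx in \<open>simp add: B ac_simps\<close>)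
      then have e: "\<rho> (B2 + ee l) * \<rho> (B + ee l') = \<rho> (B2 + ee l') * \<rho> (B + ee l)"
        unfolding B2_def B by (simp add: ac_simps)
      have "\<rho> (B2 + ee l') * (\<rho> (A - ee l) * \<rho> (B + ee l)) = \<rho> (A - ee l) * (\<rho> (B2 + ee l) * \<rho> (B + ee l'))"
        by (simp add: e mult_ac)
      also have "\<dots> = \<rho> (A - ee l') * \<rho> (B2 + ee l') * \<rho> (B + ee l')"
        by (simp add: IH mult.assoc[symmetric])
      also have "\<dots> = \<rho> (B2 + ee l') * (\<rho> (A - ee l') * \<rho> (B + ee l'))" by simp
      finally show ?thesis using pos(3)[OF J2] by simp
    qed
  qed
qed

lemma supported_indicator: "supported (\<lambda>x. if x \<in> J then 1 else 0)"
  by (simp add: supported_def)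

text \<open>Viewed as a representation over T_0, the indicator turns the valuated exchange results
  into statements about supports.\<close>

lemma weak_zero_indicator: "weak_zero (\<lambda>x. if x \<in> J then 1 else 0)"
  unfolding weak_zero_def
proof (intro allI)
  fix g a b c f
  show "(if g + ee a + ee b \<in> J then 1 else 0) * (if g + ee c + ee f \<in> J then 1 else 0) \<le>
    max ((if g + ee a + ee c \<in> J then 1 else 0) * (if g + ee b + ee f \<in> J then 1 else 0))
      ((if g + ee a + ee f \<in> J then 1 else 0) * (if g + ee b + ee c \<in> J then 1 else (0::real)))"
    using support_three_term[of g a b c f] by (auto simp: max_def)
qed

lemma J_add_two_unitsD:
  assumes "g + ee a + ee b \<in> J"
  shows "a < n \<and> b < n \<and> g \<in> discrete_simplex n (d - 2) \<and> 2 \<le> d"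
proof -
  from J_add_unitD[OF assms] have *: "b < n" "g + ee a \<in> discrete_simplex n (d - 1)" "0 < d" by auto
  then have "0 < (\<Sum>k<n. lk (g + ee a) k)"
    using discrete_simplex_lookup_less[OF *(2), of a] by (auto simp: lookup_add intro!: sum_pos2[of _ a])
  then have "d - 1 = Suc (d - 2)" using * by (auto simp: discrete_simplex_def)
  then show ?thesis using * discrete_simplex_plus_unit_iff[of g a n "d - 2"] by auto
qed

definition strong_term :: "(expo \<Rightarrow> real) \<Rightarrow> nat \<Rightarrow> expo \<Rightarrow> (nat \<Rightarrow> nat) \<Rightarrow> (nat \<Rightarrow> nat) \<Rightarrow> nat \<Rightarrow> real" where
  "strong_term \<rho> s \<alpha> i j k = \<rho> (\<alpha> + (\<Sum>m\<in>{0..s} - {k}. ee (i m))) *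
     \<rho> (\<alpha> + ee (i k) + (\<Sum>m\<in>{2..s}. ee (j m)))"

text \<open>The k-th product depends on k only through i_k, which is taken from A and given to B. A
  strong relation thus concerns a single pair A, B, of degrees d + 1 and d - 1.\<close>

lemma strong_term_eq:
  assumes "k \<le> s" "A = \<alpha> + (\<Sum>m\<in>{0..s}. ee (i m))" "B = \<alpha> + (\<Sum>m\<in>{2..s}. ee (j m))"
  shows "strong_term \<rho> s \<alpha> i j k = \<rho> (A - ee (i k)) * \<rho> (B + ee (i k))"
proof -
  have "(\<Sum>m\<in>{0..s}. ee (i m)) = ee (i k) + (\<Sum>m\<in>{0..s} - {k}. ee (i m))"
    using assms(1) by (intro sum.remove) auto
  then have "A = \<alpha> + (\<Sum>m\<in>{0..s} - {k}. ee (i m)) + ee (i k)"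
    using assms by (simp add: ac_simps)
  then have "A - ee (i k) = \<alpha> + (\<Sum>m\<in>{0..s} - {k}. ee (i m))" by simp
  then show ?thesis using assms(3) by (simp add: strong_term_def ac_simps)
qed

lemma lookup_less_strong:
  fixes s :: nat
  assumes A: "A = \<alpha> + (\<Sum>m\<in>{0..s}. ee (i m))" and "lk \<alpha> l < lk A l"
  shows "\<exists>k\<le>s. i k = l"
proof (rule ccontr)
  assume "\<not> ?thesis"
  then have "(\<Sum>m\<in>{0..s}. lk (ee (i m)) l) = 0" by (intro sum.neutral) auto
  then show False using assms by (simp add: lookup_add lookup_sum)
qed

lemma lookup_strong_unique:
  fixes s :: nat
  assumes A: "A = \<alpha> + (\<Sum>m\<in>{0..s}. ee (i m))" and "k \<le> s" "\<And>k'. k' \<le> s \<Longrightarrow> i k' = i k \<Longrightarrow> k' = k"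
  shows "lk A (i k) = lk \<alpha> (i k) + 1"
proof -
  have "(\<Sum>m\<in>{0..s}. lk (ee (i m)) (i k)) = (\<Sum>m\<in>{0..s}. if m = k then 1 else 0)"
    using assms(3) by (intro sum.cong) auto
  also have "\<dots> = 1" using assms(2) by (simp add: sum.delta del: One_nat_def)
  finally show ?thesis by (simp add: A lookup_add lookup_sum)
qed

text \<open>Exchange at l = i_k between B + e_l and A - e_l: uniqueness of i_k gives A_l =
  \<alpha>_l + 1, so the first point is the larger one at l. The returned coordinate v has B_v <
  A_v, hence occurs among the i's, and the exchanged pair is its term.\<close>

lemma strong_term_exchange:
  assumes sup: "supported \<rho>" and wz: "weak_zero \<rho>" and k: "k \<le> s" "strong_term \<rho> s \<alpha> i j k \<noteq> 0"
    and A: "A = \<alpha> + (\<Sum>m\<in>{0..s}. ee (i m))" and B: "B = \<alpha> + (\<Sum>m\<in>{2..s}. ee (j m))"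
    and uniq: "\<And>k'. k' \<le> s \<Longrightarrow> i k' = i k \<Longrightarrow> k' = k"
  shows "\<exists>k'\<le>s. k' \<noteq> k \<and> strong_term \<rho> s \<alpha> i j k \<le> strong_term \<rho> s \<alpha> i j k' \<and> lk B (i k') < lk A (i k')"
proof -
  define l where "l = i k"
  have T: "strong_term \<rho> s \<alpha> i j k = \<rho> (A - ee l) * \<rho> (B + ee l)"
    unfolding l_def by (rule strong_term_eq[OF k(1) A B])
  then have J: "A - ee l \<in> J" "B + ee l \<in> J" using k(2) supportedD(2)[OF sup] by auto
  have Al: "lk A l = lk \<alpha> l + 1" unfolding l_def using lookup_strong_unique[OF A k(1)] uniq by simp
  have aB: "lk \<alpha> m \<le> lk B m" for m by (simp add: B lookup_add)
  have "lk (A - ee l) l < lk (B + ee l) l" using Al aB[of l] by (simp add: lookup_add lookup_minus)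
  then obtain v where v: "lk (B + ee l) v < lk (A - ee l) v"
    "\<rho> (B + ee l) * \<rho> (A - ee l) \<le> \<rho> (B + ee l - ee l + ee v) * \<rho> (A - ee l - ee v + ee l)"
    using valuated_exchange[OF sup wz J(2) J(1)] by metis
  have vl: "v \<noteq> l" using v(1) Al aB[of l] by (auto simp: lookup_add lookup_minus)
  have vA: "lk B v < lk A v" using v(1) vl by (simp add: lookup_add lookup_minus)
  have "A - ee l - ee v + ee l = A - ee v"
    using Al vl by (intro poly_mapping_eqI) (auto simp: lookup_add lookup_minus)
  then have ge: "\<rho> (A - ee l) * \<rho> (B + ee l) \<le> \<rho> (A - ee v) * \<rho> (B + ee v)"
    using v(2) by (simp add: ac_simps)
  obtain k' where k': "k' \<le> s" "i k' = v"
    using lookup_less_strong[OF A, of v] vA aB[of v] by auto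
  have "strong_term \<rho> s \<alpha> i j k' = \<rho> (A - ee v) * \<rho> (B + ee v)"
    using strong_term_eq[OF k'(1) A B] k'(2) by simp
  then show ?thesis using k' vl ge T vA by (intro exI[of _ k']) (auto simp: l_def)
qed

lemma strong_rep_of_null:
  assumes "supported \<rho>"
    and "\<And>s \<alpha> i j. null (map (strong_term \<rho> s \<alpha> i j) [0..<Suc s])"
  shows "strong_rep null n d J \<rho>"
  using assms J_sub unfolding strong_rep_def supported_def strong_term_def[abs_def] by auto

lemma strong_term_repeat:
  assumes "k \<le> s" "k' \<le> s" "i k' = i k"
  shows "strong_term \<rho> s \<alpha> i j k' = strong_term \<rho> s \<alpha> i j k"
  using assms by (simp add: strong_term_eq)

text \<open>A term whose index is repeated is matched by an equal term, any other by one that is at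
  least as large.\<close>

theorem weak_zero_imp_strong:
  assumes sup: "supported \<rho>" and wz: "weak_zero \<rho>"
  shows "strong_rep zero_null n d J \<rho>"
proof (rule strong_rep_of_null[OF sup], rule zero_null_mapI)
  fix s \<alpha> i j k
  show "0 \<le> strong_term \<rho> s \<alpha> i j k" by (simp add: strong_term_def supportedD(1)[OF sup])
  assume k: "k \<le> s" "strong_term \<rho> s \<alpha> i j k \<noteq> 0"
  show "\<exists>k'\<le>s. k' \<noteq> k \<and> strong_term \<rho> s \<alpha> i j k \<le> strong_term \<rho> s \<alpha> i j k'"
  proof (cases "\<exists>k'\<le>s. i k' = i k \<and> k' \<noteq> k")
    case True
    then show ?thesis using strong_term_repeat k by (metis order_refl)
  next
    case False
    then show ?thesis using strong_term_exchange[OF sup wz k refl refl] by blast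
  qed
qed

text \<open>If only the terms k and k' are nonzero and their indices differ, exchange for the
  indicator leads from each of them to the other. Hence A exceeds B by exactly one at both indices,
  and \<open>two_term_relation\<close> equates the terms; its last hypothesis holds because there is
  no further nonzero term.\<close>

theorem weak_infty_imp_strong:
  assumes sup: "supported \<rho>" and wi: "weak_infty \<rho>"
  shows "strong_rep infty_null n d J \<rho>"
proof (rule strong_rep_of_null[OF sup], rule infty_null_mapI)
  fix s \<alpha> i j k
  let ?T = "strong_term \<rho> s \<alpha> i j"
  let ?I = "strong_term (\<lambda>x. if x \<in> J then 1 else 0) s \<alpha> i j"
  show "0 \<le> ?T k" by (simp add: strong_term_def supportedD(1)[OF sup])
  have I: "?I m \<noteq> 0 \<longleftrightarrow> ?T m \<noteq> 0" for m
    unfolding strong_term_def by (auto simp: supportedD(2)[OF sup])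
  define A B where AB: "A = \<alpha> + (\<Sum>m\<in>{0..s}. ee (i m))" "B = \<alpha> + (\<Sum>m\<in>{2..s}. ee (j m))"
  have step: "\<exists>k'\<le>s. k' \<noteq> k \<and> ?T k' \<noteq> 0 \<and> lk B (i k') < lk A (i k')"
    if k: "k \<le> s" "?T k \<noteq> 0" and u: "\<And>k'. k' \<le> s \<Longrightarrow> i k' = i k \<Longrightarrow> k' = k" for k
  proof -
    obtain k' where k': "k' \<le> s" "k' \<noteq> k" "?I k \<le> ?I k'" "lk B (i k') < lk A (i k')"
      using strong_term_exchange[OF supported_indicator weak_zero_indicator k(1) _ AB u] k(2) I by metis
    have "?I k = 1" using k(2) I[of k] by (auto simp: strong_term_def split: if_splits)
    then have "?T k' \<noteq> 0" using k'(3) I[of k'] by auto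
    then show ?thesis using k' by blast
  qed
  show "\<exists>k'\<le>s. k' \<noteq> k \<and> ?T k' \<noteq> 0" if k: "k \<le> s" "?T k \<noteq> 0"
  proof (cases "\<exists>k'\<le>s. i k' = i k \<and> k' \<noteq> k")
    case True
    then show ?thesis using strong_term_repeat k by metis
  next
    case False
    then show ?thesis using step[OF k] by blast
  qed
  fix k' assume k: "k \<le> s" "k' \<le> s" "k \<noteq> k'" "?T k \<noteq> 0" "?T k' \<noteq> 0"
    and only: "\<And>m. m \<le> s \<Longrightarrow> ?T m \<noteq> 0 \<Longrightarrow> m = k \<or> m = k'"
  show "?T k = ?T k'"
  proof (cases "i k = i k'")
    case True
    then show ?thesis using strong_term_repeat k by metis
  next
    case False
    have u: "m = k" if "m \<le> s" "i m = i k" for m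
      using only[of m] strong_term_repeat[of k s m i \<rho> \<alpha> j] that k False by auto
    have u': "m = k'" if "m \<le> s" "i m = i k'" for m
      using only[of m] strong_term_repeat[of k' s m i \<rho> \<alpha> j] that k False by auto
    have lt: "lk B (i k') < lk A (i k')" using step[OF k(1,4) u] only by metis
    have lt': "lk B (i k) < lk A (i k)" using step[OF k(2,5) u'] only by metis
    have aB: "lk \<alpha> m \<le> lk B m" for m by (simp add: AB lookup_add)
    have T: "?T m = \<rho> (A - ee (i m)) * \<rho> (B + ee (i m))" if "m \<le> s" for m
      using strong_term_eq[OF that AB] .
    have J: "A - ee (i k) \<in> J" "B + ee (i k) \<in> J" "A - ee (i k') \<in> J" "B + ee (i k') \<in> J"
      using k(4,5) T[OF k(1)] T[OF k(2)] supportedD(2)[OF sup] by auto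
    show ?thesis unfolding T[OF k(1)] T[OF k(2)]
    proof (rule two_term_relation[OF sup wi False])
      show "lk A (i k) = lk B (i k) + 1" "lk A (i k') = lk B (i k') + 1"
        using lookup_strong_unique[OF AB(1) k(1) u] lookup_strong_unique[OF AB(1) k(2) u']
          lt lt' aB[of "i k"] aB[of "i k'"] by auto
      fix m assume m: "lk B m < lk A m" "A - ee m \<in> J" "B + ee m \<in> J"
      then obtain k2 where "k2 \<le> s" "i k2 = m" using lookup_less_strong[OF AB(1), of m] aB[of m] by auto
      moreover from this have "?T k2 \<noteq> 0" using m T supportedD(2)[OF sup] by simp
      ultimately show "m = i k \<or> m = i k'" using only by blast
    qed (use J in auto)
  qed
qed

text \<open>Treats both kinds of representation at once, with R the symmetric form of the respective
  three-term relation. \<open>R_twice\<close> serves the case of three zeros and the index choices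
  excluded by the bounds in strong relations, where every nonzero product coincides with another
  one.\<close>

lemma strong_rep_three_term:
  assumes rep: "strong_rep null n d J \<rho>"
    and R_null: "\<And>p q r. 0 \<le> p \<Longrightarrow> 0 \<le> q \<Longrightarrow> 0 \<le> r \<Longrightarrow> null [p, q, r] \<Longrightarrow> R p q r"
    and R_twice: "\<And>p q r. 0 \<le> p \<Longrightarrow> 0 \<le> q \<Longrightarrow> 0 \<le> r \<Longrightarrow> (p \<noteq> 0 \<Longrightarrow> p = q \<or> p = r) \<Longrightarrow>
      (q \<noteq> 0 \<Longrightarrow> q = p \<or> q = r) \<Longrightarrow> (r \<noteq> 0 \<Longrightarrow> r = p \<or> r = q) \<Longrightarrow> R p q r"
    and R_sym: "\<And>p q r. R p q r \<Longrightarrow> R q p r" "\<And>p q r. R p q r \<Longrightarrow> R p r q"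
  defines "\<sigma> \<equiv> \<lambda>x. if x \<in> J then \<rho> x else 0"
  shows "R (\<sigma> (g + ee a + ee b) * \<sigma> (g + ee c + ee f)) (\<sigma> (g + ee a + ee c) * \<sigma> (g + ee b + ee f))
    (\<sigma> (g + ee a + ee f) * \<sigma> (g + ee b + ee c))" (is "?P a b c")
proof -
  have \<sigma>: "\<sigma> x = \<rho> x" if "x \<in> discrete_simplex n d" for x
    using rep that unfolding strong_rep_def \<sigma>_def by auto
  have nn: "0 \<le> \<sigma> x" for x
    using rep J_sub unfolding strong_rep_def \<sigma>_def by auto
  have \<sigma>J: "\<sigma> x \<noteq> 0 \<Longrightarrow> x \<in> J" for x by (auto simp: \<sigma>_def split: if_splits)
  have sorted: "?P a b c" if ord: "a \<le> b" "b \<le> c" for a b c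
  proof -
    define p q r where pqr: "p = \<sigma> (g + ee a + ee b) * \<sigma> (g + ee c + ee f)"
      "q = \<sigma> (g + ee a + ee c) * \<sigma> (g + ee b + ee f)"
      "r = \<sigma> (g + ee a + ee f) * \<sigma> (g + ee b + ee c)"
    have pos: "0 \<le> p" "0 \<le> q" "0 \<le> r" unfolding pqr by (simp_all add: nn)
    show ?thesis
    proof (cases "p = 0 \<and> q = 0 \<and> r = 0")
      case True
      then show ?thesis using R_twice[OF pos] unfolding pqr by auto
    next
      case False
      then have "{g + ee a + ee b, g + ee c + ee f} \<subseteq> J \<or> {g + ee a + ee c, g + ee b + ee f} \<subseteq> J
         \<or> {g + ee a + ee f, g + ee b + ee c} \<subseteq> J" using \<sigma>J unfolding pqr by auto
      then have *: "a < n" "b < n" "c < n" "f < n" "g \<in> discrete_simplex n (d - 2)" "2 \<le> d"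
        using J_add_two_unitsD by blast+
      let ?h = "g + ee a + ee b + ee c + ee f"
      show ?thesis
      proof (cases "(\<forall>l<n. delta_min J l \<le> lk g l) \<and> (\<forall>l<n. lk ?h l \<le> delta_max J l)")
        case True
        define i where "i m = (if m = 0 then a else if m = 1 then b else c)" for m :: nat
        have set2: "{0..2} = {0, 1, 2::nat}" by auto
        have sum2: "(\<Sum>m\<in>{0..2}. ee (i m)) = ee a + ee b + ee c"
          "(\<Sum>m\<in>{0..2} - {0}. ee (i m)) = ee b + ee c"
          "(\<Sum>m\<in>{0..2} - {1}. ee (i m)) = ee a + ee c"
          "(\<Sum>m\<in>{0..2} - {2}. ee (i m)) = ee a + ee b"
          unfolding set2 by (simp_all add: i_def insert_Diff_if add.assoc)
        have "null (map (\<lambda>k. \<rho> (g + (\<Sum>m\<in>{0..2} - {k}. ee (i m))) *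
          \<rho> (g + ee (i k) + (\<Sum>m\<in>{2..2::nat}. ee f))) [0..<Suc 2])"
        proof (rule rep[unfolded strong_rep_def, THEN conjunct2, THEN conjunct2, rule_format, of 2 g i "\<lambda>_. f"],
            intro conjI)
          show "i ` {0..2} \<subseteq> {..<n}" "mono_on {0..2} i"
            using * ord by (auto simp: i_def mono_on_def)
          show "\<forall>l<n. lk (g + (\<Sum>m\<in>{0..2}. ee (i m)) + (\<Sum>m\<in>{2..2::nat}. ee f)) l \<le> delta_max J l"
            using True unfolding sum2 by (simp add: add.assoc)
        qed (use * True in \<open>auto simp: mono_on_def\<close>)
        moreover have "[0..<Suc 2] = [0, 1, 2]" by (simp add: upt_rec)
        ultimately have nl: "null [\<rho> (g + (ee b + ee c)) * \<rho> (g + ee a + ee f),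
          \<rho> (g + (ee a + ee c)) * \<rho> (g + ee b + ee f), \<rho> (g + (ee a + ee b)) * \<rho> (g + ee c + ee f)]"
          by (simp only: list.map sum2) (simp add: i_def)
        have "g + ee u + ee v \<in> discrete_simplex n d" if "u < n" "v < n" for u v
          using that * discrete_simplex_plus_unit_iff[of "g + ee u" v n "d - 1"]
            discrete_simplex_plus_unit_iff[of g u n "d - 2"] by (simp add: Suc_diff_Suc numeral_2_eq_2)
        note m = \<sigma>[OF this]
        have "null [r, q, p]"
          using nl * unfolding pqr by (simp add: m add.assoc[symmetric] mult.commute)
        then have "R r q p" using R_null pos by blast
        then have "R p q r" using R_sym by blast
        then show ?thesis unfolding pqr .
      next
        case False
        \<comment> \<open>Outside the bounds an extreme coordinate l has to occur in both factors of
          a nonzero product; swapping the two partners of l then gives another of the three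
          products, with the same value.\<close>
        have "\<exists>l. \<forall>u v w z. g + ee u + ee v \<in> J \<longrightarrow> g + ee w + ee z \<in> J \<longrightarrow>
           g + ee u + ee v + ee w + ee z = ?h \<longrightarrow> (u = l \<or> v = l) \<and> (w = l \<or> z = l)"
        proof (cases "\<forall>l<n. delta_min J l \<le> lk g l")
          case True
          then obtain l where l: "delta_max J l < lk ?h l" using False by (meson not_le)
          have *: "lk x l \<le> delta_max J l" if "x \<in> J" for x
            using that finite_J unfolding delta_max_def by (intro Max_ge) auto
          show ?thesis
          proof (intro exI[of _ l] allI impI)
            fix u v w z assume a: "g + ee u + ee v \<in> J" "g + ee w + ee z \<in> J"
              "g + ee u + ee v + ee w + ee z = ?h"
            show "(u = l \<or> v = l) \<and> (w = l \<or> z = l)"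
              using l *[OF a(1)] *[OF a(2)] unfolding a(3)[symmetric]
              by (auto simp: lookup_add split: if_splits)
          qed
        next
          case False
          then obtain l where l: "lk g l < delta_min J l" by (meson not_le)
          have *: "delta_min J l \<le> lk x l" if "x \<in> J" for x
            using that finite_J unfolding delta_min_def by (intro Min_le) auto
          show ?thesis
          proof (intro exI[of _ l] allI impI)
            fix u v w z assume a: "g + ee u + ee v \<in> J" "g + ee w + ee z \<in> J"
            show "(u = l \<or> v = l) \<and> (w = l \<or> z = l)"
              using l *[OF a(1)] *[OF a(2)] by (auto simp: lookup_add split: if_splits)
          qed
        qed
        then obtain l where l: "\<And>u v w z. g + ee u + ee v \<in> J \<Longrightarrow> g + ee w + ee z \<in> J \<Longrightarrow>
           g + ee u + ee v + ee w + ee z = ?h \<Longrightarrow> (u = l \<or> v = l) \<and> (w = l \<or> z = l)" by blast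
        have "R p q r"
        proof (rule R_twice[OF pos])
          assume "p \<noteq> 0"
          then have "g + ee a + ee b \<in> J" "g + ee c + ee f \<in> J" using \<sigma>J unfolding pqr by auto
          with l[of a b c f] have "(a = l \<or> b = l) \<and> (c = l \<or> f = l)" by (simp add: ac_simps)
          then show "p = q \<or> p = r" unfolding pqr by (auto simp: ac_simps)
        next
          assume "q \<noteq> 0"
          then have "g + ee a + ee c \<in> J" "g + ee b + ee f \<in> J" using \<sigma>J unfolding pqr by auto
          with l[of a c b f] have "(a = l \<or> c = l) \<and> (b = l \<or> f = l)" by (simp add: ac_simps)
          then show "q = p \<or> q = r" unfolding pqr by (auto simp: ac_simps)
        next
          assume "r \<noteq> 0"
          then have "g + ee a + ee f \<in> J" "g + ee b + ee c \<in> J" using \<sigma>J unfolding pqr by auto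
          with l[of a f b c] have "(a = l \<or> f = l) \<and> (b = l \<or> c = l)" by (simp add: ac_simps)
          then show "r = p \<or> r = q" unfolding pqr by (auto simp: ac_simps)
        qed
        then show ?thesis unfolding pqr .
      qed
    qed
  qed
  \<comment> \<open>Strong relations are stated for monotone index sequences; the two swaps generate
    all orders of a, b, c and permute the three products.\<close>
  have swap1: "?P a c b" if "?P a b c" for a b c
    using R_sym(1)[OF that] by (simp only: ac_simps)
  have swap2: "?P b a c" if "?P a b c" for a b c
    using R_sym(2)[OF that] by (simp only: ac_simps)
  consider "a \<le> b" "b \<le> c" | "a \<le> c" "c \<le> b" | "b \<le> a" "a \<le> c" | "b \<le> c" "c \<le> a"
    | "c \<le> a" "a \<le> b" | "c \<le> b" "b \<le> a" by linarith
  then show ?thesis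
  proof cases
    case 1
    then show ?thesis by (rule sorted)
  next
    case 2
    then show ?thesis by (rule swap1[OF sorted])
  next
    case 3
    then show ?thesis by (rule swap2[OF sorted])
  next
    case 4
    then show ?thesis by (rule swap2[OF swap1[OF sorted]])
  next
    case 5
    then show ?thesis by (rule swap1[OF swap2[OF sorted]])
  next
    case 6
    then show ?thesis by (rule swap1[OF swap2[OF swap1[OF sorted]]])
  qed
qed

lemma strong_rep_supported:
  assumes "strong_rep null n d J \<rho>"
  shows "supported (\<lambda>x. if x \<in> J then \<rho> x else 0)"
  using assms J_sub unfolding strong_rep_def supported_def by auto

theorem strong_zero_imp_weak:
  assumes "strong_rep zero_null n d J \<rho>"
  shows "weak_zero (\<lambda>x. if x \<in> J then \<rho> x else 0)"
proof -
  have null: "p \<le> max q r \<and> q \<le> max p r \<and> r \<le> max p q" if "zero_null [p, q, r]" for p q r :: real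
    using that by (auto simp: zero_null_def max_def split: if_splits)
  have twice: "p \<le> max q r \<and> q \<le> max p r \<and> r \<le> max p q"
    if "0 \<le> p" "0 \<le> q" "0 \<le> r" "p \<noteq> 0 \<Longrightarrow> p = q \<or> p = r" "q \<noteq> 0 \<Longrightarrow> q = p \<or> q = r"
      "r \<noteq> 0 \<Longrightarrow> r = p \<or> r = q" for p q r :: real
  proof (intro conjI)
    have "p = 0 \<or> p = q \<or> p = r" using that(4) by blast
    with that(2) show "p \<le> max q r" by (elim disjE) (simp_all add: le_max_iff_disj)
    have "q = 0 \<or> q = p \<or> q = r" using that(5) by blast
    with that(1) show "q \<le> max p r" by (elim disjE) (simp_all add: le_max_iff_disj)
    have "r = 0 \<or> r = p \<or> r = q" using that(6) by blast
    with that(1) show "r \<le> max p q" by (elim disjE) (simp_all add: le_max_iff_disj)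
  qed
  let ?R = "\<lambda>p q r :: real. p \<le> max q r \<and> q \<le> max p r \<and> r \<le> max p q"
  have sym: "?R q p r" "?R p r q" if "?R p q r" for p q r
    using that by (auto simp: max.commute)
  let ?\<sigma> = "\<lambda>x. if x \<in> J then \<rho> x else 0"
  have "?R (?\<sigma> (g + ee a + ee b) * ?\<sigma> (g + ee c + ee f)) (?\<sigma> (g + ee a + ee c) * ?\<sigma> (g + ee b + ee f))
    (?\<sigma> (g + ee a + ee f) * ?\<sigma> (g + ee b + ee c))" for g a b c f
    by (rule strong_rep_three_term[where R = ?R, OF assms null twice sym])
  then show ?thesis unfolding weak_zero_def by blast
qed

theorem strong_infty_imp_weak:
  assumes "strong_rep infty_null n d J \<rho>"
  shows "weak_infty (\<lambda>x. if x \<in> J then \<rho> x else 0)"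
proof -
  let ?R = "\<lambda>p q r::real. (r = 0 \<longrightarrow> p = q) \<and> (q = 0 \<longrightarrow> p = r) \<and> (p = 0 \<longrightarrow> q = r)"
  have null: "?R p q r" if "0 \<le> p" "0 \<le> q" "0 \<le> r" "infty_null [p, q, r]" for p q r :: real
    using that by (auto simp: infty_null_def max_def split: if_splits)
  have twice: "?R p q r"
    if "0 \<le> p" "0 \<le> q" "0 \<le> r" "p \<noteq> 0 \<Longrightarrow> p = q \<or> p = r" "q \<noteq> 0 \<Longrightarrow> q = p \<or> q = r"
      "r \<noteq> 0 \<Longrightarrow> r = p \<or> r = q" for p q r :: real
    using that by auto
  have sym: "?R q p r" "?R p r q" if "?R p q r" for p q r
    using that by auto
  let ?\<sigma> = "\<lambda>x. if x \<in> J then \<rho> x else 0"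
  have "?R (?\<sigma> (g + ee a + ee b) * ?\<sigma> (g + ee c + ee f)) (?\<sigma> (g + ee a + ee c) * ?\<sigma> (g + ee b + ee f))
    (?\<sigma> (g + ee a + ee f) * ?\<sigma> (g + ee b + ee c))" for g a b c f
    by (rule strong_rep_three_term[where R = ?R, OF assms null twice sym])
  then show ?thesis unfolding weak_infty_def by blast
qed

end

section \<open>Lorentzian quadratic forms\<close>

definition bform :: "'i set \<Rightarrow> ('i \<Rightarrow> 'i \<Rightarrow> real) \<Rightarrow> ('i \<Rightarrow> real) \<Rightarrow> ('i \<Rightarrow> real) \<Rightarrow> real" where
  "bform R M x y = (\<Sum>i\<in>R. \<Sum>j\<in>R. x i * M i j * y j)"

definition symmetric_on :: "'i set \<Rightarrow> ('i \<Rightarrow> 'i \<Rightarrow> real) \<Rightarrow> bool" where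
  "symmetric_on R M \<longleftrightarrow> (\<forall>i\<in>R. \<forall>j\<in>R. M i j = M j i)"

text \<open>Reversed Cauchy-Schwarz inequality. For symmetric matrices it says that at most one
  eigenvalue is positive, and in this form it is visibly closed and stable under pullback along
  linear maps.\<close>

definition lorentz_form :: "'i set \<Rightarrow> ('i \<Rightarrow> 'i \<Rightarrow> real) \<Rightarrow> bool" where
  "lorentz_form R M \<longleftrightarrow>
     (\<forall>x y. 0 < bform R M x x \<longrightarrow> bform R M x x * bform R M y y \<le> (bform R M x y)\<^sup>2)"

lemma bform_cong:
  assumes "\<And>i j. i \<in> R \<Longrightarrow> j \<in> R \<Longrightarrow> M i j = M' i j" "\<And>i. i \<in> R \<Longrightarrow> x i = x' i" "\<And>i. i \<in> R \<Longrightarrow> y i = y' i"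
  shows "bform R M x y = bform R M' x' y'"
  unfolding bform_def using assms by (intro sum.cong) auto

lemma bform_commute:
  assumes "symmetric_on R M"
  shows "bform R M x y = bform R M y x"
proof -
  have "bform R M x y = (\<Sum>j\<in>R. \<Sum>i\<in>R. x i * M i j * y j)"
    unfolding bform_def by (rule sum.swap)
  also have "\<dots> = bform R M y x"
    unfolding bform_def using assms by (intro sum.cong) (auto simp: symmetric_on_def)
  finally show ?thesis .
qed

lemma bform_add_left: "bform R M (\<lambda>i. x i + y i) z = bform R M x z + bform R M y z"
  by (simp add: bform_def algebra_simps sum.distrib)

lemma bform_add_right: "bform R M x (\<lambda>i. y i + z i) = bform R M x y + bform R M x z"
  by (simp add: bform_def algebra_simps sum.distrib)

lemma bform_scale_left: "bform R M (\<lambda>i. c * x i) y = c * bform R M x y"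
  by (simp add: bform_def sum_distrib_left mult_ac)

lemma bform_scale_right: "bform R M x (\<lambda>i. c * y i) = c * bform R M x y"
  by (simp add: bform_def sum_distrib_left mult_ac)

lemma bform_diff_scale:
  assumes "symmetric_on R M"
  shows "bform R M (\<lambda>i. y i - s * x i) (\<lambda>i. y i - s * x i) =
    bform R M y y - 2 * s * bform R M x y + s\<^sup>2 * bform R M x x"
proof -
  have "(\<lambda>i. y i - s * x i) = (\<lambda>i. y i + (- s) * x i)" by simp
  then show ?thesis
    using bform_commute[OF assms, of y x]
    by (simp only: bform_add_left bform_add_right bform_scale_left bform_scale_right)
      (simp add: power2_eq_square algebra_simps)
qed

lemma bform_right_functional: "bform R M w z = (\<Sum>j\<in>R. (\<Sum>i\<in>R. w i * M i j) * z j)"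
  unfolding bform_def by (subst sum.swap) (simp add: sum_distrib_right)

text \<open>A vector x with positive value is not in the kernel of l, so any y can be moved into
  this kernel by a multiple of x; expanding the nonpositive value there gives the
  inequality.\<close>

lemma lorentz_formI:
  assumes sym: "symmetric_on R M"
    and neg: "\<And>z. (\<Sum>i\<in>R. l i * z i) = 0 \<Longrightarrow> bform R M z z \<le> 0"
  shows "lorentz_form R M"
  unfolding lorentz_form_def
proof (intro allI impI)
  fix x y assume x: "0 < bform R M x x"
  define s where "s = (\<Sum>i\<in>R. l i * y i) / (\<Sum>i\<in>R. l i * x i)"
  have "(\<Sum>i\<in>R. l i * x i) \<noteq> 0" using neg[of x] x by force
  then have "(\<Sum>i\<in>R. l i * y i) - s * (\<Sum>i\<in>R. l i * x i) = 0" by (simp add: s_def)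
  then have "(\<Sum>i\<in>R. l i * (y i - s * x i)) = 0"
    by (simp add: sum_subtractf sum_distrib_left right_diff_distrib mult.left_commute)
  from neg[OF this] have "bform R M y y - 2 * s * bform R M x y + s\<^sup>2 * bform R M x x \<le> 0"
    by (simp only: bform_diff_scale[OF sym])
  then have "bform R M x x * (bform R M y y - 2 * s * bform R M x y + s\<^sup>2 * bform R M x x) \<le> 0"
    using x by (simp add: mult_le_0_iff)
  moreover have "0 \<le> (bform R M x y - s * bform R M x x)\<^sup>2" by simp
  ultimately show "bform R M x x * bform R M y y \<le> (bform R M x y)\<^sup>2"
    by (simp add: power2_eq_square algebra_simps)
qed

lemma lorentz_form_neg:
  assumes "lorentz_form R M" "0 < bform R M w w" "bform R M w z = 0"
  shows "bform R M z z \<le> 0"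
  using assms unfolding lorentz_form_def by (metis power_zero_numeral mult_le_0_iff not_le)

lemma lorentz_form_cong:
  assumes "\<And>i j. i \<in> R \<Longrightarrow> j \<in> R \<Longrightarrow> M i j = M' i j"
  shows "lorentz_form R M = lorentz_form R M'"
proof -
  have "bform R M = bform R M'" by (intro ext bform_cong assms) auto
  then show ?thesis by (simp add: lorentz_form_def)
qed

lemma lorentz_form_scale:
  assumes "lorentz_form R M"
  shows "lorentz_form R (\<lambda>i j. e i * M i j * e j)"
proof -
  have "bform R (\<lambda>i j. e i * M i j * e j) x y = bform R M (\<lambda>i. e i * x i) (\<lambda>i. e i * y i)" for x y
    by (simp add: bform_def mult_ac)
  then show ?thesis using assms by (simp add: lorentz_form_def)
qed

lemma bform_pullback:
  assumes "finite R'" "finite R" "\<And>a. a \<in> R' \<Longrightarrow> f a \<in> R"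
  shows "bform R' (\<lambda>a b. s a * M (f a) (f b) * s b) x y =
    bform R M (\<lambda>i. \<Sum>a\<in>{a\<in>R'. f a = i}. s a * x a) (\<lambda>i. \<Sum>a\<in>{a\<in>R'. f a = i}. s a * y a)"
proof -
  have gr: "(\<Sum>i\<in>R. \<Sum>a\<in>{a\<in>R'. f a = i}. h a) = (\<Sum>a\<in>R'. h a)" for h :: "_ \<Rightarrow> real"
    by (rule sum.group) (use assms in auto)
  have "bform R M (\<lambda>i. \<Sum>a\<in>{a\<in>R'. f a = i}. s a * x a) (\<lambda>i. \<Sum>a\<in>{a\<in>R'. f a = i}. s a * y a) =
    (\<Sum>i\<in>R. \<Sum>j\<in>R. \<Sum>a\<in>{a\<in>R'. f a = i}. \<Sum>b\<in>{b\<in>R'. f b = j}. s a * x a * M i j * (s b * y b))"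
    unfolding bform_def by (simp only: sum_distrib_right, simp only: sum_distrib_left)
  also have "\<dots> = (\<Sum>i\<in>R. \<Sum>a\<in>{a\<in>R'. f a = i}. \<Sum>j\<in>R. \<Sum>b\<in>{b\<in>R'. f b = j}. s a * x a * M i j * (s b * y b))"
    by (rule sum.cong[OF refl], rule sum.swap)
  also have "\<dots> = (\<Sum>i\<in>R. \<Sum>a\<in>{a\<in>R'. f a = i}. \<Sum>j\<in>R. \<Sum>b\<in>{b\<in>R'. f b = j}. s a * x a * M (f a) (f b) * (s b * y b))"
    by (intro sum.cong) auto
  also have "\<dots> = bform R' (\<lambda>a b. s a * M (f a) (f b) * s b) x y"
    unfolding gr bform_def by (simp add: mult_ac)
  finally show ?thesis ..
qed

text \<open>Pullback along a linear map. Since f may identify indices, this covers restriction,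
  repeated indices and diagonal congruences alike.\<close>

lemma lorentz_form_pullback:
  assumes "lorentz_form R M" "finite R'" "finite R" "\<And>a. a \<in> R' \<Longrightarrow> f a \<in> R"
  shows "lorentz_form R' (\<lambda>a b. s a * M (f a) (f b) * s b)"
  unfolding lorentz_form_def
proof (intro allI impI)
  fix x y
  let ?M = "\<lambda>a b. s a * M (f a) (f b) * s b"
  let ?p = "\<lambda>x i. \<Sum>a\<in>{a\<in>R'. f a = i}. s a * x a"
  have *: "bform R' ?M x y = bform R M (?p x) (?p y)" for x y
    by (rule bform_pullback) (use assms in auto)
  assume "0 < bform R' ?M x x"
  then show "bform R' ?M x x * bform R' ?M y y \<le> (bform R' ?M x y)\<^sup>2"
    using assms(1) unfolding lorentz_form_def * by blast
qed

lemma lorentz_form_subset: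
  assumes "lorentz_form R M" "finite R" "R' \<subseteq> R"
  shows "lorentz_form R' M"
  using lorentz_form_pullback[OF assms(1) _ assms(2), of R' id "\<lambda>_. 1"] assms finite_subset by auto

text \<open>The quadratic form only decreases, so a vector w positive for the new form is positive
  for M, and both forms are nonpositive on the M-orthogonal complement of w.\<close>

lemma lorentz_form_diagonal:
  assumes lor: "lorentz_form R M" and sym: "symmetric_on R M" and fin: "finite R"
    and p: "\<And>i. i \<in> R \<Longrightarrow> 0 \<le> p i"
  shows "lorentz_form R (\<lambda>i j. M i j - (if i = j then p i else 0))" (is "lorentz_form R ?M")
proof -
  have eq: "bform R ?M x x = bform R M x x - (\<Sum>i\<in>R. p i * (x i)\<^sup>2)" for x
  proof -
    have "x i * (M i j - (if i = j then p i else 0)) * x j =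
      x i * M i j * x j - (if i = j then p j * (x j)\<^sup>2 else 0)" for i j
      by (simp add: power2_eq_square algebra_simps)
    then show ?thesis unfolding bform_def by (simp add: sum_subtractf fin)
  qed
  have le: "bform R ?M x x \<le> bform R M x x" for x
    unfolding eq using p by (simp add: sum_nonneg)
  show ?thesis
  proof (cases "\<exists>w. 0 < bform R ?M w w")
    case True
    then obtain w where "0 < bform R M w w" using le order_less_le_trans by blast
    note neg = lorentz_form_neg[OF lor this]
    show ?thesis
    proof (rule lorentz_formI)
      show "symmetric_on R ?M" using sym by (auto simp: symmetric_on_def)
      fix z assume "(\<Sum>j\<in>R. (\<Sum>i\<in>R. w i * M i j) * z j) = 0"
      then show "bform R ?M z z \<le> 0"
        using neg[of z] le[of z] unfolding bform_right_functional[of R M w z] by linarith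
    qed
  next
    case False
    then show ?thesis by (auto simp: lorentz_form_def)
  qed
qed

text \<open>Pulling back to four positions lets the indices coincide. The diagonal is then removed,
  and reversed Cauchy-Schwarz is tested on a vector x at the positions of a, b and a vector y at
  those of c, f. The bounds s, t, u, v stay positive, as the test vectors require, even where an
  entry is zero.\<close>

lemma lorentz_form_three_term_strict:
  fixes R :: "'i set"
  assumes lor: "lorentz_form R M" and sym: "symmetric_on R M" and fin: "finite R"
    and nn: "\<And>i j. i \<in> R \<Longrightarrow> j \<in> R \<Longrightarrow> 0 \<le> M i j"
    and R: "a \<in> R" "b \<in> R" "c \<in> R" "f \<in> R"
    and pos: "0 < s" "0 < t" "0 < u" "0 < v"
    and bnd: "M a c \<le> s\<^sup>2" "M b f \<le> t\<^sup>2" "M a f \<le> u\<^sup>2" "M b c \<le> v\<^sup>2"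
  shows "M a b * M c f \<le> (s * t + u * v)\<^sup>2"
proof (cases "M a b * M c f = 0")
  case False
  then have pp: "0 < M a b" "0 < M c f" using nn R by (auto simp: less_le)
  define \<sigma> :: "nat \<Rightarrow> 'i" where "\<sigma> k = (if k = 0 then a else if k = 1 then b else if k = 2 then c else f)" for k
  have \<sigma>: "\<sigma> k \<in> R" for k using R by (auto simp: \<sigma>_def)
  define N where "N i j = M (\<sigma> i) (\<sigma> j) - (if i = j then M (\<sigma> i) (\<sigma> i) else 0)" for i j
  have "lorentz_form {..<4} (\<lambda>i j. 1 * M (\<sigma> i) (\<sigma> j) * 1)"
    by (rule lorentz_form_pullback[OF lor _ fin]) (use \<sigma> in auto)
  then have "lorentz_form {..<4} N"
    unfolding N_def
    by (intro lorentz_form_diagonal) (use sym \<sigma> nn in \<open>auto simp: symmetric_on_def\<close>)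
  \<comment> \<open>With these weights the values at x and y are 2 s t u v times an entry, and the
    four cross terms are bounded in pairs by s^2 t^2 u v and s t u^2 v^2, with total 2 s t u v (s t
    + u v).\<close>
  define x where "x = (\<lambda>k::nat. if k = 0 then t * v else if k = 1 then s * u else 0)"
  define y where "y = (\<lambda>k::nat. if k = 2 then t * u else if k = 3 then s * v else 0)"
  have set4: "{..<4} = {0, 1, 2, 3::nat}" by auto
  have sy: "M b a = M a b" "M f c = M c f" using sym R by (auto simp: symmetric_on_def)
  have xx: "bform {..<4} N x x = 2 * (s * t * u * v) * M a b"
    unfolding bform_def set4 by (simp add: x_def N_def \<sigma>_def sy)
  have yy: "bform {..<4} N y y = 2 * (s * t * u * v) * M c f"
    unfolding bform_def set4 by (simp add: y_def N_def \<sigma>_def sy)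
  have xy: "bform {..<4} N x y = t * v * M a c * (t * u) + t * v * M a f * (s * v)
      + s * u * M b c * (t * u) + s * u * M b f * (s * v)"
    unfolding bform_def set4 by (simp add: x_def y_def N_def \<sigma>_def)
  have stuv: "0 < s * t * u * v" using pos by simp
  have "bform {..<4} N x x * bform {..<4} N y y \<le> (bform {..<4} N x y)\<^sup>2"
  proof -
    have "0 < bform {..<4} N x x" unfolding xx using stuv pp by simp
    then show ?thesis using \<open>lorentz_form {..<4} N\<close> unfolding lorentz_form_def by blast
  qed
  also have "\<dots> \<le> (t * v * s\<^sup>2 * (t * u) + t * v * u\<^sup>2 * (s * v)
      + s * u * v\<^sup>2 * (t * u) + s * u * t\<^sup>2 * (s * v))\<^sup>2"
    unfolding xy using pos bnd nn R
    by (intro power_mono add_mono mult_left_mono mult_right_mono add_nonneg_nonneg mult_nonneg_nonneg) auto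
  also have "\<dots> = (2 * (s * t * u * v))\<^sup>2 * (s * t + u * v)\<^sup>2"
    by (simp add: power2_eq_square algebra_simps)
  finally have "(2 * (s * t * u * v))\<^sup>2 * (M a b * M c f) \<le> (2 * (s * t * u * v))\<^sup>2 * (s * t + u * v)\<^sup>2"
    unfolding xx yy by (simp add: power2_eq_square mult_ac)
  moreover have "0 < (2 * (s * t * u * v))\<^sup>2" using stuv by (intro zero_less_power) simp
  ultimately show ?thesis by (rule mult_left_le_imp_le)
next
  case True
  show ?thesis unfolding True by simp
qed

text \<open>Entries are enlarged by e > 0 to make the roots positive, and e tends to 0.\<close>

lemma lorentz_form_three_term:
  assumes lor: "lorentz_form R M" and sym: "symmetric_on R M" and fin: "finite R"
    and nn: "\<And>i j. i \<in> R \<Longrightarrow> j \<in> R \<Longrightarrow> 0 \<le> M i j"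
    and R: "a \<in> R" "b \<in> R" "c \<in> R" "f \<in> R"
  shows "M a b * M c f \<le> (sqrt (M a c * M b f) + sqrt (M a f * M b c))\<^sup>2"
proof -
  let ?r = "\<lambda>i j e. sqrt (M i j + e)"
  let ?g = "\<lambda>e. (?r a c e * ?r b f e + ?r a f e * ?r b c e)\<^sup>2"
  have "(?g \<longlongrightarrow> ?g 0) (at_right 0)" by (intro tendsto_intros)
  moreover have "\<forall>\<^sub>F e in at_right 0. M a b * M c f \<le> ?g e"
  proof (rule eventually_at_rightI[of 0 1])
    fix e :: real assume "e \<in> {0<..<1}"
    then have e: "e > 0" by simp
    have p: "0 < M i j + e" if "i \<in> R" "j \<in> R" for i j using nn[OF that] e by linarith
    show "M a b * M c f \<le> ?g e"
      by (rule lorentz_form_three_term_strict[OF lor sym fin nn R]) (use p R e in \<open>auto simp: less_imp_le\<close>)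
  qed simp
  ultimately have "M a b * M c f \<le> ?g 0"
    using tendsto_lowerbound trivial_limit_at_right_real by blast
  then show ?thesis by (simp add: real_sqrt_mult)
qed

lemma lorentz_form_two_term:
  assumes lor: "lorentz_form R M" and sym: "symmetric_on R M" and fin: "finite R"
    and nn: "\<And>i j. i \<in> R \<Longrightarrow> j \<in> R \<Longrightarrow> 0 \<le> M i j"
    and R: "a \<in> R" "b \<in> R" "c \<in> R" "f \<in> R" and z: "M a f * M b c = 0"
  shows "M a b * M c f = M a c * M b f"
proof (rule antisym)
  have s: "M c b = M b c" using sym R by (auto simp: symmetric_on_def)
  show "M a b * M c f \<le> M a c * M b f"
    using lorentz_form_three_term[OF lor sym fin nn R] z nn R by simp
  show "M a c * M b f \<le> M a b * M c f"
    using lorentz_form_three_term[OF lor sym fin nn R(1,3,2,4)] z nn R by (simp add: s)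
qed

lemma le_of_power_le:
  fixes p m C :: real
  assumes "0 \<le> m" "\<And>k. k \<ge> 1 \<Longrightarrow> p ^ k \<le> C * m ^ k"
  shows "p \<le> m"
proof (rule ccontr)
  assume "\<not> p \<le> m"
  then have pm: "m < p" by simp
  show False
  proof (cases "m = 0")
    case True
    then show False using assms(2)[of 1] pm by simp
  next
    case False
    then have m: "m > 0" using assms by simp
    then have "1 < p / m" using pm by simp
    then obtain k where k: "C < (p / m) ^ k" using real_arch_pow by blast
    have "(p / m) ^ k \<le> (p / m) ^ Suc k" using \<open>1 < p / m\<close> by (intro power_increasing) auto
    with k have "C < (p / m) ^ Suc k" by linarith
    then have "C * m ^ Suc k < p ^ Suc k" using m by (simp add: power_divide field_simps)
    then show False using assms(2)[of "Suc k"] by simp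
  qed
qed

text \<open>The factor 4 in the inequality and the bounds on D are independent of k, so they
  disappear when k-th roots are taken.\<close>

lemma lorentz_form_powers_three_term:
  assumes lor: "\<And>k. k \<ge> 1 \<Longrightarrow> lorentz_form R (\<lambda>i j. M i j ^ k * D i j)" and fin: "finite R"
    and sym: "symmetric_on R M" "symmetric_on R D"
    and nn: "\<And>i j. i \<in> R \<Longrightarrow> j \<in> R \<Longrightarrow> 0 \<le> M i j"
    and D: "0 < q" "\<And>i j. i \<in> R \<Longrightarrow> j \<in> R \<Longrightarrow> q \<le> D i j" "\<And>i j. i \<in> R \<Longrightarrow> j \<in> R \<Longrightarrow> D i j \<le> 1"
    and R: "a \<in> R" "b \<in> R" "c \<in> R" "f \<in> R"
  shows "M a b * M c f \<le> max (M a c * M b f) (M a f * M b c)"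
proof (rule le_of_power_le[of _ _ "4 / (q * q)"])
  let ?q = "M a c * M b f" and ?r = "M a f * M b c"
  show "0 \<le> max ?q ?r" using nn R by (simp add: le_max_iff_disj)
  fix k :: nat assume k: "k \<ge> 1"
  let ?N = "\<lambda>i j. M i j ^ k * D i j"
  have sk: "symmetric_on R ?N" using sym by (auto simp: symmetric_on_def)
  have D0: "0 \<le> D i j" if "i \<in> R" "j \<in> R" for i j using D(1) D(2)[OF that] by linarith
  have upper: "sqrt (?N i j * ?N i' j') \<le> sqrt (max ?q ?r ^ k)"
    if "i \<in> R" "j \<in> R" "i' \<in> R" "j' \<in> R" "M i j * M i' j' \<le> max ?q ?r" for i j i' j'
  proof -
    have "?N i j * ?N i' j' = (M i j * M i' j') ^ k * (D i j * D i' j')" by (simp add: power_mult_distrib)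
    also have "\<dots> \<le> (M i j * M i' j') ^ k * (1 * 1)"
      using that nn D D0 by (intro mult_left_mono mult_mono) auto
    also have "\<dots> \<le> max ?q ?r ^ k" using that nn by (simp add: power_mono)
    finally show ?thesis by (rule real_sqrt_le_mono)
  qed
  have "q * q * (M a b * M c f) ^ k \<le> (D a b * D c f) * (M a b * M c f) ^ k"
    using D D0 R nn by (intro mult_right_mono mult_mono) (auto intro: less_imp_le)
  also have "\<dots> = ?N a b * ?N c f" by (simp add: power_mult_distrib)
  also have "\<dots> \<le> (sqrt (?N a c * ?N b f) + sqrt (?N a f * ?N b c))\<^sup>2"
    using nn D0 by (intro lorentz_form_three_term[OF lor[OF k] sk fin _ R]) simp
  also have "\<dots> \<le> (sqrt (max ?q ?r ^ k) + sqrt (max ?q ?r ^ k))\<^sup>2"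
    using nn D0 R by (intro power_mono add_mono upper) auto
  also have "\<dots> = 4 * max ?q ?r ^ k"
    using nn R by (simp add: power2_eq_square le_max_iff_disj)
  finally show "(M a b * M c f) ^ k \<le> 4 / (q * q) * max ?q ?r ^ k" using D(1) by (simp add: field_simps)
qed

section \<open>Tropical forms and ultrametrics\<close>

lemma bform_insert:
  assumes "finite K" "a \<notin> K" "symmetric_on (insert a K) M"
  shows "bform (insert a K) M x x = M a a * (x a)\<^sup>2 + 2 * x a * (\<Sum>k\<in>K. M a k * x k) + bform K M x x"
proof -
  have "(\<Sum>k\<in>K. x k * M k a * x a) = x a * (\<Sum>k\<in>K. M a k * x k)"
    unfolding sum_distrib_left
  proof (rule sum.cong[OF refl])
    fix k assume "k \<in> K"
    then have "M k a = M a k" using assms(3) unfolding symmetric_on_def by blast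
    then show "x k * M k a * x a = x a * (M a k * x k)" by simp
  qed
  moreover have "(\<Sum>k\<in>K. x a * M a k * x k) = x a * (\<Sum>k\<in>K. M a k * x k)"
    by (simp add: sum_distrib_left mult_ac)
  ultimately show ?thesis
    using assms(1,2) by (simp add: bform_def sum.distrib power2_eq_square algebra_simps)
qed

lemma symmetric_on_subset: "symmetric_on R M \<Longrightarrow> R' \<subseteq> R \<Longrightarrow> symmetric_on R' M"
  unfolding symmetric_on_def by blast

(* Merging a closest pair i, j into a single index (with new diagonal entry B i j) does not decrease
   the form, because the two rows agree away from i and j. *)
lemma ultrametric_cnd:
  assumes "finite R" "symmetric_on R B"
    and "\<And>i j k. i \<in> R \<Longrightarrow> j \<in> R \<Longrightarrow> k \<in> R \<Longrightarrow> i \<noteq> j \<Longrightarrow> i \<noteq> k \<Longrightarrow> j \<noteq> k \<Longrightarrow> B i j \<le> max (B i k) (B j k)"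
    and "\<And>i j. i \<in> R \<Longrightarrow> j \<in> R \<Longrightarrow> B i i \<le> B i j"
    and "(\<Sum>i\<in>R. u i) = 0"
  shows "bform R B u u \<le> 0"
  using assms
proof (induction "card R" arbitrary: R B u rule: less_induct)
  case less
  note fin = less.prems(1) and sym = less.prems(2) and ultra = less.prems(3) and diag = less.prems(4)
  show ?case
  proof (cases "\<exists>i\<in>R. \<exists>j\<in>R. i \<noteq> j")
    case False
    then have "R = {} \<or> (\<exists>i. R = {i})" by blast
    then show ?thesis using less.prems(5) by (auto simp: bform_def)
  next
    case True
    define P where "P = {(i, j). i \<in> R \<and> j \<in> R \<and> i \<noteq> j}"
    have "finite P" unfolding P_def by (rule finite_subset[of _ "R \<times> R"]) (use fin in auto)
    moreover have "P \<noteq> {}" using True by (auto simp: P_def)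
    ultimately obtain ij where "is_arg_min (\<lambda>(i, j). B i j) (\<lambda>x. x \<in> P) ij"
      using ex_is_arg_min_if_finite by blast
    then obtain i j where ij: "i \<in> R" "j \<in> R" "i \<noteq> j"
      and min: "\<And>k l. k \<in> R \<Longrightarrow> l \<in> R \<Longrightarrow> k \<noteq> l \<Longrightarrow> B i j \<le> B k l"
      unfolding is_arg_min_linorder P_def by (cases ij) auto
    define K where "K = R - {i, j}"
    have R: "R = insert i (insert j K)" and K: "i \<notin> K" "j \<notin> K" "finite K" using ij fin by (auto simp: K_def)
    have symD: "B k l = B l k" if "k \<in> R" "l \<in> R" for k l using sym that by (auto simp: symmetric_on_def)
    \<comment> \<open>Among the three values on i, j, k the two largest agree, and
      \<open>B i j\<close> is minimal.\<close>
    have row: "B j k = B i k" if "k \<in> K" for k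
    proof -
      have k: "k \<in> R" "k \<noteq> i" "k \<noteq> j" using that by (auto simp: K_def)
      have "B i k \<le> max (B i j) (B k j)" using ultra[of i k j] ij k by auto
      moreover have "B j k \<le> max (B j i) (B k i)" using ultra[of j k i] ij k by auto
      ultimately show ?thesis
        using min[of i k] min[of j k] k ij symD[of k j] symD[of k i] symD[of j i] by auto
    qed
    \<comment> \<open>The merged diagonal entry is the least off-diagonal value, so it is still
      dominated by the entries of its row.\<close>
    define B' where "B' k l = (if k = i \<and> l = i then B i j else B k l)" for k l
    define u' where "u' k = (if k = i then u i + u j else u k)" for k
    have "bform (insert i K) B' u' u' \<le> 0"
    proof (rule less.hyps)
      show "card (insert i K) < card R" using K ij by (simp add: R)
      show "symmetric_on (insert i K) B'" using symD R by (auto simp: symmetric_on_def B'_def)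
      show "B' a b \<le> max (B' a c) (B' b c)"
        if "a \<in> insert i K" "b \<in> insert i K" "c \<in> insert i K" "a \<noteq> b" "a \<noteq> c" "b \<noteq> c" for a b c
        using ultra[of a b c] that R by (auto simp: B'_def)
      show "B' a a \<le> B' a b" if "a \<in> insert i K" "b \<in> insert i K" for a b
        using diag[of a b] min[of a b] that R by (auto simp: B'_def)
      have "(\<Sum>k\<in>K. u' k) = (\<Sum>k\<in>K. u k)" using K by (intro sum.cong) (auto simp: u'_def)
      then show "(\<Sum>i\<in>insert i K. u' i) = 0"
        using less.prems(5) K ij by (simp add: R u'_def)
    qed (use K in simp)
    moreover have "bform (insert i K) B' u' u' = B i j * (u i + u j)\<^sup>2
       + 2 * (u i + u j) * (\<Sum>k\<in>K. B i k * u k) + bform K B u u"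
    proof -
      have s: "symmetric_on (insert i K) B'" using symD R by (auto simp: symmetric_on_def B'_def)
      have "(\<Sum>k\<in>K. B' i k * u' k) = (\<Sum>k\<in>K. B i k * u k)"
        using K by (intro sum.cong) (auto simp: u'_def B'_def)
      moreover have "bform K B' u' u' = bform K B u u"
        using K by (intro bform_cong) (auto simp: u'_def B'_def)
      ultimately show ?thesis unfolding bform_insert[OF K(3,1) s] by (simp add: u'_def B'_def)
    qed
    moreover have "bform R B u u = B i i * (u i)\<^sup>2 + 2 * u i * (B i j * u j + (\<Sum>k\<in>K. B i k * u k))
       + (B j j * (u j)\<^sup>2 + 2 * u j * (\<Sum>k\<in>K. B i k * u k) + bform K B u u)"
    proof -
      have s: "symmetric_on (insert i (insert j K)) B" "symmetric_on (insert j K) B"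
        using sym R by (auto intro: symmetric_on_subset)
      have "(\<Sum>k\<in>K. B j k * u k) = (\<Sum>k\<in>K. B i k * u k)" using row by (intro sum.cong) auto
      then show ?thesis
        unfolding R using K ij by (simp add: bform_insert[OF _ _ s(1)] bform_insert[OF _ _ s(2)])
    qed
    moreover have "B i i * (u i)\<^sup>2 \<le> B i j * (u i)\<^sup>2" "B j j * (u j)\<^sup>2 \<le> B i j * (u j)\<^sup>2"
      using diag[of i j] diag[of j i] ij symD[of j i] by (auto intro!: mult_right_mono)
    ultimately show ?thesis by (simp add: power2_eq_square algebra_simps)
  qed
qed

text \<open>Fix a nonzero row z. By the tropical relations an index i with \<open>M z i = 0\<close>
  has its row proportional to row z, hence contributes nothing on the kernel of that row. For the
  remaining indices, dividing by \<open>M z i * M z j\<close> turns the relations that involve z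
  into the ultrametric inequality.\<close>

lemma tropical_lorentz_form:
  assumes fin: "finite R" and sym: "symmetric_on R M"
    and nn: "\<And>i j. i \<in> R \<Longrightarrow> j \<in> R \<Longrightarrow> 0 \<le> M i j"
    and trop: "\<And>a b c f. a \<in> R \<Longrightarrow> b \<in> R \<Longrightarrow> c \<in> R \<Longrightarrow> f \<in> R \<Longrightarrow>
      M a b * M c f \<le> max (M a c * M b f) (M a f * M b c)"
  shows "lorentz_form R M"
proof (cases "\<exists>o1\<in>R. \<exists>k\<in>R. M o1 k \<noteq> 0")
  case False
  then have "bform R M x y = 0" for x y unfolding bform_def by (intro sum.neutral ballI) auto
  then show ?thesis by (simp add: lorentz_form_def)
next
  case True
  then obtain z k where z: "z \<in> R" "k \<in> R" "M z k > 0" using nn by (force simp: less_le)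
  have symD: "M k l = M l k" if "k \<in> R" "l \<in> R" for k l using sym that by (auto simp: symmetric_on_def)
  define I where "I = {i\<in>R. M z i > 0}"
  have I: "I \<subseteq> R" "finite I" using fin by (auto simp: I_def)
  define s where "s i = M i k / M z k" for i
  have row: "M i j = s i * M z j" if "i \<in> R - I" "j \<in> R" for i j
  proof -
    have i: "i \<in> R" "M z i = 0" using that nn[of z i] z by (auto simp: I_def)
    have "M z k * M i j \<le> max (M z i * M k j) (M z j * M i k)"
      using trop[OF z(1,2) i(1) that(2)] symD[OF z(2) i(1)] by simp
    moreover have "M z j * M i k \<le> max (M z i * M j k) (M z k * M i j)"
      using trop[OF z(1) that(2) i(1) z(2)] symD[OF that(2) i(1)] by simp
    moreover have "0 \<le> M z j * M i k" "0 \<le> M z k * M i j" using nn z i that by simp_all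
    ultimately have "M z k * M i j = M z j * M i k" unfolding i(2) by simp
    then show ?thesis using z by (simp add: s_def field_simps)
  qed
  show ?thesis
  proof (rule lorentz_formI[OF sym])
    fix x assume x: "(\<Sum>i\<in>R. M z i * x i) = 0"
    have split: "(\<Sum>i\<in>R. h i) = (\<Sum>i\<in>I. h i) + (\<Sum>i\<in>R-I. h i)" for h :: "_ \<Rightarrow> real"
      using I fin by (metis add.commute sum.subset_diff)
    have "M z i = 0" if "i \<in> R - I" for i using that nn[of z i] z by (auto simp: I_def)
    then have x': "(\<Sum>i\<in>I. M z i * x i) = 0" using x unfolding split by simp
    have out: "(\<Sum>j\<in>R. x i * M i j * x j) = 0" if "i \<in> R - I" for i
    proof -
      have "(\<Sum>j\<in>R. x i * M i j * x j) = x i * s i * (\<Sum>j\<in>R. M z j * x j)"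
        unfolding sum_distrib_left using row[OF that] by (intro sum.cong) auto
      then show ?thesis using x by simp
    qed
    have "bform R M x x = (\<Sum>i\<in>I. \<Sum>j\<in>R. x i * M i j * x j)"
      unfolding bform_def by (subst split) (simp add: out)
    also have "\<dots> = bform I M x x + (\<Sum>i\<in>I. \<Sum>j\<in>R-I. x i * M i j * x j)"
      unfolding bform_def by (simp add: split[of "\<lambda>j. x _ * M _ j * x j"] sum.distrib)
    also have "(\<Sum>i\<in>I. \<Sum>j\<in>R-I. x i * M i j * x j) = (\<Sum>j\<in>R-I. \<Sum>i\<in>I. x i * M i j * x j)"
      by (rule sum.swap)
    also have "\<dots> = 0"
    proof (rule sum.neutral, rule ballI)
      fix j assume j: "j \<in> R - I"
      have "(\<Sum>i\<in>I. x i * M i j * x j) = s j * x j * (\<Sum>i\<in>I. M z i * x i)"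
        unfolding sum_distrib_left using row[OF j] symD I j by (intro sum.cong) (auto simp: subset_iff)
      then show "(\<Sum>i\<in>I. x i * M i j * x j) = 0" using x' by simp
    qed
    also have "bform I M x x = bform I (\<lambda>i j. M i j / (M z i * M z j)) (\<lambda>i. M z i * x i) (\<lambda>i. M z i * x i)"
      unfolding bform_def by (intro sum.cong) (auto simp: I_def)
    also have "\<dots> \<le> 0"
    proof (rule ultrametric_cnd[OF I(2)])
      show "symmetric_on I (\<lambda>i j. M i j / (M z i * M z j))"
        using symD I by (auto simp: symmetric_on_def mult.commute subset_iff)
      have ult: "M i j / (M z i * M z j) \<le> max (M i l / (M z i * M z l)) (M j l / (M z j * M z l))"
        if "i \<in> I" "j \<in> I" "l \<in> I" for i j l
      proof -
        have i: "i \<in> R" "j \<in> R" "l \<in> R" "M z i > 0" "M z j > 0" "M z l > 0" using that by (auto simp: I_def)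
        have "M i j * M l z \<le> M i l * M j z \<or> M i j * M l z \<le> M i z * M j l"
          using trop[of i j l z] i z by (simp add: le_max_iff_disj)
        then have "M i j * M z l \<le> M i l * M z j \<or> M i j * M z l \<le> M z i * M j l"
          using symD i z by metis
        then show ?thesis using i by (auto simp: le_max_iff_disj field_simps)
      qed
      show "M i j / (M z i * M z j) \<le> max (M i l / (M z i * M z l)) (M j l / (M z j * M z l))"
        if "i \<in> I" "j \<in> I" "l \<in> I" for i j l using ult that by blast
      show "M i i / (M z i * M z i) \<le> M i j / (M z i * M z j)" if "i \<in> I" "j \<in> I" for i j
        using ult[of i i j] that by simp
    qed (use x' in simp)
    finally show "bform R M x x \<le> 0" by simp
  qed
qed

section \<open>Powers of conditionally negative definite kernels\<close>

definition psd_on :: "'i set \<Rightarrow> ('i \<Rightarrow> 'i \<Rightarrow> real) \<Rightarrow> bool" where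
  "psd_on R K \<longleftrightarrow> symmetric_on R K \<and> (\<forall>x. 0 \<le> bform R K x x)"

lemma bform_zero_row:
  assumes "finite K" "a \<notin> K" "\<And>k. k \<in> insert a K \<Longrightarrow> M a k = 0" "symmetric_on (insert a K) M"
  shows "bform (insert a K) M x x = bform K M x x"
  using assms by (simp add: bform_insert)

lemma bform_unit:
  assumes "finite R" "a \<in> R" "symmetric_on R M"
  shows "bform R M x (\<lambda>i. if i = a then 1 else 0) = (\<Sum>i\<in>R. M a i * x i)"
proof -
  have "bform R M x (\<lambda>i. if i = a then 1 else 0) = (\<Sum>i\<in>R. x i * M i a)"
    using assms(1,2) by (simp add: bform_def if_distrib sum.delta cong: if_cong)
  also have "\<dots> = (\<Sum>i\<in>R. M a i * x i)"
  proof (rule sum.cong[OF refl])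
    fix i assume "i \<in> R"
    then have "M i a = M a i" using assms(2,3) unfolding symmetric_on_def by blast
    then show "x i * M i a = M a i * x i" by simp
  qed
  finally show ?thesis .
qed

lemma psd_cauchy_schwarz:
  assumes "psd_on R K"
  shows "(bform R K x y)\<^sup>2 \<le> bform R K x x * bform R K y y"
proof -
  have sym: "symmetric_on R K" and nn: "0 \<le> bform R K z z" for z using assms by (auto simp: psd_on_def)
  have q: "0 \<le> bform R K y y - 2 * s * bform R K x y + s\<^sup>2 * bform R K x x" for s
    using nn[of "\<lambda>i. y i - s * x i"] by (simp only: bform_diff_scale[OF sym])
  show ?thesis
  proof (cases "bform R K x x = 0")
    case True
    have "bform R K x y = 0"
    proof (rule ccontr)
      assume n: "bform R K x y \<noteq> 0"
      have "0 \<le> bform R K y y - (bform R K y y + 1)"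
        using q[of "(bform R K y y + 1) / (2 * bform R K x y)"] True n by simp
      then show False by simp
    qed
    then show ?thesis using True by simp
  next
    case False
    then have p: "0 < bform R K x x" using nn[of x] by simp
    have "0 \<le> bform R K x x * (bform R K y y - 2 * (bform R K x y / bform R K x x) * bform R K x y
       + (bform R K x y / bform R K x x)\<^sup>2 * bform R K x x)"
      by (rule mult_nonneg_nonneg[OF less_imp_le[OF p] q])
    also have "\<dots> = bform R K x x * bform R K y y - (bform R K x y)\<^sup>2"
      using p by (simp add: power2_eq_square field_simps)
    finally show ?thesis by simp
  qed
qed

text \<open>Split off the rank-one part of K along a. The remainder K' is the Schur complement,
  positive semidefinite with vanishing row a, so induction applies to it; the rank-one part
  multiplied entrywise with L is, up to a positive factor, a diagonal congruence of L.\<close>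

lemma schur_product:
  assumes "finite R" "psd_on R K" "psd_on R L"
  shows "psd_on R (\<lambda>i j. K i j * L i j)"
  using assms
proof (induction R arbitrary: K rule: finite_induct)
  case empty
  then show ?case by (simp add: psd_on_def bform_def symmetric_on_def)
next
  case (insert a R)
  let ?R = "insert a R"
  have fin: "finite ?R" using insert by simp
  have symK: "symmetric_on ?R K" and symL: "symmetric_on ?R L" using insert.prems by (auto simp: psd_on_def)
  have nnK: "0 \<le> bform ?R K x x" and nnL: "0 \<le> bform ?R L x x" for x using insert.prems by (auto simp: psd_on_def)
  have symD: "K i j = K j i" "L i j = L j i" if "i \<in> ?R" "j \<in> ?R" for i j
    using symK symL that unfolding symmetric_on_def by blast+
  let ?e = "\<lambda>b i. if i = b then 1 else (0::real)"
  have e: "bform ?R K (?e b) (?e c) = K c b" if "b \<in> ?R" "c \<in> ?R" for b c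
    using bform_unit[OF fin that(2) symK, of "?e b"] that fin by (simp add: if_distrib sum.delta cong: if_cong)
  have Kaa: "0 \<le> K a a" using nnK[of "?e a"] e by simp
  \<comment> \<open>If \<open>K a a = 0\<close>, row a of K vanishes by Cauchy-Schwarz, and division
    by zero leaves K' = K.\<close>
  define K' where "K' i j = K i j - K a i * K a j / K a a" for i j
  have cs: "(K a i)\<^sup>2 \<le> K a a * K i i" if "i \<in> ?R" for i
    using psd_cauchy_schwarz[OF insert.prems(1), of "?e i" "?e a"] e that by (simp add: mult.commute)
  have row0: "K' a j = 0" if "j \<in> ?R" for j
    using cs[OF that] by (cases "K a a = 0") (auto simp: K'_def)
  have symK': "symmetric_on ?R K'" using symD by (auto simp: symmetric_on_def K'_def mult.commute)
  have K'nn: "0 \<le> bform ?R K' x x" for x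
  proof -
    have "bform ?R K' x x = bform ?R K x x - (\<Sum>i\<in>?R. K a i * x i)\<^sup>2 / K a a"
    proof -
      have "x i * K' i j * x j = x i * K i j * x j - (K a i * x i) * (K a j * x j) / K a a" for i j
        by (simp add: K'_def field_simps)
      then show ?thesis
        unfolding bform_def
        by (simp only: sum_subtractf sum_product power2_eq_square sum_divide_distrib)
    qed
    also have "(\<Sum>i\<in>?R. K a i * x i) = bform ?R K x (?e a)" using bform_unit[OF fin _ symK] by simp
    finally have eq: "bform ?R K' x x = bform ?R K x x - (bform ?R K x (?e a))\<^sup>2 / K a a" .
    show ?thesis
    proof (cases "K a a = 0")
      case True
      then show ?thesis using nnK[of x] by (simp add: eq)
    next
      case False
      then show ?thesis
        using psd_cauchy_schwarz[OF insert.prems(1), of x "?e a"] e Kaa by (simp add: eq divide_le_eq)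
    qed
  qed
  have rest: "bform ?R M x x = bform R M x x" if "symmetric_on ?R M" "\<And>k. k \<in> ?R \<Longrightarrow> M a k = 0" for M x
    by (rule bform_zero_row[OF insert.hyps(1,2) that(2,1)])
  have "psd_on R (\<lambda>i j. K' i j * L i j)"
  proof (rule insert.IH)
    show "psd_on R K'"
      using K'nn rest[OF symK' row0] symK' by (auto simp: psd_on_def intro: symmetric_on_subset)
    have "bform R L x x = bform ?R L (\<lambda>i. if i = a then 0 else x i) (\<lambda>i. if i = a then 0 else x i)" for x
      unfolding bform_insert[OF insert.hyps symL] using insert.hyps by (auto intro!: bform_cong)
    then show "psd_on R L"
      using nnL symL by (auto simp: psd_on_def intro: symmetric_on_subset)
  qed
  then have 0: "0 \<le> bform R (\<lambda>i j. K' i j * L i j) x x" for x unfolding psd_on_def by blast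
  have "symmetric_on ?R (\<lambda>i j. K' i j * L i j)"
    unfolding symmetric_on_def
  proof (intro ballI)
    fix i j assume ij: "i \<in> ?R" "j \<in> ?R"
    have "K' i j = K' j i" using symK' ij unfolding symmetric_on_def by blast
    then show "K' i j * L i j = K' j i * L j i" using symD(2)[OF ij] by simp
  qed
  then have "bform ?R (\<lambda>i j. K' i j * L i j) x x = bform R (\<lambda>i j. K' i j * L i j) x x" for x
    by (rule rest) (simp add: row0)
  then have 1: "0 \<le> bform ?R (\<lambda>i j. K' i j * L i j) x x" for x using 0 by simp
  have 2: "0 \<le> bform ?R (\<lambda>i j. K a i * K a j / K a a * L i j) x x" for x
  proof -
    have "bform ?R (\<lambda>i j. K a i * K a j / K a a * L i j) x x
      = bform ?R L (\<lambda>i. K a i * x i) (\<lambda>i. K a i * x i) / K a a"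
      unfolding bform_def sum_divide_distrib by (intro sum.cong refl) (simp add: field_simps)
    then show ?thesis using nnL Kaa by simp
  qed
  have "bform ?R (\<lambda>i j. K i j * L i j) x x = bform ?R (\<lambda>i j. K' i j * L i j) x x
     + bform ?R (\<lambda>i j. K a i * K a j / K a a * L i j) x x" for x
  proof -
    have "x i * (K i j * L i j) * x j = x i * (K' i j * L i j) * x j + x i * (K a i * K a j / K a a * L i j) * x j" for i j
      by (simp add: K'_def algebra_simps)
    then show ?thesis unfolding bform_def by (simp only: sum.distrib)
  qed
  then have "0 \<le> bform ?R (\<lambda>i j. K i j * L i j) x x" for x using 1 2 by simp
  moreover have "symmetric_on ?R (\<lambda>i j. K i j * L i j)"
    unfolding symmetric_on_def
  proof (intro ballI)
    fix i j assume "i \<in> ?R" "j \<in> ?R"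
    from symD[OF this] show "K i j * L i j = K j i * L j i" by simp
  qed
  ultimately show ?case by (simp add: psd_on_def)
qed

lemma psd_on_ones: "psd_on R (\<lambda>i j. 1)"
proof -
  have "bform R (\<lambda>i j. 1) x x = (\<Sum>i\<in>R. x i)\<^sup>2" for x
    by (simp add: bform_def power2_eq_square sum_product)
  then show ?thesis by (simp add: psd_on_def symmetric_on_def)
qed

lemma psd_on_power:
  assumes "finite R" "psd_on R K"
  shows "psd_on R (\<lambda>i j. K i j ^ k)"
proof (induction k)
  case 0
  then show ?case using psd_on_ones by simp
next
  case (Suc k)
  then show ?case using schur_product[OF assms Suc] by simp
qed

text \<open>The exponential series is a combination of entrywise powers with positive
  coefficients.\<close>

lemma psd_on_exp:
  assumes "finite R" "psd_on R K"
  shows "0 \<le> bform R (\<lambda>i j. exp (K i j)) x x"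
proof -
  have "(\<lambda>k. x i * (K i j ^ k /\<^sub>R fact k) * x j) sums (x i * exp (K i j) * x j)" for i j
    by (intro sums_mult sums_mult2 exp_converges)
  then have "(\<lambda>k. \<Sum>i\<in>R. \<Sum>j\<in>R. x i * (K i j ^ k /\<^sub>R fact k) * x j) sums bform R (\<lambda>i j. exp (K i j)) x x"
    unfolding bform_def by (intro sums_sum)
  moreover have "(\<Sum>i\<in>R. \<Sum>j\<in>R. x i * (K i j ^ k /\<^sub>R fact k) * x j) = bform R (\<lambda>i j. K i j ^ k) x x / fact k" for k
    unfolding bform_def sum_divide_distrib by (intro sum.cong refl) (simp add: field_simps)
  moreover have "0 \<le> bform R (\<lambda>i j. K i j ^ k) x x / fact k" for k
    using psd_on_power[OF assms] by (simp add: psd_on_def)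
  ultimately show ?thesis using sums_le[OF _ sums_zero] by (metis (no_types, lifting) sums_cong)
qed

definition cnd_on :: "'i set \<Rightarrow> ('i \<Rightarrow> 'i \<Rightarrow> real) \<Rightarrow> bool" where
  "cnd_on R B \<longleftrightarrow> symmetric_on R B \<and> (\<forall>u. (\<Sum>i\<in>R. u i) = 0 \<longrightarrow> bform R B u u \<le> 0)"

text \<open>Up to the diagonal factors exp(- l B a i) and a constant, exp(- l B) is the entrywise
  exponential of a positive semidefinite kernel.\<close>

lemma cnd_exp_psd:
  assumes fin: "finite R" and cnd: "cnd_on R B" and l: "0 \<le> l"
  shows "0 \<le> bform R (\<lambda>i j. exp (- (l * B i j))) x x"
proof (cases "R = {}")
  case False
  then obtain a where a: "a \<in> R" by blast
  have sym: "symmetric_on R B" and neg: "\<And>u. (\<Sum>i\<in>R. u i) = 0 \<Longrightarrow> bform R B u u \<le> 0"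
    using cnd by (auto simp: cnd_on_def)
  \<comment> \<open>Gram kernel based at a: its value at y is that of - l B at y - s e_a, a vector
    with coordinate sum zero.\<close>
  define K where "K i j = l * (B a i + B a j - B i j - B a a)" for i j
  let ?e = "\<lambda>i. if i = a then 1 else (0::real)"
  have psd: "psd_on R K"
    unfolding psd_on_def
  proof (intro conjI allI)
    show "symmetric_on R K" using sym by (auto simp: symmetric_on_def K_def)
    fix y :: "_ \<Rightarrow> real"
    define s where "s = (\<Sum>i\<in>R. y i)"
    have "(\<Sum>i\<in>R. y i - s * ?e i) = 0"
      unfolding sum_subtractf sum_distrib_left[symmetric] using fin a by (simp add: s_def)
    from neg[OF this] have "bform R B y y - 2 * s * bform R B ?e y + s\<^sup>2 * bform R B ?e ?e \<le> 0"
      by (simp only: bform_diff_scale[OF sym])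
    also have "bform R B ?e y = (\<Sum>i\<in>R. B a i * y i)"
      using bform_unit[OF fin a sym] bform_commute[OF sym] by metis
    also have "bform R B ?e ?e = B a a"
      using bform_unit[OF fin a sym, of ?e] fin a by (simp add: if_distrib sum.delta cong: if_cong)
    finally have *: "bform R B y y - 2 * s * (\<Sum>i\<in>R. B a i * y i) + s\<^sup>2 * B a a \<le> 0" .
    have "bform R K y y = l * (2 * s * (\<Sum>i\<in>R. B a i * y i) - bform R B y y - s\<^sup>2 * B a a)"
    proof -
      have "y i * K i j * y j = l * ((B a i * y i) * y j + y i * (B a j * y j) - y i * B i j * y j - B a a * (y i * y j))" for i j
        by (simp add: K_def algebra_simps)
      then have "bform R K y y = l * ((\<Sum>i\<in>R. \<Sum>j\<in>R. (B a i * y i) * y j) + (\<Sum>i\<in>R. \<Sum>j\<in>R. y i * (B a j * y j))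
         - bform R B y y - B a a * (\<Sum>i\<in>R. \<Sum>j\<in>R. y i * y j))"
        unfolding bform_def by (simp only: sum_distrib_left[symmetric] sum.distrib sum_subtractf)
      then show ?thesis
        unfolding sum_product[symmetric] s_def by (simp add: power2_eq_square algebra_simps)
    qed
    then show "0 \<le> bform R K y y" using * l by simp
  qed
  have "x i * exp (- (l * B i j)) * x j = exp (l * B a a) *
    ((exp (- (l * B a i)) * x i) * exp (K i j) * (exp (- (l * B a j)) * x j))" for i j
  proof -
    have "exp (- (l * B i j)) = exp (l * B a a + (- (l * B a i)) + K i j + (- (l * B a j)))"
      by (simp add: K_def algebra_simps)
    then show ?thesis by (simp only: exp_add mult_ac)
  qed
  then have "bform R (\<lambda>i j. exp (- (l * B i j))) x x = exp (l * B a a) *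
    bform R (\<lambda>i j. exp (K i j)) (\<lambda>i. exp (- (l * B a i)) * x i) (\<lambda>i. exp (- (l * B a i)) * x i)"
    unfolding bform_def by (simp only: sum_distrib_left)
  then show ?thesis using psd_on_exp[OF fin psd] by simp
qed (simp add: bform_def)

text \<open>Substituting l / x for l shows that the integral over l is x^t times a constant, which
  is finite for 0 < t < 1 because 1 - exp(- l x) is O(l) at 0 and bounded at infinity.\<close>

definition frac_kernel :: "real \<Rightarrow> real \<Rightarrow> real \<Rightarrow> real" where
  "frac_kernel t x l = indicator {0<..} l * ((1 - exp (- (l * x))) * l powr (- 1 - t))"

lemma frac_kernel_nonneg: "0 \<le> x \<Longrightarrow> 0 \<le> frac_kernel t x l"
  by (auto simp: frac_kernel_def indicator_def)

lemma borel_measurable_frac_kernel [measurable]: "frac_kernel t x \<in> borel_measurable borel"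
  unfolding frac_kernel_def by measurable

lemma frac_kernel_integrable_one:
  assumes t: "0 < t" "t < 1"
  shows "integrable lborel (frac_kernel t 1)"
proof (rule Bochner_Integration.integrable_bound)
  have "(\<lambda>l. l powr (- t)) absolutely_integrable_on {0..1::real}"
    using integrable_on_powr_from_0[of "- t" 1] t by (intro nonnegative_absolutely_integrable_1) auto
  then have 1: "integrable lborel (\<lambda>l. indicator {0..1} l * l powr (- t))"
    unfolding set_integrable_def by (subst (asm) integrable_completion) auto
  have "(\<lambda>l. l powr (- 1 - t)) absolutely_integrable_on {1::real..}"
    using has_integral_powr_to_inf[of "- 1 - t" 1] t
    by (intro nonnegative_absolutely_integrable_1) (auto simp: integrable_on_def)
  then have 2: "integrable lborel (\<lambda>l. indicator {1..} l * l powr (- 1 - t))"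
    unfolding set_integrable_def by (subst (asm) integrable_completion) auto
  show "integrable lborel (\<lambda>l. indicator {0..1} l * l powr (- t) + indicator {1..} l * l powr (- 1 - t))"
    using 1 2 by (rule Bochner_Integration.integrable_add)
  show "frac_kernel t 1 \<in> borel_measurable lborel" by simp
  show "AE l in lborel. norm (frac_kernel t 1 l) \<le>
      norm (indicator {0..1} l * l powr (- t) + indicator {1..} l * l powr (- 1 - t))"
  proof (rule AE_I2)
    fix l :: real
    consider "l \<le> 0" | "0 < l" "l < 1" | "1 \<le> l" by linarith
    then show "norm (frac_kernel t 1 l) \<le>
      norm (indicator {0..1} l * l powr (- t) + indicator {1..} l * l powr (- 1 - t))"
    proof cases
      case 1
      then show ?thesis by (simp add: frac_kernel_def)
    next
      case 2
      have "(1 - exp (- l)) * l powr (- 1 - t) \<le> l * l powr (- 1 - t)"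
        using exp_ge_add_one_self[of "- l"] by (intro mult_right_mono) auto
      also have "\<dots> = l powr (- t)" using 2 by (simp add: powr_mult_base)
      finally show ?thesis using 2 by (simp add: frac_kernel_def)
    next
      case 3
      have "(1 - exp (- l)) * l powr (- 1 - t) \<le> 1 * l powr (- 1 - t)"
        by (intro mult_right_mono) auto
      moreover have "0 \<le> (1 - exp (- l)) * l powr (- 1 - t)" using 3 by simp
      moreover have "0 \<le> indicat_real {0..1} l * l powr (- t)" by simp
      ultimately have "\<bar>(1 - exp (- l)) * l powr (- 1 - t)\<bar> \<le>
        \<bar>indicat_real {0..1} l * l powr (- t) + l powr (- 1 - t)\<bar>"
        by linarith
      then show ?thesis using 3 by (simp add: frac_kernel_def)
    qed
  qed
qed

text \<open>The summand 0 gives the argument the affine form of the substitution rule for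
  \<open>lborel\<close>.\<close>

lemma frac_kernel_scale:
  assumes "0 < x"
  shows "frac_kernel t x l = x powr (1 + t) * frac_kernel t 1 (0 + x * l)"
proof (cases "0 < l")
  case True
  then have "x powr (1 + t) * (x * l) powr (- 1 - t) = l powr (- 1 - t)"
    using assms by (simp add: powr_mult mult.assoc[symmetric] flip: powr_add)
  then show ?thesis using True assms by (simp add: frac_kernel_def mult_ac)
next
  case False
  then show ?thesis using assms by (simp add: frac_kernel_def zero_less_mult_iff)
qed

lemma frac_kernel_integral:
  assumes t: "0 < t" "t < 1" and x: "0 \<le> x"
  shows "integrable lborel (frac_kernel t x)"
    and "integral\<^sup>L lborel (frac_kernel t x) = x powr t * integral\<^sup>L lborel (frac_kernel t 1)"
proof -
  have "integrable lborel (frac_kernel t x) \<and>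
    integral\<^sup>L lborel (frac_kernel t x) = x powr t * integral\<^sup>L lborel (frac_kernel t 1)"
  proof (cases "x = 0")
    case True
    then have "frac_kernel t x = (\<lambda>l. 0)" by (auto simp: frac_kernel_def)
    then show ?thesis using True by simp
  next
    case False
    then have x: "0 < x" using x by simp
    have eq: "frac_kernel t x = (\<lambda>l. x powr (1 + t) * frac_kernel t 1 (0 + x * l))"
      using frac_kernel_scale[OF x] by auto
    have i: "integrable lborel (\<lambda>l. frac_kernel t 1 (0 + x * l))"
      using lborel_integrable_real_affine[OF frac_kernel_integrable_one[OF t], of x 0] x by simp
    have "integral\<^sup>L lborel (frac_kernel t 1) = x * integral\<^sup>L lborel (\<lambda>l. frac_kernel t 1 (0 + x * l))"
      using lborel_integral_real_affine[of x "frac_kernel t 1" 0] x by simp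
    moreover have "x powr (1 + t) = x powr t * x" using x by (simp add: powr_add)
    ultimately show ?thesis unfolding eq using i by simp
  qed
  then show "integrable lborel (frac_kernel t x)"
    and "integral\<^sup>L lborel (frac_kernel t x) = x powr t * integral\<^sup>L lborel (frac_kernel t 1)" by auto
qed

lemma not_AE_notin_interval:
  fixes a b :: real
  assumes "a < b"
  shows "\<not> (AE l in lborel. l \<notin> {a<..<b})"
proof
  assume "AE l in lborel. l \<notin> {a<..<b}"
  then have "emeasure lborel {a<..<b} = 0"
    by (subst (asm) AE_iff_measurable[of "{a<..<b}"]) auto
  then show False using assms by simp
qed

lemma frac_kernel_integral_pos:
  assumes t: "0 < t" "t < 1"
  shows "0 < integral\<^sup>L lborel (frac_kernel t 1)"
proof -
  have "integral\<^sup>L lborel (frac_kernel t 1) \<noteq> 0"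
  proof
    assume "integral\<^sup>L lborel (frac_kernel t 1) = 0"
    then have "AE l in lborel. frac_kernel t 1 l = 0"
      using integral_nonneg_eq_0_iff_AE[OF frac_kernel_integrable_one[OF t]] frac_kernel_nonneg[of 1 t]
      by auto
    then have "AE l in lborel. l \<notin> {0<..<1::real}"
      by eventually_elim (auto simp: frac_kernel_def)
    then show False using not_AE_notin_interval[of 0 1] by simp
  qed
  moreover have "0 \<le> integral\<^sup>L lborel (frac_kernel t 1)"
    by (intro integral_nonneg_AE AE_I2 frac_kernel_nonneg) simp
  ultimately show ?thesis by simp
qed

(* Schoenberg: x^t is a positive combination of the functions 1 - exp(-l x), and exp(-l B) is positive
   semidefinite when B is conditionally negative definite. *)
lemma cnd_powr:
  fixes u :: "'i \<Rightarrow> real"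
  assumes fin: "finite R" and cnd: "cnd_on R B" and nn: "\<And>i j. i \<in> R \<Longrightarrow> j \<in> R \<Longrightarrow> 0 \<le> B i j"
    and t: "0 < t" "t < 1" and u: "(\<Sum>i\<in>R. u i) = 0"
  shows "bform R (\<lambda>i j. B i j powr t) u u \<le> 0"
    and "(\<And>i j. i \<in> R \<Longrightarrow> j \<in> R \<Longrightarrow> i \<noteq> j \<Longrightarrow> 0 < B i j) \<Longrightarrow> (\<And>i. i \<in> R \<Longrightarrow> u i \<noteq> 0 \<Longrightarrow> B i i = 0) \<Longrightarrow>
      (\<exists>i\<in>R. u i \<noteq> 0) \<Longrightarrow> bform R (\<lambda>i j. B i j powr t) u u < 0"
proof -
  define c where "c = integral\<^sup>L lborel (frac_kernel t 1)"
  have c: "0 < c" unfolding c_def by (rule frac_kernel_integral_pos[OF t])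
  define f where "f l = bform R (\<lambda>i j. exp (- (l * B i j))) u u" for l
  define g where "g l = indicator {0<..} l * (f l * l powr (- 1 - t))" for l
  have f: "0 \<le> f l" if "0 \<le> l" for l unfolding f_def by (rule cnd_exp_psd[OF fin cnd that])
  have g: "0 \<le> g l" for l using f[of l] by (auto simp: g_def indicator_def)
  \<comment> \<open>The constant 1 in the kernel cancels because u has sum zero; only the
    exponential part remains.\<close>
  have "(\<Sum>i\<in>R. \<Sum>j\<in>R. u i * frac_kernel t (B i j) l * u j) = - g l" for l
  proof -
    have "u i * frac_kernel t (B i j) l * u j = indicator {0<..} l * l powr (- 1 - t) * (u i * u j)
       - indicator {0<..} l * l powr (- 1 - t) * (u i * exp (- (l * B i j)) * u j)" for i j
      by (simp add: frac_kernel_def algebra_simps)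
    then have "(\<Sum>i\<in>R. \<Sum>j\<in>R. u i * frac_kernel t (B i j) l * u j) =
       indicator {0<..} l * l powr (- 1 - t) * ((\<Sum>i\<in>R. u i) * (\<Sum>i\<in>R. u i))
       - indicator {0<..} l * l powr (- 1 - t) * f l"
      unfolding f_def bform_def by (simp only: sum_subtractf sum_distrib_left[symmetric] sum_product)
    then show ?thesis by (simp add: u g_def)
  qed
  then have geq: "g = (\<lambda>l. - (\<Sum>i\<in>R. \<Sum>j\<in>R. u i * frac_kernel t (B i j) l * u j))" by auto
  have int: "integrable lborel (\<lambda>l. u i * frac_kernel t (B i j) l * u j)" if "i \<in> R" "j \<in> R" for i j
    using frac_kernel_integral(1)[OF t nn[OF that]] by simp
  have ig: "integrable lborel g"
    unfolding geq using int by (intro integrable_minus Bochner_Integration.integrable_sum)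
  have "integral\<^sup>L lborel g = - (\<Sum>i\<in>R. \<Sum>j\<in>R. integral\<^sup>L lborel (\<lambda>l. u i * frac_kernel t (B i j) l * u j))"
    unfolding geq using int by (simp add: Bochner_Integration.integral_sum Bochner_Integration.integrable_sum)
  also have "(\<Sum>i\<in>R. \<Sum>j\<in>R. integral\<^sup>L lborel (\<lambda>l. u i * frac_kernel t (B i j) l * u j))
     = (\<Sum>i\<in>R. \<Sum>j\<in>R. c * (u i * B i j powr t * u j))"
  proof (intro sum.cong refl)
    fix i j assume "i \<in> R" "j \<in> R"
    from frac_kernel_integral(2)[OF t nn[OF this]]
    show "integral\<^sup>L lborel (\<lambda>l. u i * frac_kernel t (B i j) l * u j) = c * (u i * B i j powr t * u j)"
      by (simp add: c_def)
  qed
  also have "\<dots> = c * bform R (\<lambda>i j. B i j powr t) u u"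
    by (simp add: bform_def sum_distrib_left)
  finally have I: "integral\<^sup>L lborel g = - (c * bform R (\<lambda>i j. B i j powr t) u u)" .
  have "0 \<le> integral\<^sup>L lborel g" by (intro integral_nonneg_AE AE_I2 g)
  then show "bform R (\<lambda>i j. B i j powr t) u u \<le> 0" using c unfolding I by (simp add: mult_le_0_iff)
  assume off: "\<And>i j. i \<in> R \<Longrightarrow> j \<in> R \<Longrightarrow> i \<noteq> j \<Longrightarrow> 0 < B i j"
    and hollow: "\<And>i. i \<in> R \<Longrightarrow> u i \<noteq> 0 \<Longrightarrow> B i i = 0" and ex: "\<exists>i\<in>R. u i \<noteq> 0"
  \<comment> \<open>As l grows the off-diagonal exponentials die out, while \<open>B i i = 0\<close>
    keeps the diagonal ones equal to 1 wherever u is nonzero. The limit is a positive sum of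
    squares, so g is positive on an interval and its integral is nonzero.\<close>
  have "(f \<longlongrightarrow> (\<Sum>i\<in>R. \<Sum>j\<in>R. if i = j then (u i)\<^sup>2 else 0)) at_top"
    unfolding f_def bform_def
  proof (intro tendsto_sum)
    fix i j assume ij: "i \<in> R" "j \<in> R"
    show "((\<lambda>l. u i * exp (- (l * B i j)) * u j) \<longlongrightarrow> (if i = j then (u i)\<^sup>2 else 0)) at_top"
    proof (cases "i = j")
      case True
      then have "(\<lambda>l. u i * exp (- (l * B i j)) * u j) = (\<lambda>l. (u i)\<^sup>2)"
        using hollow[OF ij(1)] by (cases "u i = 0") (auto simp: power2_eq_square)
      then show ?thesis using True by simp
    next
      case False
      have "filterlim (\<lambda>l. - (l * B i j)) at_bot at_top"
        using filterlim_tendsto_pos_mult_at_top[OF tendsto_const off[OF ij False] filterlim_ident]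
        by (simp add: filterlim_uminus_at_bot mult.commute)
      then have "((\<lambda>l. u i * exp (- (l * B i j)) * u j) \<longlongrightarrow> u i * 0 * u j) at_top"
        by (intro tendsto_intros filterlim_compose[OF exp_at_bot])
      then show ?thesis using False by simp
    qed
  qed
  moreover have "0 < (\<Sum>i\<in>R. \<Sum>j\<in>R. if i = j then (u i)\<^sup>2 else 0)"
  proof -
    have "(\<Sum>i\<in>R. \<Sum>j\<in>R. if i = j then (u i)\<^sup>2 else 0) = (\<Sum>i\<in>R. (u i)\<^sup>2)"
      using fin by (intro sum.cong) (auto simp: sum.delta)
    moreover obtain i where "i \<in> R" "u i \<noteq> 0" using ex by blast
    ultimately show ?thesis using fin by (auto intro!: sum_pos2[of R i])
  qed
  ultimately have "\<forall>\<^sub>F l in at_top. 0 < f l" by (rule order_tendstoD(1))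
  then obtain L where L: "\<And>l. L \<le> l \<Longrightarrow> 0 < f l" by (auto simp: eventually_at_top_linorder)
  have "integral\<^sup>L lborel g \<noteq> 0"
  proof
    assume "integral\<^sup>L lborel g = 0"
    then have "AE l in lborel. g l = 0" using integral_nonneg_eq_0_iff_AE[OF ig] g by auto
    then have "AE l in lborel. l \<notin> {max L 0<..<max L 0 + 1}"
    proof eventually_elim
      fix l assume "g l = 0"
      then show "l \<notin> {max L 0<..<max L 0 + 1}" using L[of l] by (auto simp: g_def)
    qed
    then show False using not_AE_notin_interval[of "max L 0" "max L 0 + 1"] by simp
  qed
  moreover have "bform R (\<lambda>i j. B i j powr t) u u \<le> 0"
    using \<open>0 \<le> integral\<^sup>L lborel g\<close> c unfolding I by (simp add: mult_le_0_iff)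
  ultimately show "bform R (\<lambda>i j. B i j powr t) u u < 0" unfolding I by (simp add: less_le)
qed

section \<open>Interior points\<close>

text \<open>Vectors are functions on the whole index type; with the coordinates outside R pinned to
  0, compactness comes from Tychonoff's theorem.\<close>

lemma compact_Pi_finite_support:
  "compact {z :: 'i \<Rightarrow> real. \<forall>i. z i \<in> (if i \<in> R then {-1..1} else {0})}"
proof -
  have "compactin (product_topology (\<lambda>i::'i. euclidean :: real topology) UNIV)
      (PiE UNIV (\<lambda>i. if i \<in> R then {-1..1} else {0}))"
    unfolding compactin_PiE by (auto simp: compactin_euclidean_iff)
  then show ?thesis
    unfolding euclidean_product_topology compactin_euclidean_iff by (simp add: PiE_UNIV_domain Pi_def)
qed

definition unit_sphere :: "'i set \<Rightarrow> ('i \<Rightarrow> real) set" where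
  "unit_sphere R = {z. (\<forall>i. i \<notin> R \<longrightarrow> z i = 0) \<and> (\<Sum>i\<in>R. (z i)\<^sup>2) = 1}"

lemma unit_sphere_abs_le:
  assumes "finite R" "z \<in> unit_sphere R"
  shows "\<bar>z i\<bar> \<le> 1"
proof (cases "i \<in> R")
  case True
  have "(z i)\<^sup>2 \<le> (\<Sum>i\<in>R. (z i)\<^sup>2)" using True assms(1) by (intro member_le_sum) auto
  then show ?thesis using assms(2) by (simp add: unit_sphere_def abs_square_le_1)
qed (use assms in \<open>simp add: unit_sphere_def\<close>)

lemma compact_unit_sphere:
  assumes "finite R"
  shows "compact (unit_sphere R)"
proof -
  have cont: "continuous_on UNIV (\<lambda>z :: 'a \<Rightarrow> real. z i)" for i by simp
  have "compact ({z :: 'a \<Rightarrow> real. \<forall>i. z i \<in> (if i \<in> R then {-1..1} else {0})} \<inter> {z. (\<Sum>i\<in>R. (z i)\<^sup>2) = 1})"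
    by (intro compact_Int_closed compact_Pi_finite_support closed_Collect_eq continuous_intros cont)
  also have "\<dots> = unit_sphere R"
    using unit_sphere_abs_le[OF assms] by (auto simp: unit_sphere_def abs_le_iff split: if_splits)
  finally show ?thesis .
qed

lemma unit_sphere_normalize:
  assumes fin: "finite R" and z: "\<exists>i\<in>R. z i \<noteq> 0"
  obtains c y where "0 < c" "y \<in> unit_sphere R" "\<And>i. i \<in> R \<Longrightarrow> z i = c * y i"
proof -
  define c where "c = sqrt (\<Sum>i\<in>R. (z i)\<^sup>2)"
  obtain i where "i \<in> R" "z i \<noteq> 0" using z by blast
  then have "0 < (\<Sum>i\<in>R. (z i)\<^sup>2)" using fin by (intro sum_pos2[of R i]) auto
  then have c: "0 < c" "c\<^sup>2 = (\<Sum>i\<in>R. (z i)\<^sup>2)" by (auto simp: c_def)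
  define y where "y i = (if i \<in> R then z i / c else 0)" for i
  have "(\<Sum>i\<in>R. (y i)\<^sup>2) = (\<Sum>i\<in>R. (z i)\<^sup>2) / c\<^sup>2"
    unfolding sum_divide_distrib by (intro sum.cong) (auto simp: y_def power_divide)
  then have "y \<in> unit_sphere R" using c(1) unfolding c(2)[symmetric] unit_sphere_def by (simp add: y_def)
  then show ?thesis using c(1) by (intro that[of c y]) (auto simp: y_def)
qed

lemma bform_eq_scaled:
  assumes "\<And>i. i \<in> R \<Longrightarrow> z i = c * y i"
  shows "bform R M z z = c\<^sup>2 * bform R M y y"
proof -
  have "bform R M z z = bform R M (\<lambda>i. c * y i) (\<lambda>i. c * y i)" using assms by (intro bform_cong) auto
  also have "\<dots> = c\<^sup>2 * bform R M y y"
    by (simp only: bform_scale_left bform_scale_right) (simp add: power2_eq_square)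
  finally show ?thesis .
qed

lemma continuous_on_bform_self: "continuous_on K (\<lambda>z. bform R C z z)"
proof -
  have "continuous_on UNIV (\<lambda>z :: 'a \<Rightarrow> real. z i)" for i by simp
  note c = continuous_on_subset[OF this]
  show ?thesis unfolding bform_def by (intro continuous_intros c) auto
qed

text \<open>By compactness C has a negative maximum on the unit vectors of the hyperplane.
  Coordinates of unit vectors have modulus at most 1, so entries perturbed by less than e change the
  value by at most e times the square of \<open>card R\<close>.\<close>

lemma negative_definite_perturb:
  fixes C :: "'i \<Rightarrow> 'i \<Rightarrow> real" and l :: "'i \<Rightarrow> real"
  assumes fin: "finite R"
    and neg: "\<And>z. (\<Sum>i\<in>R. l i * z i) = 0 \<Longrightarrow> \<exists>i\<in>R. z i \<noteq> 0 \<Longrightarrow> bform R C z z < 0"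
  shows "\<exists>e>0. \<forall>M. (\<forall>i\<in>R. \<forall>j\<in>R. \<bar>M i j - C i j\<bar> < e) \<longrightarrow>
    (\<forall>z. (\<Sum>i\<in>R. l i * z i) = 0 \<longrightarrow> bform R M z z \<le> 0)"
proof -
  define K where "K = unit_sphere R \<inter> {z. (\<Sum>i\<in>R. l i * z i) = 0}"
  have cont: "continuous_on UNIV (\<lambda>z :: 'i \<Rightarrow> real. z i)" for i by simp
  have "compact K"
    unfolding K_def by (intro compact_Int_closed compact_unit_sphere fin closed_Collect_eq continuous_intros cont)
  have normalize: "\<exists>c>0. \<exists>y\<in>K. \<forall>i\<in>R. z i = c * y i"
    if z: "(\<Sum>i\<in>R. l i * z i) = 0" "\<exists>i\<in>R. z i \<noteq> 0" for z
  proof -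
    obtain c y where c: "0 < c" "y \<in> unit_sphere R" "\<And>i. i \<in> R \<Longrightarrow> z i = c * y i"
      using unit_sphere_normalize[OF fin z(2)] by metis
    have "(\<Sum>i\<in>R. l i * z i) = c * (\<Sum>i\<in>R. l i * y i)"
      unfolding sum_distrib_left by (intro sum.cong) (auto simp: c(3))
    then have "(\<Sum>i\<in>R. l i * y i) = 0" using z(1) c(1) by simp
    then show ?thesis using c by (auto simp: K_def)
  qed
  have scale: "bform R M z z \<le> 0" if "\<forall>i\<in>R. z i = c * y i" "bform R M y y \<le> 0" for M z y and c :: real
    using that bform_eq_scaled[of R z c y M] by (simp add: mult_le_0_iff)
  have triv: "bform R M z z \<le> 0" if "\<not> (\<exists>i\<in>R. z i \<noteq> 0)" for M z
    using that unfolding bform_def by (intro sum_nonpos) auto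
  show ?thesis
  proof (cases "K = {}")
    case True
    have "bform R M z z \<le> 0" if "(\<Sum>i\<in>R. l i * z i) = 0" for M z
    proof (cases "\<exists>i\<in>R. z i \<noteq> 0")
      case True
      then show ?thesis using normalize[OF that] \<open>K = {}\<close> by auto
    qed (rule triv)
    then show ?thesis by (intro exI[of _ 1]) simp
  next
    case False
    from continuous_attains_sup[OF \<open>compact K\<close> False continuous_on_bform_self]
    obtain y0 where y0: "y0 \<in> K" "\<And>y. y \<in> K \<Longrightarrow> bform R C y y \<le> bform R C y0 y0" by blast
    define m where "m = bform R C y0 y0"
    have "\<exists>i\<in>R. y0 i \<noteq> 0"
    proof (rule ccontr)
      assume "\<not> ?thesis"
      then have "(\<Sum>i\<in>R. (y0 i)\<^sup>2) = 0" by (intro sum.neutral) auto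
      then show False using y0(1) by (simp add: K_def unit_sphere_def)
    qed
    then have m: "m < 0" unfolding m_def using y0(1) by (intro neg) (auto simp: K_def)
    define N where "N = real (card R) * real (card R) + 1"
    have N: "0 < N" by (simp add: N_def add_nonneg_pos)
    show ?thesis
    proof (intro exI[of _ "- m / N"] conjI allI impI)
      show "0 < - m / N" using divide_neg_pos[OF m N] by simp
      fix M z assume M: "\<forall>i\<in>R. \<forall>j\<in>R. \<bar>M i j - C i j\<bar> < - m / N" and z: "(\<Sum>i\<in>R. l i * z i) = 0"
      have "bform R M y y \<le> 0" if y: "y \<in> K" for y
      proof -
        have y1: "\<bar>y i\<bar> \<le> 1" for i using y unit_sphere_abs_le[OF fin] by (auto simp: K_def)
        have "bform R M y y - bform R C y y = (\<Sum>i\<in>R. \<Sum>j\<in>R. y i * (M i j - C i j) * y j)"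
          unfolding bform_def by (simp add: sum_subtractf[symmetric] algebra_simps)
        also have "\<dots> \<le> (\<Sum>i\<in>R. \<Sum>j\<in>R. - m / N)"
        proof (intro sum_mono)
          fix i j assume ij: "i \<in> R" "j \<in> R"
          have "y i * (M i j - C i j) * y j \<le> \<bar>y i * (M i j - C i j) * y j\<bar>" by simp
          also have "\<dots> = \<bar>y i\<bar> * \<bar>M i j - C i j\<bar> * \<bar>y j\<bar>" by (simp add: abs_mult)
          also have "\<dots> \<le> 1 * (- m / N) * 1"
            using y1[of i] y1[of j] M ij m N
            by (intro mult_mono) (auto intro: less_imp_le simp: divide_nonpos_pos)
          finally show "y i * (M i j - C i j) * y j \<le> - m / N" by simp
        qed
        also have "\<dots> = (real (card R) * real (card R) / N) * (- m)" by simp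
        also have "\<dots> \<le> 1 * (- m)" using m N by (intro mult_right_mono) (auto simp: N_def)
        finally show ?thesis using y0(2)[OF y] by (simp add: m_def)
      qed
      then show "bform R M z z \<le> 0" using normalize[OF z] scale triv by metis
    qed
  qed
qed

section \<open>Stability of Lorentzian forms under two-term relations\<close>

definition two_term_on :: "'i set \<Rightarrow> ('i \<Rightarrow> 'i \<Rightarrow> real) \<Rightarrow> bool" where
  "two_term_on R M \<longleftrightarrow> (\<forall>a\<in>R. \<forall>b\<in>R. \<forall>c\<in>R. \<forall>f\<in>R. M a f * M b c = 0 \<longrightarrow> M a b * M c f = M a c * M b f)"

text \<open>The zero entry annihilates one of the three products, so the two-term relation makes row
  i a multiple of row j.\<close>

lemma two_term_row:
  assumes M: "two_term_on R M" "symmetric_on R M" and i: "i \<in> R" "j \<in> R" "M i j = 0"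
    and c: "c \<in> R" "M j c \<noteq> 0" and k: "k \<in> R"
  shows "M i k = M i c / M j c * M j k"
proof -
  have "M i k * M c j = M i c * M k j" using M(1) i c(1) k unfolding two_term_on_def by simp
  moreover have "M c j = M j c" "M k j = M j k" using M(2) i c k unfolding symmetric_on_def by blast+
  ultimately show ?thesis using c by (simp add: field_simps)
qed

lemma maximal_clique:
  assumes "finite I"
  obtains T where "T \<subseteq> I" "\<And>i j. i \<in> T \<Longrightarrow> j \<in> T \<Longrightarrow> i \<noteq> j \<Longrightarrow> P i j"
    "\<And>i. i \<in> I - T \<Longrightarrow> \<exists>j\<in>T. \<not> P i j \<or> \<not> P j i"
proof -
  define F where "F = {T. T \<subseteq> I \<and> (\<forall>i\<in>T. \<forall>j\<in>T. i \<noteq> j \<longrightarrow> P i j)}"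
  have "F \<subseteq> Pow I" unfolding F_def by blast
  then have "finite F" using assms by (simp add: finite_subset)
  moreover have "F \<noteq> {}" unfolding F_def by blast
  ultimately obtain T where T: "T \<in> F" "\<And>T'. T' \<in> F \<Longrightarrow> T \<subseteq> T' \<Longrightarrow> T' = T"
    using finite_has_maximal[of F] by auto
  show ?thesis
  proof (rule that[of T])
    show "\<exists>j\<in>T. \<not> P i j \<or> \<not> P j i" if i: "i \<in> I - T" for i
    proof (rule ccontr)
      assume "\<not> ?thesis"
      then have "insert i T \<in> F" using T(1) i by (auto simp: F_def)
      then show False using T(2)[of "insert i T"] i by auto
    qed
  qed (use T(1) in \<open>auto simp: F_def\<close>)
qed

text \<open>The row sums r represent the functional A(1, .), and the all-ones vector has positive
  value; dividing by \<open>r i * r j\<close> therefore makes A conditionally negative definite, so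
  its t-th powers have nonpositive values. Strictness has two sources: if u meets a nonzero diagonal
  entry of B, the factor q < 1 loses a positive amount; otherwise the strict part of
  \<open>cnd_powr\<close> applies.\<close>

lemma strict_power_negative:
  assumes fin: "finite T" and sym: "symmetric_on T A" and lor: "lorentz_form T A"
    and nn: "\<And>i j. i \<in> T \<Longrightarrow> j \<in> T \<Longrightarrow> 0 \<le> A i j"
    and off: "\<And>i j. i \<in> T \<Longrightarrow> j \<in> T \<Longrightarrow> i \<noteq> j \<Longrightarrow> 0 < A i j"
    and row: "\<And>i. i \<in> T \<Longrightarrow> 0 < (\<Sum>k\<in>T. A i k)"
    and t: "0 < t" "t < 1" and q: "q < 1"
    and z: "(\<Sum>i\<in>T. (\<Sum>k\<in>T. A i k) powr t * z i) = 0" "\<exists>i\<in>T. z i \<noteq> 0"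
  shows "bform T (\<lambda>i j. A i j powr t * (if i = j then q else 1)) z z < 0"
proof -
  define r where "r i = (\<Sum>k\<in>T. A i k)" for i
  have r: "0 < r i" if "i \<in> T" for i using row that by (simp add: r_def)
  have symD: "A i j = A j i" if "i \<in> T" "j \<in> T" for i j using sym that unfolding symmetric_on_def by blast
  define B where "B i j = A i j / (r i * r j)" for i j
  define u where "u i = r i powr t * z i" for i
  have Bnn: "0 \<le> B i j" if "i \<in> T" "j \<in> T" for i j using nn r that by (simp add: B_def less_imp_le)
  have "T \<noteq> {}" using z(2) by auto
  have pos: "0 < bform T A (\<lambda>i. 1) (\<lambda>i. 1)"
  proof -
    have "bform T A (\<lambda>i. 1) (\<lambda>i. 1) = (\<Sum>i\<in>T. r i)" by (simp add: bform_def r_def)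
    then show ?thesis using r fin \<open>T \<noteq> {}\<close> by (simp add: sum_pos)
  qed
  have cnd: "cnd_on T B"
    unfolding cnd_on_def
  proof (intro conjI allI impI)
    show "symmetric_on T B" unfolding symmetric_on_def B_def using symD by (simp add: mult.commute)
    fix v :: "_ \<Rightarrow> real" assume v: "(\<Sum>i\<in>T. v i) = 0"
    have "bform T A (\<lambda>i. 1) (\<lambda>i. v i / r i) = (\<Sum>j\<in>T. r j * (v j / r j))"
      unfolding bform_right_functional r_def
      by (intro sum.cong refl arg_cong2[of _ _ _ _ "(*)"]) (auto intro!: sum.cong simp: symD)
    also have "\<dots> = (\<Sum>i\<in>T. v i)" using r by (intro sum.cong) (auto simp: less_imp_neq[symmetric])
    finally have "bform T A (\<lambda>i. v i / r i) (\<lambda>i. v i / r i) \<le> 0"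
      using lorentz_form_neg[OF lor pos] v by simp
    moreover have "bform T A (\<lambda>i. v i / r i) (\<lambda>i. v i / r i) = bform T B v v"
      unfolding bform_def B_def by (intro sum.cong refl) simp
    ultimately show "bform T B v v \<le> 0" by simp
  qed
  have u0: "(\<Sum>i\<in>T. u i) = 0" using z(1) by (simp add: u_def r_def)
  have "bform T (\<lambda>i j. A i j powr t * (if i = j then q else 1)) z z
     = bform T (\<lambda>i j. B i j powr t) u u - (\<Sum>i\<in>T. (1 - q) * B i i powr t * (u i)\<^sup>2)"
  proof -
    have "z i * (A i j powr t * (if i = j then q else 1)) * z j = u i * B i j powr t * u j
       - (if i = j then (1 - q) * B j j powr t * (u j)\<^sup>2 else 0)" if "i \<in> T" "j \<in> T" for i j
    proof -
      have "A i j = r i * r j * B i j" using r[OF that(1)] r[OF that(2)] by (simp add: B_def)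
      then have "A i j powr t = r i powr t * r j powr t * B i j powr t"
        using r[OF that(1)] r[OF that(2)] Bnn[OF that] by (simp add: powr_mult)
      then show ?thesis by (simp add: u_def power2_eq_square algebra_simps)
    qed
    then have "bform T (\<lambda>i j. A i j powr t * (if i = j then q else 1)) z z =
      (\<Sum>i\<in>T. \<Sum>j\<in>T. u i * B i j powr t * u j - (if i = j then (1 - q) * B j j powr t * (u j)\<^sup>2 else 0))"
      unfolding bform_def by (intro sum.cong refl) auto
    also have "\<dots> = bform T (\<lambda>i j. B i j powr t) u u - (\<Sum>i\<in>T. (1 - q) * B i i powr t * (u i)\<^sup>2)"
      unfolding bform_def sum_subtractf using fin by simp
    finally show ?thesis .
  qed
  moreover have nn2: "0 \<le> (1 - q) * B i i powr t * (u i)\<^sup>2" for i using q by simp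
  moreover have le: "bform T (\<lambda>i j. B i j powr t) u u \<le> 0"
    using cnd_powr(1)[OF fin cnd Bnn t u0] by simp
  moreover have "bform T (\<lambda>i j. B i j powr t) u u < 0 \<or> 0 < (\<Sum>i\<in>T. (1 - q) * B i i powr t * (u i)\<^sup>2)"
  proof (cases "\<exists>i\<in>T. u i \<noteq> 0 \<and> B i i \<noteq> 0")
    case True
    then obtain i where i: "i \<in> T" "u i \<noteq> 0" "B i i \<noteq> 0" by blast
    then have "0 < (1 - q) * B i i powr t * (u i)\<^sup>2" using q Bnn[of i i] by simp
    then show ?thesis using nn2 fin i by (intro disjI2 sum_pos2[of T i]) auto
  next
    case False
    have "0 < B i j" if "i \<in> T" "j \<in> T" "i \<noteq> j" for i j using off r that by (simp add: B_def)
    moreover have "\<exists>i\<in>T. u i \<noteq> 0" using z(2) r by (force simp: u_def)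
    ultimately show ?thesis using cnd_powr(2)[OF fin cnd Bnn t u0] False by blast
  qed
  ultimately show ?thesis using sum_nonneg[of T "\<lambda>i. (1 - q) * B i i powr t * (u i)\<^sup>2"] by fastforce
qed

(* If M i j = 0 for nonzero rows i and j, then these rows are proportional, so it suffices to consider
   M on a maximal set T of indices with nonzero entries between any two of them. *)
lemma lorentz_form_power_interior:
  fixes A :: "'i \<Rightarrow> 'i \<Rightarrow> real"
  assumes fin: "finite R" and sym: "symmetric_on R A" and lor: "lorentz_form R A"
    and nn: "\<And>i j. i \<in> R \<Longrightarrow> j \<in> R \<Longrightarrow> 0 \<le> A i j"
    and t: "0 < t" "t < 1" and q: "q < 1"
  shows "\<exists>e>0. \<forall>M. symmetric_on R M \<longrightarrow> two_term_on R M \<longrightarrow>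
    (\<forall>i\<in>R. \<forall>j\<in>R. M i j = 0 \<longleftrightarrow> A i j = 0) \<longrightarrow>
    (\<forall>i\<in>R. \<forall>j\<in>R. \<bar>M i j - A i j powr t * (if i = j then q else 1)\<bar> < e) \<longrightarrow> lorentz_form R M"
proof -
  define I where "I = {i\<in>R. \<exists>k\<in>R. A i k \<noteq> 0}"
  have I: "I \<subseteq> R" "finite I" using fin by (auto simp: I_def)
  obtain T where T: "T \<subseteq> I" and clique: "\<And>i j. i \<in> T \<Longrightarrow> j \<in> T \<Longrightarrow> i \<noteq> j \<Longrightarrow> A i j \<noteq> 0"
    and maximal: "\<And>i. i \<in> I - T \<Longrightarrow> \<exists>j\<in>T. \<not> A i j \<noteq> 0 \<or> \<not> A j i \<noteq> 0"
    using maximal_clique[where P = "\<lambda>i j. A i j \<noteq> 0", OF I(2)] by blast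
  have TR: "T \<subseteq> R" "finite T" using T I finite_subset by auto
  have symD: "A i j = A j i" if "i \<in> R" "j \<in> R" for i j using sym that unfolding symmetric_on_def by blast
  \<comment> \<open>Each index of a nonzero row is represented in T either by itself or by an index
    at which its row has a zero entry, and then the two rows are proportional.\<close>
  have "\<forall>i\<in>I. \<exists>j\<in>T. i = j \<or> A i j = 0" using maximal symD I TR by (metis DiffI subsetD)
  then obtain f where f: "\<And>i. i \<in> I \<Longrightarrow> f i \<in> T" "\<And>i. i \<in> I \<Longrightarrow> i = f i \<or> A i (f i) = 0" by metis
  \<comment> \<open>Stated for every M with the zero pattern of A, since it is needed for A itself
    and for its perturbations.\<close>
  have decomp: "\<exists>s. \<forall>i\<in>I. \<forall>k\<in>R. M i k = s i * M (f i) k"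
    if M: "symmetric_on R M" "two_term_on R M" "\<forall>i\<in>R. \<forall>j\<in>R. M i j = 0 \<longleftrightarrow> A i j = 0" for M
  proof -
    have "\<forall>i\<in>I. \<exists>s. \<forall>k\<in>R. M i k = s * M (f i) k"
    proof
      fix i assume i: "i \<in> I"
      have fi: "f i \<in> R" "f i \<in> I" using f(1)[OF i] TR T by auto
      show "\<exists>s. \<forall>k\<in>R. M i k = s * M (f i) k"
      proof (cases "i = f i")
        case True
        then show ?thesis by (intro exI[of _ 1]) auto
      next
        case False
        then have "M i (f i) = 0" using f(2)[OF i] M(3) i fi I by auto
        moreover obtain c where "c \<in> R" "M (f i) c \<noteq> 0" using fi M(3) by (auto simp: I_def)
        ultimately show ?thesis using two_term_row[OF M(2,1) _ fi(1)] i I by blast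
      qed
    qed
    then show ?thesis by metis
  qed
  have "two_term_on R A"
    unfolding two_term_on_def using lorentz_form_two_term[OF lor sym fin nn] by blast
  from decomp[OF sym this] obtain s where s: "\<And>i k. i \<in> I \<Longrightarrow> k \<in> R \<Longrightarrow> A i k = s i * A (f i) k" by blast
  \<comment> \<open>A nonzero entry in column k is moved into T by passing to column f k.\<close>
  have row: "0 < (\<Sum>k\<in>T. A i k)" if i: "i \<in> T" for i
  proof -
    have iR: "i \<in> R" using i TR by auto
    obtain k where k: "k \<in> R" "A i k \<noteq> 0" using i T by (auto simp: I_def)
    then have kI: "k \<in> I" using symD[OF iR] iR by (auto simp: I_def)
    have "A k i = s k * A (f k) i" using s[OF kI iR] .
    then have "A i (f k) \<noteq> 0" using k symD[OF iR k(1)] symD[OF iR, of "f k"] f(1)[OF kI] TR by auto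
    then have "0 < A i (f k)" using nn[OF iR, of "f k"] f(1)[OF kI] TR by (auto simp: less_le)
    then show ?thesis using f(1)[OF kI] TR nn iR by (intro sum_pos2[of T "f k"]) auto
  qed
  define l where "l i = (\<Sum>k\<in>T. A i k) powr t" for i
  define C where "C i j = A i j powr t * (if i = j then q else 1)" for i j
  have neg: "bform T C z z < 0" if "(\<Sum>i\<in>T. l i * z i) = 0" "\<exists>i\<in>T. z i \<noteq> 0" for z
    unfolding C_def
  proof (rule strict_power_negative[OF TR(2) symmetric_on_subset[OF sym TR(1)] lorentz_form_subset[OF lor fin TR(1)]])
    show "0 < A i j" if "i \<in> T" "j \<in> T" "i \<noteq> j" for i j
      using clique[OF that] nn[of i j] that TR by (auto simp: less_le)
  qed (use row t q nn TR that in \<open>auto simp: l_def\<close>)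
  have "\<exists>e>0. \<forall>M. (\<forall>i\<in>T. \<forall>j\<in>T. \<bar>M i j - C i j\<bar> < e) \<longrightarrow>
      (\<forall>z. (\<Sum>i\<in>T. l i * z i) = 0 \<longrightarrow> bform T M z z \<le> 0)"
    by (rule negative_definite_perturb[OF TR(2)]) (rule neg)
  then obtain e where e: "0 < e"
    and pert: "\<forall>M. (\<forall>i\<in>T. \<forall>j\<in>T. \<bar>M i j - C i j\<bar> < e) \<longrightarrow>
      (\<forall>z. (\<Sum>i\<in>T. l i * z i) = 0 \<longrightarrow> bform T M z z \<le> 0)"
    by (elim exE conjE) (rule that)
  show ?thesis
  proof (intro exI[of _ e] conjI allI impI e)
    fix M assume M: "symmetric_on R M" "two_term_on R M" "\<forall>i\<in>R. \<forall>j\<in>R. M i j = 0 \<longleftrightarrow> A i j = 0"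
      and close: "\<forall>i\<in>R. \<forall>j\<in>R. \<bar>M i j - A i j powr t * (if i = j then q else 1)\<bar> < e"
    have "\<forall>i\<in>T. \<forall>j\<in>T. \<bar>M i j - C i j\<bar> < e" using close TR unfolding C_def by blast
    from pert[rule_format, OF this[rule_format]] have lorT: "lorentz_form T M"
      by (rule lorentz_formI[OF symmetric_on_subset[OF M(1) TR(1)]])
    from decomp[OF M] obtain s where s: "\<And>i k. i \<in> I \<Longrightarrow> k \<in> R \<Longrightarrow> M i k = s i * M (f i) k" by blast
    have symM: "M i j = M j i" if "i \<in> R" "j \<in> R" for i j using M(1) that unfolding symmetric_on_def by blast
    have Mz: "M i j = 0" if "i \<in> R - I" "j \<in> R" for i j using that M(3) by (auto simp: I_def)
    show "lorentz_form R M"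
    proof (cases "I = {}")
      case True
      then have "bform R M x y = 0" for x y unfolding bform_def using Mz by (intro sum.neutral ballI) auto
      then show ?thesis by (simp add: lorentz_form_def)
    next
      case False
      then obtain i0 where "i0 \<in> I" by blast
      \<comment> \<open>Indices of zero rows get the factor 0 and an arbitrary representative, so
        that M is a pullback of its restriction to T.\<close>
      define g where "g i = (if i \<in> I then f i else f i0)" for i
      define s' where "s' i = (if i \<in> I then s i else 0)" for i
      have gT: "g i \<in> T" for i using f(1) \<open>i0 \<in> I\<close> by (auto simp: g_def)
      have "lorentz_form R (\<lambda>i j. s' i * M (g i) (g j) * s' j)"
        by (rule lorentz_form_pullback[OF lorT fin TR(2)]) (rule gT)
      moreover have M_eq: "M i j = s' i * M (g i) (g j) * s' j" if ij: "i \<in> R" "j \<in> R" for i j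
      proof (cases "i \<in> I \<and> j \<in> I")
        case True
        have fR: "f i \<in> R" "f j \<in> R" using f(1) True TR by auto
        have "M i j = s i * M (f i) j" using s True ij by blast
        also have "M (f i) j = M j (f i)" using symM fR ij by blast
        also have "\<dots> = s j * M (f j) (f i)" using s True fR by blast
        also have "M (f j) (f i) = M (f i) (f j)" using symM fR by blast
        finally show ?thesis using True by (simp add: g_def s'_def)
      next
        case False
        then have "M i j = 0" using Mz symM ij by (metis DiffI)
        then show ?thesis using False by (auto simp: s'_def)
      qed
      ultimately show ?thesis by (subst lorentz_form_cong[OF M_eq])
    qed
  qed
qed

section \<open>Spectral characterization and coefficients of derivatives\<close>

text \<open>Maximise the form on the unit sphere: e - A is positive semidefinite and vanishes at the
  maximiser v, so by Cauchy-Schwarz v lies in its kernel.\<close>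

lemma rayleigh_eigenvector:
  assumes fin: "finite R" and "R \<noteq> {}" and sym: "symmetric_on R A"
  shows "\<exists>e v. (\<Sum>i\<in>R. (v i)\<^sup>2) = 1 \<and> (\<forall>i\<in>R. (\<Sum>j\<in>R. A i j * v j) = e * v i)"
proof -
  obtain a where "a \<in> R" using \<open>R \<noteq> {}\<close> by blast
  then have "(\<lambda>i. if i = a then 1 else 0) \<in> unit_sphere R"
    using fin by (simp add: unit_sphere_def if_distrib[of "\<lambda>x. x\<^sup>2"] cong: if_cong)
  then obtain v where v: "v \<in> unit_sphere R" "\<And>y. y \<in> unit_sphere R \<Longrightarrow> bform R A y y \<le> bform R A v v"
    using continuous_attains_sup[OF compact_unit_sphere[OF fin] _ continuous_on_bform_self, of R A] by blast
  define e where "e = bform R A v v"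
  define K where "K i j = (if i = j then e else 0) - A i j" for i j
  have symK: "symmetric_on R K" using sym by (auto simp: symmetric_on_def K_def)
  have K: "bform R K x x = e * (\<Sum>i\<in>R. (x i)\<^sup>2) - bform R A x x" for x
  proof -
    have "x i * K i j * x j = (if i = j then e * (x j)\<^sup>2 else 0) - x i * A i j * x j" for i j
      by (simp add: K_def power2_eq_square algebra_simps)
    then show ?thesis unfolding bform_def using fin by (simp add: sum_subtractf sum_distrib_left)
  qed
  have "0 \<le> bform R K x x" for x
  proof (cases "\<exists>i\<in>R. x i \<noteq> 0")
    case True
    obtain c y where c: "0 < c" "y \<in> unit_sphere R" "\<And>i. i \<in> R \<Longrightarrow> x i = c * y i"
      using unit_sphere_normalize[OF fin True] by metis
    have "0 \<le> bform R K y y" unfolding K using v(2)[OF c(2)] c(2) by (simp add: unit_sphere_def e_def)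
    moreover have "bform R K x x = c\<^sup>2 * bform R K y y" by (rule bform_eq_scaled) (rule c(3))
    ultimately show ?thesis by simp
  next
    case False
    then show ?thesis unfolding bform_def by (intro sum_nonneg) auto
  qed
  then have psd: "psd_on R K" using symK by (simp add: psd_on_def)
  have "bform R K v v = 0" unfolding K using v(1) by (simp add: unit_sphere_def e_def)
  then have "(bform R K v x)\<^sup>2 \<le> 0" for x using psd_cauchy_schwarz[OF psd, of v x] by simp
  then have z: "bform R K v x = 0" for x by simp
  have "(\<Sum>j\<in>R. A i j * v j) = e * v i" if "i \<in> R" for i
  proof -
    have "(\<Sum>j\<in>R. K i j * v j) = 0" using bform_unit[OF fin that symK, of v] z by simp
    moreover have "K i j * v j = (if i = j then e * v j else 0) - A i j * v j" for j
      by (simp add: K_def algebra_simps)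
    ultimately show ?thesis using fin that by (simp add: sum_subtractf)
  qed
  then show ?thesis using v(1) unfolding unit_sphere_def by blast
qed

text \<open>Reflection in the hyperplane orthogonal to w = e_0 - v, which exchanges e_0 and v. For v
  = e_0 the division by s = 0 gives c = 0, and W is the identity.\<close>

lemma householder_reflection:
  fixes v :: "nat \<Rightarrow> real"
  assumes "0 < n" and v: "(\<Sum>i\<in>{0..<n}. (v i)\<^sup>2) = 1"
  shows "\<exists>W\<in>carrier_mat n n. transpose_mat W = W \<and> W * W = 1\<^sub>m n \<and> (\<forall>i<n. W $$ (i, 0) = v i)"
proof -
  define w where "w i = (if i = 0 then 1 else 0) - v i" for i
  define s where "s = (\<Sum>i\<in>{0..<n}. (w i)\<^sup>2)"
  define c where "c = 2 / s"
  have s_eq: "s = 2 * w 0"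
  proof -
    have "(w i)\<^sup>2 = (if i = 0 then 1 - 2 * v 0 else 0) + (v i)\<^sup>2" for i
      by (simp add: w_def power2_eq_square algebra_simps)
    then show ?thesis using assms by (simp add: s_def sum.distrib w_def)
  qed
  have wz: "w i = 0" if "s = 0" "i < n" for i
  proof -
    have "\<forall>i\<in>{0..<n}. (w i)\<^sup>2 = 0"
      using that(1) unfolding s_def by (subst (asm) sum_nonneg_eq_0_iff) auto
    then show ?thesis using that(2) by simp
  qed
  have c0: "c * w i * w 0 = w i" if "i < n" for i
    using wz[OF _ that] s_eq by (cases "s = 0") (auto simp: c_def field_simps)
  have css: "c * c * s = 2 * c" by (cases "s = 0") (auto simp: c_def)
  define W where "W = Matrix.mat n n (\<lambda>(i, j). (if i = j then 1 else 0) - c * w i * w j)"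
  have W: "W \<in> carrier_mat n n" by (simp add: W_def)
  have tr: "transpose_mat W = W" by (rule eq_matI) (auto simp: W_def)
  have "W * W = 1\<^sub>m n"
  proof (rule eq_matI)
    fix i j assume "i < dim_row (1\<^sub>m n :: real mat)" "j < dim_col (1\<^sub>m n :: real mat)"
    then have ij: "i < n" "j < n" by auto
    have "(W * W) $$ (i, j) = (\<Sum>k\<in>{0..<n}. ((if i = k then 1 else 0) - c * w i * w k) * ((if k = j then 1 else 0) - c * w k * w j))"
      using ij by (simp add: W_def scalar_prod_def)
    also have "\<dots> = (\<Sum>k\<in>{0..<n}. (if k = i then (if i = j then 1 else 0) - c * w i * w j else 0)
       - (if k = j then c * w i * w j else 0) + c * c * w i * w j * (w k)\<^sup>2)"
      by (intro sum.cong) (auto simp: power2_eq_square algebra_simps)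
    also have "\<dots> = (if i = j then 1 else 0) - c * w i * w j - c * w i * w j + c * c * w i * w j * s"
      using ij by (simp add: sum.distrib sum_subtractf s_def sum_distrib_left)
    also have "c * c * w i * w j * s = 2 * c * w i * w j" using css by (metis mult.assoc mult.commute)
    finally show "(W * W) $$ (i, j) = (1\<^sub>m n) $$ (i, j)" using ij by simp
  qed (use W in auto)
  moreover have "W $$ (i, 0) = v i" if "i < n" for i
  proof -
    have "W $$ (i, 0) = (if i = 0 then 1 else 0) - c * w i * w 0" using that assms(1) by (simp add: W_def)
    also have "\<dots> = (if i = 0 then 1 else 0) - w i" by (simp only: c0[OF that])
    also have "\<dots> = v i" by (simp add: w_def)
    finally show ?thesis .
  qed
  ultimately show ?thesis using W tr by blast
qed

text \<open>A reflection taking e_0 to an eigenvector splits a 1 by 1 block off the matrix; the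
  other block is diagonalised by induction.\<close>

lemma real_symmetric_diagonalization:
  fixes A :: "real mat"
  assumes "A \<in> carrier_mat n n" "transpose_mat A = A"
  shows "\<exists>P\<in>carrier_mat n n. \<exists>es. transpose_mat P * P = 1\<^sub>m n \<and> transpose_mat P * A * P = mat_diag n es"
  using assms
proof (induction n arbitrary: A)
  case 0
  show ?case by (intro bexI[of _ "1\<^sub>m 0"] exI[of _ "\<lambda>_. 0"] conjI eq_matI) (auto simp: mat_diag_def)
next
  case (Suc m)
  note A = Suc.prems
  let ?N = "Suc m"
  have sA: "A $$ (i, j) = A $$ (j, i)" if "i < ?N" "j < ?N" for i j
    using A that by (metis carrier_matD index_transpose_mat(1))
  have "\<exists>e v. (\<Sum>i\<in>{0..<?N}. (v i)\<^sup>2) = 1 \<and> (\<forall>i\<in>{0..<?N}. (\<Sum>j\<in>{0..<?N}. A $$ (i, j) * v j) = e * v i)"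
    by (rule rayleigh_eigenvector) (use sA in \<open>auto simp: symmetric_on_def\<close>)
  then obtain e v where v: "(\<Sum>i\<in>{0..<?N}. (v i)\<^sup>2) = 1"
    "\<forall>i\<in>{0..<?N}. (\<Sum>j\<in>{0..<?N}. A $$ (i, j) * v j) = e * v i" by blast
  obtain W where W: "W \<in> carrier_mat ?N ?N" "transpose_mat W = W" "W * W = 1\<^sub>m ?N"
    "\<And>i. i < ?N \<Longrightarrow> W $$ (i, 0) = v i"
    using householder_reflection[OF _ v(1)] by auto
  define A' where "A' = W * A * W"
  have A': "A' \<in> carrier_mat ?N ?N" using W A by (simp add: A'_def)
  have A'T: "transpose_mat A' = A'"
    unfolding A'_def using W A
    by (simp add: transpose_mult[of _ ?N ?N _ ?N] assoc_mult_mat[of _ ?N ?N _ ?N _ ?N])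
  have sA': "A' $$ (i, j) = A' $$ (j, i)" if "i < ?N" "j < ?N" for i j
    using A' A'T that by (metis carrier_matD index_transpose_mat(1))
  have col: "A' $$ (i, 0) = (if i = 0 then e else 0)" if i: "i < ?N" for i
  proof -
    have AW: "(A * W) $$ (k, 0) = e * W $$ (k, 0)" if "k < ?N" for k
    proof -
      have "(A * W) $$ (k, 0) = (\<Sum>j\<in>{0..<?N}. A $$ (k, j) * W $$ (j, 0))"
        using that A W by (simp add: scalar_prod_def del: sum.op_ivl_Suc)
      also have "\<dots> = (\<Sum>j\<in>{0..<?N}. A $$ (k, j) * v j)" using W(4) by (intro sum.cong) auto
      finally show ?thesis using v(2) W(4)[OF that] that by (simp del: sum.op_ivl_Suc)
    qed
    have "A' = W * (A * W)" unfolding A'_def using W A by (simp add: assoc_mult_mat[of _ ?N ?N _ ?N _ ?N])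
    then have "A' $$ (i, 0) = (\<Sum>k\<in>{0..<?N}. W $$ (i, k) * (A * W) $$ (k, 0))"
      using i A W by (simp add: scalar_prod_def del: sum.op_ivl_Suc index_mult_mat(1)) (simp add: scalar_prod_def del: sum.op_ivl_Suc)
    also have "\<dots> = (\<Sum>k\<in>{0..<?N}. e * (W $$ (i, k) * W $$ (k, 0)))"
      using AW by (intro sum.cong) auto
    also have "\<dots> = e * (W * W) $$ (i, 0)"
      using i W(1) by (simp add: scalar_prod_def sum_distrib_left del: sum.op_ivl_Suc)
    also have "(W * W) $$ (i, 0) = (if i = 0 then 1 else 0)" unfolding W(3) using i by simp
    finally show ?thesis by simp
  qed
  define A3 where "A3 = Matrix.mat m m (\<lambda>(i, j). A' $$ (Suc i, Suc j))"
  have A3: "A3 \<in> carrier_mat m m" by (simp add: A3_def)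
  have "transpose_mat A3 = A3" by (rule eq_matI) (auto simp: A3_def sA')
  from Suc.IH[OF A3 this] obtain P3 es where P3: "P3 \<in> carrier_mat m m" "transpose_mat P3 * P3 = 1\<^sub>m m"
    "transpose_mat P3 * A3 * P3 = mat_diag m es" by blast
  let ?E = "mat_diag 1 (\<lambda>_. e)"
  have A'b: "A' = four_block_mat ?E (0\<^sub>m 1 m) (0\<^sub>m m 1) A3"
    using A' col sA' by (intro eq_matI) (auto simp: A3_def mat_diag_def)
  define P' where "P' = four_block_mat (1\<^sub>m 1) (0\<^sub>m 1 m) (0\<^sub>m m 1) P3"
  have P': "P' \<in> carrier_mat ?N ?N" using four_block_carrier_mat[of "1\<^sub>m 1" 1 1 P3 m m] P3(1) by (simp add: P'_def)
  have P'T: "transpose_mat P' = four_block_mat (1\<^sub>m 1) (0\<^sub>m 1 m) (0\<^sub>m m 1) (transpose_mat P3)"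
    unfolding P'_def using P3(1) by (subst transpose_four_block_mat[of _ 1 1 _ m _ m]) auto
  have one: "transpose_mat P' * P' = 1\<^sub>m ?N"
    unfolding P'T unfolding P'_def using P3
    by (subst mult_four_block_mat[of _ 1 1 _ m _ m _ _ 1 _ m]) auto
  have diag: "transpose_mat P' * A' * P' = mat_diag ?N (\<lambda>i. if i = 0 then e else es (i - 1))"
  proof -
    have E: "?E \<in> carrier_mat 1 1" by simp
    have E1: "1\<^sub>m (Suc 0) * ?E = ?E" "0\<^sub>m m (Suc 0) * ?E = 0\<^sub>m m 1"
      "?E * 1\<^sub>m (Suc 0) = ?E" "?E * 0\<^sub>m (Suc 0) m = 0\<^sub>m 1 m"
      using left_mult_one_mat[OF E] left_mult_zero_mat[OF E] right_mult_one_mat[OF E] right_mult_zero_mat[OF E]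
      by simp_all
    have "transpose_mat P' * A' = four_block_mat ?E (0\<^sub>m 1 m) (0\<^sub>m m 1) (transpose_mat P3 * A3)"
      unfolding P'T A'b using P3(1) A3 E E1
      by (subst mult_four_block_mat[of _ 1 1 _ m _ m _ _ 1 _ m]) auto
    then have "transpose_mat P' * A' * P' = four_block_mat ?E (0\<^sub>m 1 m) (0\<^sub>m m 1) (mat_diag m es)"
      unfolding P'_def P3(3)[symmetric] using P3(1) A3 E E1
      by (simp, subst mult_four_block_mat[of _ 1 1 _ m _ m _ _ 1 _ m]) auto
    also have "\<dots> = mat_diag ?N (\<lambda>i. if i = 0 then e else es (i - 1))"
      by (rule eq_matI) (auto simp: mat_diag_def)
    finally show ?thesis .
  qed
  define P where "P = W * P'"
  have P: "P \<in> carrier_mat ?N ?N" using W P' by (simp add: P_def)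
  have PT: "transpose_mat P = transpose_mat P' * W"
    unfolding P_def using W P' by (simp add: transpose_mult[of _ ?N ?N _ ?N])
  have P'T': "transpose_mat P' \<in> carrier_mat ?N ?N" using P' by simp
  note assoc = assoc_mult_mat[of _ ?N ?N _ ?N _ ?N]
  have "transpose_mat P * P = transpose_mat P' * (W * W) * P'"
    unfolding PT unfolding P_def using W(1) P' P'T' by (simp add: assoc)
  then have 1: "transpose_mat P * P = 1\<^sub>m ?N" unfolding W(3) using one P' P'T' by simp
  have "transpose_mat P * A * P = transpose_mat P' * A' * P'"
    unfolding PT A'_def unfolding P_def using W(1) P' P'T' A(1) by (simp add: assoc)
  then show ?case using P 1 diag by metis
qed

text \<open>In an orthonormal eigenbasis the quadratic form is the sum of es_k L_k^2. If at most
  es_p is positive, it is nonpositive on the kernel of L_p; two positive eigenvalues give orthogonal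
  vectors that violate reversed Cauchy-Schwarz.\<close>

lemma num_pos_eigenvalues_le_one_iff:
  assumes A: "A \<in> carrier_mat n n" and sym: "\<And>i j. i < n \<Longrightarrow> j < n \<Longrightarrow> A $$ (i, j) = A $$ (j, i)"
  shows "num_pos_eigenvalues A \<le> 1 \<longleftrightarrow> lorentz_form {..<n} (\<lambda>i j. A $$ (i, j))"
proof -
  have T: "transpose_mat A = A" using A sym by (intro eq_matI) auto
  obtain P es where P: "P \<in> carrier_mat n n" "transpose_mat P * P = 1\<^sub>m n"
    "transpose_mat P * A * P = mat_diag n es"
    using real_symmetric_diagonalization[OF A T] by blast
  let ?D = "mat_diag n es"
  have PT: "transpose_mat P \<in> carrier_mat n n" using P by simp
  have PPT: "P * transpose_mat P = 1\<^sub>m n" by (rule mat_mult_left_right_inverse[OF PT P(1,2)])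
  note assoc = assoc_mult_mat[of _ n n _ n _ n]
  have Aeq: "A = P * ?D * transpose_mat P"
  proof -
    have "P * ?D * transpose_mat P = (P * transpose_mat P) * A * (P * transpose_mat P)"
      unfolding P(3)[symmetric] using P(1) PT A by (simp add: assoc)
    then show ?thesis unfolding PPT using A by simp
  qed
  have "similar_mat A ?D"
    by (rule similar_matI[OF _ PPT P(2) Aeq]) (use A P PT in auto)
  then have "char_poly A = char_poly ?D" by (rule char_poly_similar)
  also have "\<dots> = (\<Prod>a\<leftarrow>map es [0..<n]. [:- a, 1:])"
  proof -
    have "diag_mat ?D = map es [0..<n]" by (auto simp: diag_mat_def mat_diag_def intro!: nth_equalityI)
    then show ?thesis by (subst char_poly_upper_triangular[of _ n]) (auto simp: mat_diag_def)
  qed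
  finally have "proots (char_poly A) = (\<Sum>p\<leftarrow>map (\<lambda>a. [:- a, 1:]) (map es [0..<n]). proots p)"
    using proots_prod_list[of "map (\<lambda>a. [:- a, 1:]) (map es [0..<n])"] by (simp add: image_iff)
  also have "\<dots> = mset (map es [0..<n])"
    by (induction n) auto
  finally have "num_pos_eigenvalues A = length (filter (\<lambda>x. x > 0) (map es [0..<n]))"
    unfolding num_pos_eigenvalues_def by (metis mset_filter size_mset)
  also have "\<dots> = card {i. i < n \<and> 0 < es i}"
    unfolding length_filter_conv_card by (intro arg_cong[of _ _ card]) auto
  finally have num: "num_pos_eigenvalues A = card {i. i < n \<and> 0 < es i}" .
  have fin: "finite {i. i < n \<and> 0 < es i}" by simp
  have entry: "A $$ (i, j) = (\<Sum>k<n. es k * P $$ (i, k) * P $$ (j, k))" if ij: "i < n" "j < n" for i j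
  proof -
    have "A $$ (i, j) = (P * ?D * transpose_mat P) $$ (i, j)" by (simp add: Aeq[symmetric])
    also have "P * ?D = Matrix.mat n n (\<lambda>(i, k). P $$ (i, k) * es k)" by (rule mat_diag_mult_right[OF P(1)])
    also have "(\<dots> * transpose_mat P) $$ (i, j) = (\<Sum>k\<in>{0..<n}. P $$ (i, k) * es k * P $$ (j, k))"
      using ij P(1) by (simp add: scalar_prod_def)
    finally show ?thesis by (simp add: lessThan_atLeast0 mult_ac)
  qed
  define L where "L k x = (\<Sum>i<n. P $$ (i, k) * x i)" for k and x :: "nat \<Rightarrow> real"
  have form: "bform {..<n} (\<lambda>i j. A $$ (i, j)) x y = (\<Sum>k<n. es k * L k x * L k y)" for x y
  proof -
    have "bform {..<n} (\<lambda>i j. A $$ (i, j)) x y =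
      (\<Sum>i<n. \<Sum>j<n. \<Sum>k<n. es k * ((P $$ (i, k) * x i) * (P $$ (j, k) * y j)))"
      unfolding bform_def by (intro sum.cong refl) (simp add: entry sum_distrib_left sum_distrib_right mult_ac)
    also have "\<dots> = (\<Sum>i<n. \<Sum>k<n. \<Sum>j<n. es k * ((P $$ (i, k) * x i) * (P $$ (j, k) * y j)))"
      by (rule sum.cong[OF refl], rule sum.swap)
    also have "\<dots> = (\<Sum>k<n. \<Sum>i<n. \<Sum>j<n. es k * ((P $$ (i, k) * x i) * (P $$ (j, k) * y j)))"
      by (rule sum.swap)
    also have "\<dots> = (\<Sum>k<n. es k * L k x * L k y)"
    proof (rule sum.cong[OF refl])
      fix k
      have "L k x * L k y = (\<Sum>i<n. \<Sum>j<n. (P $$ (i, k) * x i) * (P $$ (j, k) * y j))"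
        unfolding L_def by (rule sum_product)
      then show "(\<Sum>i<n. \<Sum>j<n. es k * ((P $$ (i, k) * x i) * (P $$ (j, k) * y j))) = es k * L k x * L k y"
        by (simp only: sum_distrib_left mult.assoc[of "es k"])
    qed
    finally show ?thesis .
  qed
  have Lcol: "L k (\<lambda>i. P $$ (i, l)) = (if k = l then 1 else 0)" if "k < n" "l < n" for k l
  proof -
    have "(transpose_mat P * P) $$ (k, l) = L k (\<lambda>i. P $$ (i, l))"
      using that P(1) by (simp add: scalar_prod_def L_def lessThan_atLeast0)
    then show ?thesis unfolding P(2) using that by simp
  qed
  have symA: "symmetric_on {..<n} (\<lambda>i j. A $$ (i, j))" using sym by (simp add: symmetric_on_def)
  show ?thesis
  proof
    assume "num_pos_eigenvalues A \<le> 1"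
    then have le: "\<forall>a\<in>{i. i < n \<and> 0 < es i}. \<forall>b\<in>{i. i < n \<and> 0 < es i}. a = b"
      unfolding num using card_le_Suc0_iff_eq[OF fin] by simp
    have "\<exists>p. \<forall>k<n. k \<noteq> p \<longrightarrow> es k \<le> 0" using le by (metis (no_types, lifting) mem_Collect_eq not_le)
    then obtain p where p: "\<And>k. k < n \<Longrightarrow> k \<noteq> p \<Longrightarrow> es k \<le> 0" by blast
    show "lorentz_form {..<n} (\<lambda>i j. A $$ (i, j))"
    proof (rule lorentz_formI[OF symA])
      fix z :: "nat \<Rightarrow> real" assume "(\<Sum>i<n. P $$ (i, p) * z i) = 0"
      then have "L p z = 0" by (simp add: L_def)
      then show "bform {..<n} (\<lambda>i j. A $$ (i, j)) z z \<le> 0"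
        unfolding form
      proof (intro sum_nonpos)
        fix k assume "k \<in> {..<n}"
        then show "es k * L k z * L k z \<le> 0"
          using p[of k] \<open>L p z = 0\<close> by (cases "k = p") (auto simp: mult.assoc mult_le_0_iff)
      qed
    qed
  next
    assume lor: "lorentz_form {..<n} (\<lambda>i j. A $$ (i, j))"
    have "\<forall>a\<in>{i. i < n \<and> 0 < es i}. \<forall>b\<in>{i. i < n \<and> 0 < es i}. a = b"
    proof (intro ballI, rule ccontr)
      fix a b assume ab: "a \<in> {i. i < n \<and> 0 < es i}" "b \<in> {i. i < n \<and> 0 < es i}" "a \<noteq> b"
      have v: "bform {..<n} (\<lambda>i j. A $$ (i, j)) (\<lambda>i. P $$ (i, k)) (\<lambda>i. P $$ (i, l)) = (if k = l then es k else 0)"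
        if "k < n" "l < n" for k l
      proof -
        have "bform {..<n} (\<lambda>i j. A $$ (i, j)) (\<lambda>i. P $$ (i, k)) (\<lambda>i. P $$ (i, l)) =
          (\<Sum>m<n. if m = k then (if k = l then es k else 0) else 0)"
          unfolding form using that by (intro sum.cong refl) (auto simp: Lcol)
        then show ?thesis using that by simp
      qed
      have "es a * es b \<le> 0"
        using lor[unfolded lorentz_form_def, rule_format, of "\<lambda>i. P $$ (i, a)" "\<lambda>i. P $$ (i, b)"] ab
        by (simp add: v)
      then show False using ab by (simp add: mult_le_0_iff)
    qed
    then show "num_pos_eigenvalues A \<le> 1" unfolding num using card_le_Suc0_iff_eq[OF fin] by simp
  qed
qed

section \<open>Normalised coefficients of derivatives\<close>

lemma lookup_partial_deriv:
  "lk (partial_deriv i f) \<mu> = (real (lk \<mu> i) + 1) * lk f (\<mu> + ee i)"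
proof -
  have "lk (partial_deriv i f) \<mu> = (\<Sum>\<nu>\<in>Poly_Mapping.keys f. if \<nu> = \<mu> + ee i then (real (lk \<mu> i) + 1) * lk f \<nu> else 0)"
    unfolding partial_deriv_def lookup_sum
  proof (rule sum.cong[OF refl])
    fix \<nu>
    show "lk (Poly_Mapping.single (\<nu> - ee i) (real (lk \<nu> i) * lk f \<nu>)) \<mu> =
      (if \<nu> = \<mu> + ee i then (real (lk \<mu> i) + 1) * lk f \<nu> else 0)"
    proof (cases "0 < lk \<nu> i")
      case True
      then have "\<nu> - ee i = \<mu> \<longleftrightarrow> \<nu> = \<mu> + ee i" by (metis expo_minus_plus_unit expo_plus_minus_unit)
      then show ?thesis by (auto simp: lookup_single when_def lookup_add)
    next
      case False
      then have "\<nu> \<noteq> \<mu> + ee i" by (auto simp: lookup_add)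
      then show ?thesis using False by simp
    qed
  qed
  then show ?thesis by (simp add: sum.delta in_keys_iff)
qed

lemma prod_fact_superset:
  fixes \<mu> :: expo
  assumes "finite S" "Poly_Mapping.keys \<mu> \<subseteq> S"
  shows "(\<Prod>i\<in>Poly_Mapping.keys \<mu>. fact (lk \<mu> i) :: real) = (\<Prod>i\<in>S. fact (lk \<mu> i))"
  by (rule prod.mono_neutral_left) (use assms in \<open>auto simp: in_keys_iff\<close>)

text \<open>The exponent produced by differentiation is absorbed by the factorial, so derivatives
  merely shift normalised coefficients.\<close>

lemma norm_coeff_partial_deriv: "norm_coeff (partial_deriv i f) \<mu> = norm_coeff f (\<mu> + ee i)"
proof -
  let ?S = "insert i (Poly_Mapping.keys \<mu>)"
  have k: "Poly_Mapping.keys (\<mu> + ee i) \<subseteq> ?S" by (auto simp: in_keys_iff lookup_add split: if_splits)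
  have "(\<Prod>k\<in>?S. fact (lk (\<mu> + ee i) k) :: real) = fact (lk \<mu> i + 1) * (\<Prod>k\<in>?S - {i}. fact (lk \<mu> k))"
    by (subst prod.remove[of _ i]) (auto simp: lookup_add)
  also have "\<dots> = (real (lk \<mu> i) + 1) * (\<Prod>k\<in>?S. fact (lk \<mu> k))"
    by (subst (2) prod.remove[of _ i]) auto
  finally show ?thesis
    unfolding norm_coeff_def lookup_partial_deriv
    by (subst (1 2) prod_fact_superset[of ?S]) (use k in auto)
qed

lemma norm_coeff_partial_deriv_power:
  "norm_coeff ((partial_deriv i ^^ k) f) \<mu> = norm_coeff f (\<mu> + Poly_Mapping.single i k)"
proof (induction k arbitrary: \<mu>)
  case (Suc k)
  have "\<mu> + ee i + Poly_Mapping.single i k = \<mu> + Poly_Mapping.single i (Suc k)"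
    by (simp add: unit_expo_def add.assoc single_add[symmetric])
  then show ?case using Suc[of "\<mu> + ee i"] by (simp add: norm_coeff_partial_deriv)
qed simp

lemma norm_coeff_multi_deriv: "norm_coeff (multi_deriv \<alpha> f) \<mu> = norm_coeff f (\<mu> + \<alpha>)"
proof -
  have "norm_coeff (fold (\<lambda>i. partial_deriv i ^^ lk \<alpha> i) xs f) \<mu> =
    norm_coeff f (\<mu> + (\<Sum>i\<leftarrow>xs. Poly_Mapping.single i (lk \<alpha> i)))" for xs
    by (induction xs arbitrary: f) (simp_all add: norm_coeff_partial_deriv_power ac_simps)
  moreover have "(\<Sum>i\<leftarrow>sorted_list_of_set (Poly_Mapping.keys \<alpha>). Poly_Mapping.single i (lk \<alpha> i)) = \<alpha>"
  proof (rule poly_mapping_eqI)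
    fix k
    show "lk (\<Sum>i\<leftarrow>sorted_list_of_set (Poly_Mapping.keys \<alpha>). Poly_Mapping.single i (lk \<alpha> i)) k = lk \<alpha> k"
      by (simp add: sum_list_distinct_conv_sum_set lookup_sum lookup_single when_def sum.delta in_keys_iff)
  qed
  ultimately show ?thesis by (simp add: multi_deriv_def)
qed

lemma norm_coeff_zero: "norm_coeff g 0 = lk g 0"
  by (simp add: norm_coeff_def)

lemma poly_support_eq_keys: "poly_support f = Poly_Mapping.keys f"
  by (auto simp: poly_support_def norm_coeff_def in_keys_iff)

text \<open>The Hessian entries are themselves normalised coefficients, so Lorentzian polynomials
  can be described by \<open>lorentz_form\<close> alone.\<close>

lemma num_pos_eigenvalues_hessian:
  "num_pos_eigenvalues (const_hessian n (multi_deriv \<alpha> f)) \<le> 1 \<longleftrightarrow>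
    lorentz_form {..<n} (\<lambda>i j. norm_coeff f (\<alpha> + ee i + ee j))"
proof -
  let ?H = "const_hessian n (multi_deriv \<alpha> f)"
  have e: "?H $$ (i, j) = norm_coeff f (\<alpha> + ee i + ee j)" if "i < n" "j < n" for i j
  proof -
    have "?H $$ (i, j) = norm_coeff (partial_deriv i (partial_deriv j (multi_deriv \<alpha> f))) 0"
      using that by (simp add: const_hessian_def hessian_def norm_coeff_zero)
    then show ?thesis by (simp add: norm_coeff_partial_deriv norm_coeff_multi_deriv ac_simps)
  qed
  have "?H \<in> carrier_mat n n" by (simp add: const_hessian_def hessian_def)
  then have "num_pos_eigenvalues ?H \<le> 1 \<longleftrightarrow> lorentz_form {..<n} (\<lambda>i j. ?H $$ (i, j))"
    by (rule num_pos_eigenvalues_le_one_iff) (simp add: e ac_simps)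
  also have "\<dots> \<longleftrightarrow> lorentz_form {..<n} (\<lambda>i j. norm_coeff f (\<alpha> + ee i + ee j))"
    by (rule lorentz_form_cong) (simp add: e)
  finally show ?thesis .
qed

section \<open>The logarithmic image of the Lorentzian polynomials\<close>

lemma lookup_scaleR: "lk (c *\<^sub>R v) x = c * lk v x" for v :: "'b \<Rightarrow>\<^sub>0 real"
proof -
  have "finite {x. c * lk v x \<noteq> 0}"
    by (rule finite_subset[of _ "Poly_Mapping.keys v"]) (auto simp: in_keys_iff)
  then show ?thesis by (simp add: scaleR_poly_mapping_def)
qed

lemma abs_lookup_diff_le: "\<bar>lk v x - lk w x\<bar> \<le> dist v w" for v w :: "'b \<Rightarrow>\<^sub>0 real"
proof (cases "x \<in> Poly_Mapping.keys v \<union> Poly_Mapping.keys w")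
  case True
  then have "dist (lk v x) (lk w x) \<le> (\<Sum>x\<in>Poly_Mapping.keys v \<union> Poly_Mapping.keys w. dist (lk v x) (lk w x))"
    by (intro member_le_sum) auto
  then show ?thesis by (simp add: dist_poly_mapping_def dist_real_def)
qed (simp add: in_keys_iff)

lemma continuous_on_lookup [continuous_intros]:
  assumes "continuous_on S h"
  shows "continuous_on S (\<lambda>z. lk (h z :: 'b \<Rightarrow>\<^sub>0 real) x)"
proof -
  have "continuous_on UNIV (\<lambda>v :: 'b \<Rightarrow>\<^sub>0 real. lk v x)"
    unfolding continuous_on_iff
    using abs_lookup_diff_le by (metis dist_real_def order_le_less_trans)
  then show ?thesis using continuous_on_compose2[OF _ assms] by blast
qed

context M_convex_subset
begin

definition exp_coeff :: "(expo \<Rightarrow>\<^sub>0 real) \<Rightarrow> expo \<Rightarrow> real" where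
  "exp_coeff v x = (if x \<in> J then exp (lk v x) else 0)"

text \<open>The support is J, which is M-convex by assumption, so only the conditions on the
  second-order coefficient matrices remain.\<close>

definition log_lorentzian :: "(expo \<Rightarrow>\<^sub>0 real) set" where
  "log_lorentzian = {v. Poly_Mapping.keys v \<subseteq> J \<and> (2 \<le> d \<longrightarrow> (\<forall>\<alpha>\<in>discrete_simplex n (d - 2).
     lorentz_form {..<n} (\<lambda>i j. exp_coeff v (\<alpha> + ee i + ee j))))}"

lemma keys_subset_iff: "Poly_Mapping.keys v \<subseteq> J \<longleftrightarrow> (\<forall>x. x \<notin> J \<longrightarrow> lk v x = 0)"
  by (auto simp: in_keys_iff)

lemma lookup_sum_single:
  "lk (\<Sum>x\<in>J. Poly_Mapping.single x (c x)) y = (if y \<in> J then c y else 0)"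
  using finite_J by (simp add: lookup_sum lookup_single when_def sum.delta)

lemma lookup_log_vec: "lk (log_vec J \<rho>) x = (if x \<in> J then ln (\<rho> x) else 0)"
  unfolding log_vec_def by (rule lookup_sum_single)

lemma lookup_ones_vec: "lk (ones_vec J) x = (if x \<in> J then 1 else 0)"
  unfolding ones_vec_def by (rule lookup_sum_single)

lemma supported_exp_coeff: "supported (exp_coeff v)"
  by (simp add: supported_def exp_coeff_def)

lemma exp_coeff_nonneg: "0 \<le> exp_coeff v x"
  by (simp add: exp_coeff_def)

lemma log_vec_exp_coeff:
  assumes "Poly_Mapping.keys v \<subseteq> J"
  shows "log_vec J (exp_coeff v) = v"
  using assms unfolding keys_subset_iff by (intro poly_mapping_eqI) (simp add: lookup_log_vec exp_coeff_def)

lemma keys_log_vec: "Poly_Mapping.keys (log_vec J \<rho>) \<subseteq> J"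
  by (simp add: keys_subset_iff lookup_log_vec)

lemma exp_coeff_log_vec:
  assumes "\<And>x. x \<in> J \<Longrightarrow> 0 < \<rho> x"
  shows "exp_coeff (log_vec J \<rho>) = (\<lambda>x. if x \<in> J then \<rho> x else 0)"
  using assms by (auto simp: exp_coeff_def lookup_log_vec)

lemma exp_coeff_add: "exp_coeff (v + w) x = exp_coeff v x * exp_coeff w x"
  by (simp add: exp_coeff_def lookup_add exp_add)

lemma exp_coeff_scale: "exp_coeff (t *\<^sub>R v) x = exp_coeff v x powr t"
  by (simp add: exp_coeff_def lookup_scaleR powr_def)

lemma strong_rep_pos:
  assumes "strong_rep null n d J \<rho>" "x \<in> J"
  shows "0 < \<rho> x"
  using supportedD(3)[OF strong_rep_supported[OF assms(1)] assms(2)] assms(2) by simp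

lemma V_space_iff: "v \<in> V_space n d J \<longleftrightarrow> Poly_Mapping.keys v \<subseteq> J \<and> weak_infty (exp_coeff v)"
proof
  assume "v \<in> V_space n d J"
  then obtain \<rho> where \<rho>: "v = log_vec J \<rho>" "strong_rep infty_null n d J \<rho>" by (auto simp: V_space_def)
  then show "Poly_Mapping.keys v \<subseteq> J \<and> weak_infty (exp_coeff v)"
    using keys_log_vec strong_infty_imp_weak[OF \<rho>(2)] exp_coeff_log_vec[OF strong_rep_pos[OF \<rho>(2)]] by simp
next
  assume "Poly_Mapping.keys v \<subseteq> J \<and> weak_infty (exp_coeff v)"
  then show "v \<in> V_space n d J"
    using weak_infty_imp_strong[OF supported_exp_coeff] log_vec_exp_coeff unfolding V_space_def by force
qed

lemma strong_zero_iff: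
  "(\<exists>\<rho>. v = log_vec J \<rho> \<and> strong_rep zero_null n d J \<rho>) \<longleftrightarrow> Poly_Mapping.keys v \<subseteq> J \<and> weak_zero (exp_coeff v)"
proof
  assume "\<exists>\<rho>. v = log_vec J \<rho> \<and> strong_rep zero_null n d J \<rho>"
  then obtain \<rho> where \<rho>: "v = log_vec J \<rho>" "strong_rep zero_null n d J \<rho>" by blast
  then show "Poly_Mapping.keys v \<subseteq> J \<and> weak_zero (exp_coeff v)"
    using keys_log_vec strong_zero_imp_weak[OF \<rho>(2)] exp_coeff_log_vec[OF strong_rep_pos[OF \<rho>(2)]] by simp
next
  assume "Poly_Mapping.keys v \<subseteq> J \<and> weak_zero (exp_coeff v)"
  then show "\<exists>\<rho>. v = log_vec J \<rho> \<and> strong_rep zero_null n d J \<rho>"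
    using weak_zero_imp_strong[OF supported_exp_coeff] log_vec_exp_coeff by metis
qed

abbreviation hess :: "expo \<Rightarrow> (expo \<Rightarrow> real) \<Rightarrow> nat \<Rightarrow> nat \<Rightarrow> real" where
  "hess \<alpha> \<rho> \<equiv> \<lambda>i j. \<rho> (\<alpha> + ee i + ee j)"

lemma symmetric_on_hess: "symmetric_on R (hess \<alpha> \<rho>)"
  by (simp add: symmetric_on_def ac_simps)

lemma supported_product_zero:
  assumes "supported \<rho>" "\<not> (2 \<le> d \<and> g \<in> discrete_simplex n (d - 2) \<and> a < n \<and> b < n \<and> c < n \<and> f < n)"
  shows "\<rho> (g + ee a + ee b) * \<rho> (g + ee c + ee f) = 0"
  using assms J_add_two_unitsD supportedD(2) by (metis mult_eq_0_iff)

text \<open>When the base point or an index is out of range, both products to be compared vanish;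
  the relations are thus conditions on finitely many matrices.\<close>

lemma weak_infty_iff_hess:
  assumes sup: "supported \<rho>"
  shows "weak_infty \<rho> \<longleftrightarrow> (2 \<le> d \<longrightarrow> (\<forall>\<alpha>\<in>discrete_simplex n (d - 2). two_term_on {..<n} (hess \<alpha> \<rho>)))"
proof
  assume "weak_infty \<rho>"
  then show "2 \<le> d \<longrightarrow> (\<forall>\<alpha>\<in>discrete_simplex n (d - 2). two_term_on {..<n} (hess \<alpha> \<rho>))"
    unfolding weak_infty_def two_term_on_def by blast
next
  assume *: "2 \<le> d \<longrightarrow> (\<forall>\<alpha>\<in>discrete_simplex n (d - 2). two_term_on {..<n} (hess \<alpha> \<rho>))"
  show "weak_infty \<rho>"
    unfolding weak_infty_def
  proof (intro allI impI)
    fix g a b c f assume z: "\<rho> (g + ee a + ee f) * \<rho> (g + ee b + ee c) = 0"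
    show "\<rho> (g + ee a + ee b) * \<rho> (g + ee c + ee f) = \<rho> (g + ee a + ee c) * \<rho> (g + ee b + ee f)"
    proof (cases "2 \<le> d \<and> g \<in> discrete_simplex n (d - 2) \<and> a < n \<and> b < n \<and> c < n \<and> f < n")
      case True
      then show ?thesis using * z unfolding two_term_on_def by (meson lessThan_iff)
    next
      case False
      then show ?thesis
        using supported_product_zero[OF sup, of g a b c f] supported_product_zero[OF sup, of g a c b f] by auto
    qed
  qed
qed

lemma weak_zero_iff_hess:
  assumes sup: "supported \<rho>"
  shows "weak_zero \<rho> \<longleftrightarrow> (2 \<le> d \<longrightarrow> (\<forall>\<alpha>\<in>discrete_simplex n (d - 2). \<forall>a<n. \<forall>b<n. \<forall>c<n. \<forall>f<n.
    hess \<alpha> \<rho> a b * hess \<alpha> \<rho> c f \<le> max (hess \<alpha> \<rho> a c * hess \<alpha> \<rho> b f) (hess \<alpha> \<rho> a f * hess \<alpha> \<rho> b c)))"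
proof
  assume "weak_zero \<rho>"
  then show "2 \<le> d \<longrightarrow> (\<forall>\<alpha>\<in>discrete_simplex n (d - 2). \<forall>a<n. \<forall>b<n. \<forall>c<n. \<forall>f<n.
    hess \<alpha> \<rho> a b * hess \<alpha> \<rho> c f \<le> max (hess \<alpha> \<rho> a c * hess \<alpha> \<rho> b f) (hess \<alpha> \<rho> a f * hess \<alpha> \<rho> b c))"
    unfolding weak_zero_def by blast
next
  assume *: "2 \<le> d \<longrightarrow> (\<forall>\<alpha>\<in>discrete_simplex n (d - 2). \<forall>a<n. \<forall>b<n. \<forall>c<n. \<forall>f<n.
    hess \<alpha> \<rho> a b * hess \<alpha> \<rho> c f \<le> max (hess \<alpha> \<rho> a c * hess \<alpha> \<rho> b f) (hess \<alpha> \<rho> a f * hess \<alpha> \<rho> b c))"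
  show "weak_zero \<rho>"
    unfolding weak_zero_def
  proof (intro allI)
    fix g a b c f
    show "\<rho> (g + ee a + ee b) * \<rho> (g + ee c + ee f) \<le>
      max (\<rho> (g + ee a + ee c) * \<rho> (g + ee b + ee f)) (\<rho> (g + ee a + ee f) * \<rho> (g + ee b + ee c))"
    proof (cases "2 \<le> d \<and> g \<in> discrete_simplex n (d - 2) \<and> a < n \<and> b < n \<and> c < n \<and> f < n")
      case True
      then show ?thesis using * by blast
    next
      case False
      then have "\<rho> (g + ee a + ee b) * \<rho> (g + ee c + ee f) = 0"
        by (rule supported_product_zero[OF sup])
      moreover have "0 \<le> \<rho> (g + ee a + ee c) * \<rho> (g + ee b + ee f)"
        using supportedD(1)[OF sup] by simp
      ultimately have "\<rho> (g + ee a + ee b) * \<rho> (g + ee c + ee f) \<le> \<rho> (g + ee a + ee c) * \<rho> (g + ee b + ee f)"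
        by linarith
      then show ?thesis by (rule max.coboundedI1)
    qed
  qed
qed

lemma log_lorentzian_subset_V: "log_lorentzian \<subseteq> V_space n d J"
proof
  fix v assume v: "v \<in> log_lorentzian"
  have "two_term_on {..<n} (hess \<alpha> (exp_coeff v))" if "2 \<le> d" "\<alpha> \<in> discrete_simplex n (d - 2)" for \<alpha>
  proof -
    have lor: "lorentz_form {..<n} (hess \<alpha> (exp_coeff v))" using v that by (simp add: log_lorentzian_def)
    show ?thesis
      unfolding two_term_on_def
      by (intro ballI impI lorentz_form_two_term[OF lor symmetric_on_hess]) (auto simp: exp_coeff_nonneg)
  qed
  then show "v \<in> V_space n d J"
    using v weak_infty_iff_hess[OF supported_exp_coeff] by (auto simp: V_space_iff log_lorentzian_def)
qed

lemma weak_zero_imp_log_lorentzian: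
  assumes "Poly_Mapping.keys v \<subseteq> J" "weak_zero (exp_coeff v)"
  shows "v \<in> log_lorentzian"
proof -
  have "lorentz_form {..<n} (hess \<alpha> (exp_coeff v))" if "2 \<le> d" "\<alpha> \<in> discrete_simplex n (d - 2)" for \<alpha>
  proof (rule tropical_lorentz_form)
    fix a b c f assume "a \<in> {..<n}" "b \<in> {..<n}" "c \<in> {..<n}" "f \<in> {..<n}"
    then show "hess \<alpha> (exp_coeff v) a b * hess \<alpha> (exp_coeff v) c f \<le>
      max (hess \<alpha> (exp_coeff v) a c * hess \<alpha> (exp_coeff v) b f) (hess \<alpha> (exp_coeff v) a f * hess \<alpha> (exp_coeff v) b c)"
      using assms(2) unfolding weak_zero_def by blast
  qed (auto simp: symmetric_on_hess exp_coeff_nonneg)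
  then show ?thesis using assms(1) by (simp add: log_lorentzian_def)
qed

lemma zero_log_lorentzian: "0 \<in> log_lorentzian"
proof (rule weak_zero_imp_log_lorentzian)
  have "exp_coeff 0 = (\<lambda>x. if x \<in> J then 1 else 0)" by (auto simp: exp_coeff_def)
  then show "weak_zero (exp_coeff 0)" using weak_zero_indicator by simp
qed simp

text \<open>Which products vanish depends on J alone, so the same two-term equations hold for all
  vectors of V_J; they may be multiplied and raised to real powers.\<close>

lemma subspace_V: "subspace (V_space n d J)"
proof (rule subspaceI)
  show "0 \<in> V_space n d J" using zero_log_lorentzian log_lorentzian_subset_V by blast
next
  fix v w assume v: "v \<in> V_space n d J" and w: "w \<in> V_space n d J"
  have "weak_infty (exp_coeff (v + w))"
    unfolding weak_infty_def
  proof (intro allI impI)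
    fix g a b c f assume "exp_coeff (v + w) (g + ee a + ee f) * exp_coeff (v + w) (g + ee b + ee c) = 0"
    then have z: "exp_coeff v (g + ee a + ee f) * exp_coeff v (g + ee b + ee c) = 0"
      "exp_coeff w (g + ee a + ee f) * exp_coeff w (g + ee b + ee c) = 0"
      by (auto simp: supportedD(2)[OF supported_exp_coeff])
    have eq: "exp_coeff v (g + ee a + ee b) * exp_coeff v (g + ee c + ee f) = exp_coeff v (g + ee a + ee c) * exp_coeff v (g + ee b + ee f)"
      "exp_coeff w (g + ee a + ee b) * exp_coeff w (g + ee c + ee f) = exp_coeff w (g + ee a + ee c) * exp_coeff w (g + ee b + ee f)"
      using v w z unfolding V_space_iff weak_infty_def by blast+
    show "exp_coeff (v + w) (g + ee a + ee b) * exp_coeff (v + w) (g + ee c + ee f) =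
      exp_coeff (v + w) (g + ee a + ee c) * exp_coeff (v + w) (g + ee b + ee f)"
      using arg_cong2[OF eq, of "(*)"] unfolding exp_coeff_add by (simp only: mult_ac)
  qed
  moreover have "Poly_Mapping.keys (v + w) \<subseteq> J"
    using v w unfolding V_space_iff keys_subset_iff by (simp add: lookup_add)
  ultimately show "v + w \<in> V_space n d J" by (simp add: V_space_iff)
next
  fix t :: real and v assume v: "v \<in> V_space n d J"
  have "weak_infty (exp_coeff (t *\<^sub>R v))"
    unfolding weak_infty_def
  proof (intro allI impI)
    fix g a b c f assume "exp_coeff (t *\<^sub>R v) (g + ee a + ee f) * exp_coeff (t *\<^sub>R v) (g + ee b + ee c) = 0"
    then have z: "exp_coeff v (g + ee a + ee f) * exp_coeff v (g + ee b + ee c) = 0"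
      by (auto simp: supportedD(2)[OF supported_exp_coeff])
    have "exp_coeff v (g + ee a + ee b) * exp_coeff v (g + ee c + ee f) = exp_coeff v (g + ee a + ee c) * exp_coeff v (g + ee b + ee f)"
      using v z unfolding V_space_iff weak_infty_def by blast
    then show "exp_coeff (t *\<^sub>R v) (g + ee a + ee b) * exp_coeff (t *\<^sub>R v) (g + ee c + ee f) =
      exp_coeff (t *\<^sub>R v) (g + ee a + ee c) * exp_coeff (t *\<^sub>R v) (g + ee b + ee f)"
      unfolding exp_coeff_scale by (simp only: powr_mult[symmetric] exp_coeff_nonneg)
  qed
  moreover have "Poly_Mapping.keys (t *\<^sub>R v) \<subseteq> J"
    using v unfolding V_space_iff keys_subset_iff by (simp add: lookup_scaleR)
  ultimately show "t *\<^sub>R v \<in> V_space n d J" by (simp add: V_space_iff)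
qed

(* Adding a multiple of the center changes each matrix by a positive diagonal congruence and a
   shrinking of its diagonal, see hess_center below. *)
definition center :: "expo \<Rightarrow>\<^sub>0 real" where
  "center = (\<Sum>x\<in>J. Poly_Mapping.single x (- (\<Sum>l<n. (real (lk x l))\<^sup>2)))"

lemma keys_center: "Poly_Mapping.keys center \<subseteq> J"
  unfolding keys_subset_iff center_def lookup_sum_single by simp

text \<open>The expansion |\<alpha> + e_i + e_j|^2 = |\<alpha>|^2 + (2 \<alpha>_i + 1) + (2
  \<alpha>_j + 1) + 2 [i = j] is divided between i and j; since |\<alpha>|^2 / 2 goes to each, the
  exponent shown combines with the doubled increments up to the last term, which leaves exp(-2 s) on
  the diagonal.\<close>

definition center_factor :: "real \<Rightarrow> expo \<Rightarrow> nat \<Rightarrow> real" where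
  "center_factor s \<alpha> i = exp (- s * ((\<Sum>l<n. (real (lk \<alpha> l))\<^sup>2) / 2 + 2 * real (lk \<alpha> i) + 1))"

lemma center_factor_pos: "0 < center_factor s \<alpha> i"
  by (simp add: center_factor_def)

lemma exp_coeff_center:
  assumes "\<alpha> + ee i + ee j \<in> J" "i < n" "j < n"
  shows "exp_coeff (s *\<^sub>R center) (\<alpha> + ee i + ee j) =
    center_factor s \<alpha> i * (if i = j then exp (- 2 * s) else 1) * center_factor s \<alpha> j"
proof -
  have "(real (lk (\<alpha> + ee i + ee j) l))\<^sup>2 = (real (lk \<alpha> l))\<^sup>2 +
     (if l = i then 2 * real (lk \<alpha> i) + 1 else 0) + (if l = j then 2 * real (lk \<alpha> j) + 1 else 0)
     + (if l = i then (if i = j then 2 else 0) else 0)" for l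
    by (auto simp: lookup_add power2_eq_square algebra_simps)
  then have "(\<Sum>l<n. (real (lk (\<alpha> + ee i + ee j) l))\<^sup>2) = (\<Sum>l<n. (real (lk \<alpha> l))\<^sup>2)
     + (2 * real (lk \<alpha> i) + 1) + (2 * real (lk \<alpha> j) + 1) + (if i = j then 2 else 0)"
    using assms(2,3) by (simp add: sum.distrib)
  then have L: "lk center (\<alpha> + ee i + ee j) = - ((\<Sum>l<n. (real (lk \<alpha> l))\<^sup>2)
     + (2 * real (lk \<alpha> i) + 1) + (2 * real (lk \<alpha> j) + 1) + (if i = j then 2 else 0))"
    using assms(1) unfolding center_def lookup_sum_single by simp
  have "exp_coeff (s *\<^sub>R center) (\<alpha> + ee i + ee j) = exp (s * lk center (\<alpha> + ee i + ee j))"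
    using assms(1) by (simp add: exp_coeff_def lookup_scaleR)
  also have "s * lk center (\<alpha> + ee i + ee j) =
    - s * ((\<Sum>l<n. (real (lk \<alpha> l))\<^sup>2) / 2 + 2 * real (lk \<alpha> i) + 1) + (if i = j then - 2 * s else 0)
    + - s * ((\<Sum>l<n. (real (lk \<alpha> l))\<^sup>2) / 2 + 2 * real (lk \<alpha> j) + 1)"
  proof -
    have "s * - (N + (2 * p + 1) + (2 * q + 1) + e) = - s * (N / 2 + 2 * p + 1) + - s * e + - s * (N / 2 + 2 * q + 1)"
      for N p q e :: real by (simp add: field_simps)
    from this[of "\<Sum>l<n. (real (lk \<alpha> l))\<^sup>2" "real (lk \<alpha> i)" "real (lk \<alpha> j)" "if i = j then 2 else 0"]
    show ?thesis unfolding L by (cases "i = j") simp_all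
  qed
  finally show ?thesis unfolding center_factor_def by (simp only: exp_add) (simp split: if_split)
qed

text \<open>Used with (t, s) = (1, s) for adding the center, (k, 1) for rays from it, and (t, 1 - t)
  for segments towards it.\<close>

lemma hess_center:
  assumes "i < n" "j < n"
  shows "hess \<alpha> (exp_coeff (t *\<^sub>R v + s *\<^sub>R center)) i j =
    center_factor s \<alpha> i * (hess \<alpha> (exp_coeff v) i j powr t * (if i = j then exp (- 2 * s) else 1)) * center_factor s \<alpha> j"
proof (cases "\<alpha> + ee i + ee j \<in> J")
  case True
  then show ?thesis
    unfolding exp_coeff_add exp_coeff_scale[of t] exp_coeff_center[OF True assms] by simp
next
  case False
  then show ?thesis by (simp add: exp_coeff_def)
qed

lemma lorentz_form_unscale:
  assumes "lorentz_form R (\<lambda>i j. e i * M i j * e j)" "\<And>i. e i \<noteq> 0"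
  shows "lorentz_form R M"
proof -
  have "lorentz_form R (\<lambda>i j. (1 / e i) * (e i * M i j * e j) * (1 / e j))"
    by (rule lorentz_form_scale[OF assms(1)])
  then show ?thesis using assms(2) by simp
qed

lemma log_lorentzian_add_center:
  assumes v: "v \<in> log_lorentzian" and s: "0 \<le> s"
  shows "v + s *\<^sub>R center \<in> log_lorentzian"
proof -
  have "lorentz_form {..<n} (hess \<alpha> (exp_coeff (v + s *\<^sub>R center)))"
    if \<alpha>: "2 \<le> d" "\<alpha> \<in> discrete_simplex n (d - 2)" for \<alpha>
  proof -
    let ?A = "hess \<alpha> (exp_coeff v)"
    have "lorentz_form {..<n} ?A" using v \<alpha> by (simp add: log_lorentzian_def)
    then have "lorentz_form {..<n} (\<lambda>i j. ?A i j - (if i = j then (1 - exp (- 2 * s)) * ?A i i else 0))"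
      using s by (intro lorentz_form_diagonal symmetric_on_hess) (auto simp: exp_coeff_nonneg)
    from lorentz_form_scale[OF this, of "center_factor s \<alpha>"]
    show ?thesis
    proof (rule lorentz_form_cong[THEN iffD1, rotated])
      fix i j assume ij: "i \<in> {..<n}" "j \<in> {..<n}"
      have "?A i j powr 1 = ?A i j" using exp_coeff_nonneg by simp
      then show "center_factor s \<alpha> i * (?A i j - (if i = j then (1 - exp (- 2 * s)) * ?A i i else 0)) * center_factor s \<alpha> j
        = hess \<alpha> (exp_coeff (v + s *\<^sub>R center)) i j"
        using hess_center[of i j 1 v s \<alpha>] ij by (auto simp: algebra_simps)
    qed
  qed
  moreover have "Poly_Mapping.keys (v + s *\<^sub>R center) \<subseteq> J"
    using v keys_center unfolding log_lorentzian_def keys_subset_iff by (simp add: lookup_add lookup_scaleR)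
  ultimately show ?thesis by (simp add: log_lorentzian_def)
qed

lemma center_log_lorentzian: "center \<in> log_lorentzian"
  using log_lorentzian_add_center[OF zero_log_lorentzian, of 1] by simp

lemma log_lorentzian_add_ones:
  assumes "v \<in> log_lorentzian"
  shows "v + t *\<^sub>R ones_vec J \<in> log_lorentzian"
proof -
  have "exp_coeff (v + t *\<^sub>R ones_vec J) x = exp (t / 2) * exp_coeff v x * exp (t / 2)" for x
    by (simp add: exp_coeff_add exp_coeff_scale) (simp add: exp_coeff_def lookup_ones_vec exp_add[symmetric] powr_def)
  moreover have "Poly_Mapping.keys (v + t *\<^sub>R ones_vec J) \<subseteq> J"
    using assms unfolding log_lorentzian_def keys_subset_iff by (simp add: lookup_add lookup_scaleR lookup_ones_vec)
  ultimately show ?thesis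
    using assms lorentz_form_scale[of "{..<n}" _ "\<lambda>_. exp (t / 2)"] by (auto simp: log_lorentzian_def)
qed

lemma ones_vec_V: "ones_vec J \<in> V_space n d J"
  using log_lorentzian_add_ones[OF zero_log_lorentzian, of 1] log_lorentzian_subset_V by auto

section \<open>Recession directions, closedness and relative interior\<close>

lemma weak_zero_scale:
  assumes "weak_zero (exp_coeff v)" "0 < t"
  shows "weak_zero (exp_coeff (t *\<^sub>R v))"
  unfolding weak_zero_def
proof (intro allI)
  fix g a b c f
  let ?e = "exp_coeff v"
  have "?e (g + ee a + ee b) * ?e (g + ee c + ee f) \<le> max (?e (g + ee a + ee c) * ?e (g + ee b + ee f)) (?e (g + ee a + ee f) * ?e (g + ee b + ee c))"
    using assms(1) unfolding weak_zero_def by blast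
  moreover have "x powr t \<le> y powr t" if "x \<le> y" "0 \<le> x" for x y
    using assms(2) that by (intro powr_mono2) auto
  moreover have "0 \<le> ?e (g + ee a + ee b) * ?e (g + ee c + ee f)" by (simp add: exp_coeff_nonneg)
  ultimately have "(?e (g + ee a + ee b) * ?e (g + ee c + ee f)) powr t \<le> (?e (g + ee a + ee c) * ?e (g + ee b + ee f)) powr t
     \<or> (?e (g + ee a + ee b) * ?e (g + ee c + ee f)) powr t \<le> (?e (g + ee a + ee f) * ?e (g + ee b + ee c)) powr t"
    unfolding le_max_iff_disj by blast
  then show "exp_coeff (t *\<^sub>R v) (g + ee a + ee b) * exp_coeff (t *\<^sub>R v) (g + ee c + ee f) \<le>
    max (exp_coeff (t *\<^sub>R v) (g + ee a + ee c) * exp_coeff (t *\<^sub>R v) (g + ee b + ee f))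
      (exp_coeff (t *\<^sub>R v) (g + ee a + ee f) * exp_coeff (t *\<^sub>R v) (g + ee b + ee c))"
    unfolding exp_coeff_scale le_max_iff_disj by (simp only: powr_mult exp_coeff_nonneg)
qed

lemma weak_zero_iff_recession:
  assumes v: "Poly_Mapping.keys v \<subseteq> J"
  shows "weak_zero (exp_coeff v) \<longleftrightarrow> (\<forall>t>0. center + t *\<^sub>R v \<in> log_lorentzian)"
proof
  assume "weak_zero (exp_coeff v)"
  then have "t *\<^sub>R v + 1 *\<^sub>R center \<in> log_lorentzian" if "t > 0" for t
    using that v unfolding keys_subset_iff
    by (intro log_lorentzian_add_center weak_zero_imp_log_lorentzian weak_zero_scale)
      (auto simp: keys_subset_iff lookup_scaleR)
  then show "\<forall>t>0. center + t *\<^sub>R v \<in> log_lorentzian" by (simp add: add.commute)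
next
  assume rec: "\<forall>t>0. center + t *\<^sub>R v \<in> log_lorentzian"
  have "hess \<alpha> (exp_coeff v) a b * hess \<alpha> (exp_coeff v) c f \<le>
      max (hess \<alpha> (exp_coeff v) a c * hess \<alpha> (exp_coeff v) b f) (hess \<alpha> (exp_coeff v) a f * hess \<alpha> (exp_coeff v) b c)"
    if \<alpha>: "2 \<le> d" "\<alpha> \<in> discrete_simplex n (d - 2)" and abcf: "a < n" "b < n" "c < n" "f < n" for \<alpha> a b c f
  \<comment> \<open>Only integer multiples of v are used; the center contributes the same diagonal
    factor exp(-2) to each of them, whence q and D.\<close>
  proof (rule lorentz_form_powers_three_term[where q = "exp (- 2)" and R = "{..<n}"
      and D = "\<lambda>i j. if i = j then exp (- 2) else 1"])
    fix k :: nat assume k: "k \<ge> 1"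
    then have "center + real k *\<^sub>R v \<in> log_lorentzian" using rec by simp
    then have "lorentz_form {..<n} (hess \<alpha> (exp_coeff (real k *\<^sub>R v + 1 *\<^sub>R center)))"
      using \<alpha> by (simp add: log_lorentzian_def add.commute)
    then have "lorentz_form {..<n} (\<lambda>i j. center_factor 1 \<alpha> i *
       (hess \<alpha> (exp_coeff v) i j ^ k * (if i = j then exp (- 2) else 1)) * center_factor 1 \<alpha> j)"
    proof (rule lorentz_form_cong[THEN iffD1, rotated])
      fix i j assume ij: "i \<in> {..<n}" "j \<in> {..<n}"
      have "hess \<alpha> (exp_coeff v) i j powr real k = hess \<alpha> (exp_coeff v) i j ^ k"
        using k exp_coeff_nonneg[of v "\<alpha> + ee i + ee j"]
        by (cases "exp_coeff v (\<alpha> + ee i + ee j) = 0") (auto simp: powr_realpow)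
      then show "hess \<alpha> (exp_coeff (real k *\<^sub>R v + 1 *\<^sub>R center)) i j = center_factor 1 \<alpha> i *
         (hess \<alpha> (exp_coeff v) i j ^ k * (if i = j then exp (- 2) else 1)) * center_factor 1 \<alpha> j"
        using hess_center[of i j "real k" v 1 \<alpha>] ij by simp
    qed
    then show "lorentz_form {..<n} (\<lambda>i j. hess \<alpha> (exp_coeff v) i j ^ k * (if i = j then exp (- 2) else 1))"
      by (rule lorentz_form_unscale) (simp add: center_factor_pos less_imp_neq[symmetric])
  qed (use abcf in \<open>auto simp: symmetric_on_hess exp_coeff_nonneg symmetric_on_def[of _ "\<lambda>i j. if i = j then _ else _"]\<close>)
  then show "weak_zero (exp_coeff v)" unfolding weak_zero_iff_hess[OF supported_exp_coeff] by blast
qed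

lemma continuous_on_exp_coeff [continuous_intros]:
  "continuous_on S h \<Longrightarrow> continuous_on S (\<lambda>z. exp_coeff (h z) x)"
  unfolding exp_coeff_def by (cases "x \<in> J") (auto intro!: continuous_intros)

lemma continuous_on_bform_exp_coeff:
  "continuous_on UNIV (\<lambda>w. bform {..<n} (hess \<alpha> (exp_coeff w)) x y)"
  unfolding bform_def by (intro continuous_intros)

text \<open>For fixed x and y the implication defining \<open>lorentz_form\<close> is a union of two
  closed conditions on w.\<close>

lemma closed_log_lorentzian: "closed log_lorentzian"
proof -
  let ?Q = "\<lambda>\<alpha> x y w. bform {..<n} (hess \<alpha> (exp_coeff w)) x y"
  have eq: "log_lorentzian = (\<Inter>x\<in>- J. {w. lk w x = 0}) \<inter>
     (\<Inter>\<alpha>\<in>{\<alpha>. 2 \<le> d \<and> \<alpha> \<in> discrete_simplex n (d - 2)}. \<Inter>x. \<Inter>y.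
        {w. ?Q \<alpha> x x w \<le> 0} \<union> {w. ?Q \<alpha> x x w * ?Q \<alpha> y y w \<le> (?Q \<alpha> x y w)\<^sup>2})"
    unfolding log_lorentzian_def lorentz_form_def keys_subset_iff by (auto simp: not_less) (meson not_le)+
  show ?thesis
    unfolding eq
    by (intro closed_Int closed_INT ballI closed_Un closed_Collect_eq closed_Collect_le continuous_intros
        continuous_on_bform_exp_coeff)
qed

text \<open>After division by the center factors, the matrices at the given point are t-th powers
  with the diagonal multiplied by q < 1, to which \<open>lorentz_form_power_interior\<close>
  applies. For nearby points, membership in V supplies the two-term relations, and J fixes the zero
  pattern.\<close>

lemma log_lorentzian_interior:
  assumes v: "v \<in> log_lorentzian" and t: "0 < t" "t < 1"
  shows "\<exists>U. open U \<and> t *\<^sub>R v + (1 - t) *\<^sub>R center \<in> U \<and> U \<inter> V_space n d J \<subseteq> log_lorentzian"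
proof (cases "2 \<le> d")
  case False
  then show ?thesis by (intro exI[of _ UNIV]) (auto simp: V_space_iff log_lorentzian_def)
next
  case d: True
  define q where "q = exp (- 2 * (1 - t))"
  have q: "q < 1" using t by (simp add: q_def)
  define s where "s = center_factor (1 - t)"
  have s: "0 < s \<alpha> i" for \<alpha> i by (simp add: s_def center_factor_pos)
  define A where "A \<alpha> = hess \<alpha> (exp_coeff v)" for \<alpha>
  have "\<forall>\<alpha>\<in>discrete_simplex n (d - 2). \<exists>e>0. \<forall>M. symmetric_on {..<n} M \<longrightarrow> two_term_on {..<n} M \<longrightarrow>
    (\<forall>i\<in>{..<n}. \<forall>j\<in>{..<n}. M i j = 0 \<longleftrightarrow> A \<alpha> i j = 0) \<longrightarrow>
    (\<forall>i\<in>{..<n}. \<forall>j\<in>{..<n}. \<bar>M i j - A \<alpha> i j powr t * (if i = j then q else 1)\<bar> < e) \<longrightarrow> lorentz_form {..<n} M"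
    using v d t q unfolding A_def log_lorentzian_def
    by (intro ballI lorentz_form_power_interior) (auto simp: symmetric_on_hess exp_coeff_nonneg)
  then obtain e where e: "\<And>\<alpha>. \<alpha> \<in> discrete_simplex n (d - 2) \<Longrightarrow> 0 < e \<alpha>"
    and lor: "\<And>\<alpha> M. \<alpha> \<in> discrete_simplex n (d - 2) \<Longrightarrow> symmetric_on {..<n} M \<Longrightarrow> two_term_on {..<n} M \<Longrightarrow>
      (\<forall>i\<in>{..<n}. \<forall>j\<in>{..<n}. M i j = 0 \<longleftrightarrow> A \<alpha> i j = 0) \<Longrightarrow>
      (\<forall>i\<in>{..<n}. \<forall>j\<in>{..<n}. \<bar>M i j - A \<alpha> i j powr t * (if i = j then q else 1)\<bar> < e \<alpha>) \<Longrightarrow> lorentz_form {..<n} M"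
    by metis
  define M where "M \<alpha> w i j = (1 / s \<alpha> i) * hess \<alpha> (exp_coeff w) i j * (1 / s \<alpha> j)" for \<alpha> w i j
  define U where "U = (\<Inter>\<alpha>\<in>discrete_simplex n (d - 2). \<Inter>i\<in>{..<n}. \<Inter>j\<in>{..<n}.
    {w. \<bar>M \<alpha> w i j - A \<alpha> i j powr t * (if i = j then q else 1)\<bar> < e \<alpha>})"
  show ?thesis
  proof (intro exI[of _ U] conjI)
    show "open U"
      unfolding U_def M_def
      by (intro open_INT finite_discrete_simplex finite_lessThan ballI open_Collect_less continuous_intros)
    have "M \<alpha> (t *\<^sub>R v + (1 - t) *\<^sub>R center) i j = A \<alpha> i j powr t * (if i = j then q else 1)"
      if "i < n" "j < n" for \<alpha> i j
      using hess_center[OF that, of t v "1 - t" \<alpha>] s[of \<alpha> i] s[of \<alpha> j]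
      by (simp add: M_def A_def q_def s_def)
    then show "t *\<^sub>R v + (1 - t) *\<^sub>R center \<in> U" using e by (simp add: U_def)
    show "U \<inter> V_space n d J \<subseteq> log_lorentzian"
    proof
      fix w assume w: "w \<in> U \<inter> V_space n d J"
      have "lorentz_form {..<n} (hess \<alpha> (exp_coeff w))" if \<alpha>: "\<alpha> \<in> discrete_simplex n (d - 2)" for \<alpha>
      proof -
        have tt: "two_term_on {..<n} (hess \<alpha> (exp_coeff w))"
          using w \<alpha> d unfolding Int_iff V_space_iff weak_infty_iff_hess[OF supported_exp_coeff] by blast
        have "lorentz_form {..<n} (M \<alpha> w)"
        proof (rule lor[OF \<alpha>])
          show "symmetric_on {..<n} (M \<alpha> w)" by (simp add: symmetric_on_def M_def ac_simps)
          show "two_term_on {..<n} (M \<alpha> w)"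
            unfolding two_term_on_def
          proof (intro ballI impI)
            fix a b c f assume abcf: "a \<in> {..<n}" "b \<in> {..<n}" "c \<in> {..<n}" "f \<in> {..<n}"
              and "M \<alpha> w a f * M \<alpha> w b c = 0"
            then have "hess \<alpha> (exp_coeff w) a f * hess \<alpha> (exp_coeff w) b c = 0"
              using s by (auto simp: M_def less_imp_neq[symmetric])
            with tt abcf have "hess \<alpha> (exp_coeff w) a b * hess \<alpha> (exp_coeff w) c f =
               hess \<alpha> (exp_coeff w) a c * hess \<alpha> (exp_coeff w) b f" unfolding two_term_on_def by blast
            then show "M \<alpha> w a b * M \<alpha> w c f = M \<alpha> w a c * M \<alpha> w b f" by (simp add: M_def)
          qed
          show "\<forall>i\<in>{..<n}. \<forall>j\<in>{..<n}. M \<alpha> w i j = 0 \<longleftrightarrow> A \<alpha> i j = 0"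
            using s by (simp add: M_def A_def exp_coeff_def less_imp_neq[symmetric])
          show "\<forall>i\<in>{..<n}. \<forall>j\<in>{..<n}. \<bar>M \<alpha> w i j - A \<alpha> i j powr t * (if i = j then q else 1)\<bar> < e \<alpha>"
            using w \<alpha> by (auto simp: U_def)
        qed
        then show ?thesis
          unfolding M_def by (rule lorentz_form_unscale) (use s in \<open>simp add: less_imp_neq[symmetric]\<close>)
      qed
      then show "w \<in> log_lorentzian" using w by (simp add: log_lorentzian_def V_space_iff)
    qed
  qed
qed

end

section \<open>Radial rescaling and quotients\<close>

text \<open>As S may fail to be convex, its gauge at p may fail to be subadditive; continuity has to
  come from \<open>strict\<close> and \<open>closedS\<close>.\<close>

locale strictly_star_shaped =
  fixes V S :: "'a::real_normed_vector set" and p :: 'a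
  assumes V: "subspace V" and SV: "S \<subseteq> V" and pS: "p \<in> S" and closedS: "closed S"
    and strict: "\<And>v t. v \<in> S \<Longrightarrow> 0 < t \<Longrightarrow> t < 1 \<Longrightarrow> \<exists>U. open U \<and> t *\<^sub>R v + (1 - t) *\<^sub>R p \<in> U \<and> U \<inter> V \<subseteq> S"
begin

definition gauge_set :: "'a \<Rightarrow> real set" where
  "gauge_set x = {s. 0 < s \<and> p + (1 / s) *\<^sub>R x \<in> S}"

definition minkowski :: "'a \<Rightarrow> real" where
  "minkowski x = Inf (gauge_set x)"

lemma interior_point:
  assumes x: "x \<in> V" and s: "s \<in> gauge_set x" "s < s'"
  shows "\<exists>U. open U \<and> p + (1 / s') *\<^sub>R x \<in> U \<and> U \<inter> V \<subseteq> S"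
proof -
  have s0: "0 < s" and S: "p + (1 / s) *\<^sub>R x \<in> S" using s by (auto simp: gauge_set_def)
  have "(s / s') *\<^sub>R (p + (1 / s) *\<^sub>R x) + (1 - s / s') *\<^sub>R p = p + (1 / s') *\<^sub>R x"
    using s0 s by (simp add: algebra_simps)
  moreover have "0 < s / s'" "s / s' < 1" using s0 s by auto
  ultimately show ?thesis using strict[OF S] by metis
qed

lemma in_V: "x \<in> V \<Longrightarrow> p + c *\<^sub>R x \<in> V"
  using V SV pS subspace_add subspace_scale by (metis subsetD)

lemma gauge_set_up: "x \<in> V \<Longrightarrow> s \<in> gauge_set x \<Longrightarrow> s \<le> s' \<Longrightarrow> s' \<in> gauge_set x"
  using interior_point[of x s s'] in_V[of x "1 / s'"] by (cases "s = s'") (auto simp: gauge_set_def)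

lemma gauge_set_nonempty:
  assumes x: "x \<in> V"
  shows "gauge_set x \<noteq> {}"
proof -
  \<comment> \<open>Taking v = p shows that p itself is a relative interior point.\<close>
  obtain U where U: "open U" "p \<in> U" "U \<inter> V \<subseteq> S"
    using strict[OF pS, of "1/2"] by (auto simp flip: scaleR_left_distrib)
  have "((\<lambda>s. p + (1 / s) *\<^sub>R x) \<longlongrightarrow> p + 0 *\<^sub>R x) at_top"
    by (intro tendsto_intros tendsto_divide_0[OF tendsto_const] filterlim_at_top_imp_at_infinity filterlim_ident)
  then have "\<forall>\<^sub>F s in at_top. p + (1 / s) *\<^sub>R x \<in> U" using U by (auto dest: topological_tendstoD)
  then have "\<forall>\<^sub>F s in at_top. 0 < s \<and> p + (1 / s) *\<^sub>R x \<in> U"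
    using eventually_gt_at_top[of 0] by eventually_elim auto
  from eventually_happens'[OF trivial_limit_at_top_linorder this]
  obtain s where "0 < s" "p + (1 / s) *\<^sub>R x \<in> U" by blast
  then show ?thesis using U in_V[OF x] by (auto simp: gauge_set_def)
qed

lemma gauge_set_bdd: "bdd_below (gauge_set x)"
  by (rule bdd_belowI[of _ 0]) (auto simp: gauge_set_def)

lemma gauge_nonneg: "x \<in> V \<Longrightarrow> 0 \<le> minkowski x"
  unfolding minkowski_def by (intro cInf_greatest gauge_set_nonempty) (auto simp: gauge_set_def)

lemma gauge_less_iff: "x \<in> V \<Longrightarrow> minkowski x < a \<longleftrightarrow> (\<exists>s\<in>gauge_set x. s < a)"
  unfolding minkowski_def by (rule cInf_less_iff[OF gauge_set_nonempty gauge_set_bdd])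

text \<open>All s > a belong to the gauge set, and closedness of S allows s to decrease to
  a.\<close>

lemma gauge_le_iff:
  assumes x: "x \<in> V" and a: "0 < a"
  shows "minkowski x \<le> a \<longleftrightarrow> p + (1 / a) *\<^sub>R x \<in> S"
proof
  assume le: "minkowski x \<le> a"
  have "p + (1 / s) *\<^sub>R x \<in> S" if "a < s" for s
  proof -
    have "minkowski x < s" using le that by simp
    then have "s \<in> gauge_set x" using gauge_less_iff[OF x] gauge_set_up[OF x] by (meson less_imp_le)
    then show ?thesis by (simp add: gauge_set_def)
  qed
  then have "\<forall>\<^sub>F s in at_right a. p + (1 / s) *\<^sub>R x \<in> S"
    by (auto simp: eventually_at_filter)
  moreover have "((\<lambda>s. p + (1 / s) *\<^sub>R x) \<longlongrightarrow> p + (1 / a) *\<^sub>R x) (at_right a)"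
    using a by (intro tendsto_intros) auto
  ultimately show "p + (1 / a) *\<^sub>R x \<in> S"
    by (rule Lim_in_closed_set[OF closedS _ trivial_limit_at_right_real])
next
  assume "p + (1 / a) *\<^sub>R x \<in> S"
  then have "a \<in> gauge_set x" using a by (simp add: gauge_set_def)
  then show "minkowski x \<le> a" unfolding minkowski_def by (intro cInf_lower gauge_set_bdd)
qed

lemma gauge_eq_zero_iff:
  assumes x: "x \<in> V"
  shows "minkowski x = 0 \<longleftrightarrow> (\<forall>t>0. p + t *\<^sub>R x \<in> S)"
proof
  assume z: "minkowski x = 0"
  show "\<forall>t>0. p + t *\<^sub>R x \<in> S"
  proof (intro allI impI)
    fix t :: real assume "t > 0"
    then show "p + t *\<^sub>R x \<in> S" using gauge_le_iff[OF x, of "1 / t"] z by simp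
  qed
next
  assume *: "\<forall>t>0. p + t *\<^sub>R x \<in> S"
  have "minkowski x \<le> a" if "0 < a" for a using gauge_le_iff[OF x that] * that by simp
  then show "minkowski x = 0" using gauge_nonneg[OF x] by (metis field_le_epsilon add_0 antisym)
qed

lemma gauge_scale:
  assumes x: "x \<in> V" and c: "0 < c"
  shows "minkowski (c *\<^sub>R x) = c * minkowski x"
proof (rule antisym)
  have cx: "c *\<^sub>R x \<in> V" using V x subspace_scale by blast
  have iff: "minkowski (c *\<^sub>R x) \<le> c * a \<longleftrightarrow> minkowski x \<le> a" if "0 < a" for a
    using gauge_le_iff[OF cx, of "c * a"] gauge_le_iff[OF x that] c that by simp
  show "minkowski (c *\<^sub>R x) \<le> c * minkowski x"
  proof (rule field_le_epsilon)
    fix e :: real assume "0 < e"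
    then have "0 < minkowski x + e / c" using gauge_nonneg[OF x] c by (simp add: add_nonneg_pos)
    then have "minkowski (c *\<^sub>R x) \<le> c * (minkowski x + e / c)" using iff \<open>0 < e\<close> c by simp
    then show "minkowski (c *\<^sub>R x) \<le> c * minkowski x + e" using c by (simp add: algebra_simps)
  qed
  have "minkowski x \<le> minkowski (c *\<^sub>R x) / c"
  proof (rule field_le_epsilon)
    fix e :: real assume "0 < e"
    then have "0 < minkowski (c *\<^sub>R x) / c + e" using gauge_nonneg[OF cx] c by (simp add: add_nonneg_pos)
    moreover have "minkowski (c *\<^sub>R x) \<le> c * (minkowski (c *\<^sub>R x) / c + e)" using \<open>0 < e\<close> c by (simp add: algebra_simps)
    ultimately show "minkowski x \<le> minkowski (c *\<^sub>R x) / c + e" using iff by blast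
  qed
  then show "c * minkowski x \<le> minkowski (c *\<^sub>R x)" using c by (simp add: field_simps)
qed

text \<open>Upper semicontinuity comes from the relative interior points obtained by slightly
  enlarging s, lower semicontinuity from the open complement of S.\<close>

lemma continuous_on_gauge: "continuous_on V minkowski"
  unfolding continuous_on_def
proof (intro ballI order_tendstoI)
  fix x a assume x: "x \<in> V" and a: "minkowski x < a"
  then obtain s where s: "s \<in> gauge_set x" "s < a" using gauge_less_iff by blast
  define s' where "s' = (s + a) / 2"
  have s': "s < s'" "s' < a" "0 < s'" using s by (auto simp: s'_def gauge_set_def)
  obtain U where U: "open U" "p + (1 / s') *\<^sub>R x \<in> U" "U \<inter> V \<subseteq> S"
    using interior_point[OF x s(1) s'(1)] by blast
  have "((\<lambda>y. p + (1 / s') *\<^sub>R y) \<longlongrightarrow> p + (1 / s') *\<^sub>R x) (at x within V)" by (intro tendsto_intros)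
  then have "\<forall>\<^sub>F y in at x within V. p + (1 / s') *\<^sub>R y \<in> U" using U topological_tendstoD by blast
  then have "\<forall>\<^sub>F y in at x within V. p + (1 / s') *\<^sub>R y \<in> U \<and> y \<in> V"
    using eventually_at_topological by (auto intro: eventually_conj simp: eventually_at_filter)
  then show "\<forall>\<^sub>F y in at x within V. minkowski y < a"
  proof eventually_elim
    case (elim y)
    then have "p + (1 / s') *\<^sub>R y \<in> S" using U in_V by blast
    then have "minkowski y \<le> s'" using gauge_le_iff elim s' by blast
    then show ?case using s' by simp
  qed
next
  fix x a assume x: "x \<in> V" and a: "a < minkowski x"
  define b where "b = (max a 0 + minkowski x) / 2"
  show "\<forall>\<^sub>F y in at x within V. a < minkowski y"
  proof (cases "a < 0")
    case True
    then have "\<forall>y. y \<noteq> x \<longrightarrow> y \<in> V \<longrightarrow> a < minkowski y" using gauge_nonneg order_less_le_trans by blast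
    then show ?thesis unfolding eventually_at_filter by (rule always_eventually)
  next
    case False
    then have b: "0 < b" "b < minkowski x" "a < b" using a by (auto simp: b_def)
    have "p + (1 / b) *\<^sub>R x \<in> - S" using gauge_le_iff[OF x b(1)] b by auto
    moreover have "((\<lambda>y. p + (1 / b) *\<^sub>R y) \<longlongrightarrow> p + (1 / b) *\<^sub>R x) (at x within V)" by (intro tendsto_intros)
    ultimately have "\<forall>\<^sub>F y in at x within V. p + (1 / b) *\<^sub>R y \<in> - S"
      using closedS topological_tendstoD by (metis open_Compl)
    then have "\<forall>\<^sub>F y in at x within V. p + (1 / b) *\<^sub>R y \<in> - S \<and> y \<in> V"
      by (auto intro: eventually_conj simp: eventually_at_filter)
    then show ?thesis
    proof eventually_elim
      case (elim y)
      then have "\<not> minkowski y \<le> b" using gauge_le_iff b by blast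
      then show ?case using b by simp
    qed
  qed
qed

lemma gauge_translate:
  assumes x: "x \<in> V" and S: "\<And>v t. v \<in> S \<Longrightarrow> v + t *\<^sub>R u \<in> S"
  shows "minkowski (x + t *\<^sub>R u) = minkowski x"
proof -
  have "p + (1 / s) *\<^sub>R (x + t *\<^sub>R u) \<in> S \<longleftrightarrow> p + (1 / s) *\<^sub>R x \<in> S" for s
  proof -
    have eq: "p + (1 / s) *\<^sub>R (x + t *\<^sub>R u) = p + (1 / s) *\<^sub>R x + (t / s) *\<^sub>R u"
      by (simp add: algebra_simps)
    have "p + (1 / s) *\<^sub>R x = p + (1 / s) *\<^sub>R x + (t / s) *\<^sub>R u + (- (t / s)) *\<^sub>R u" by simp
    then show ?thesis unfolding eq using S by metis
  qed
  then show ?thesis unfolding minkowski_def gauge_set_def by simp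
qed

end

(* The radial homeomorphism between {g <= 1} and {N <= 1} minus {N = 1, g = 0} rescales a ray so that
   the point with g = 1 (possibly at infinity) is sent to the point with N = 1. *)
locale radial_map = strictly_star_shaped V S p for V S :: "'a::real_normed_vector set" and p :: 'a +
  fixes u :: 'a and N :: "'a \<Rightarrow> real"
  assumes uV: "u \<in> V" and S_translate: "\<And>v t. v \<in> S \<Longrightarrow> v + t *\<^sub>R u \<in> S"
    and N_nonneg: "\<And>x. x \<in> V \<Longrightarrow> 0 \<le> N x"
    and N_scale: "\<And>x c. x \<in> V \<Longrightarrow> N (c *\<^sub>R x) = \<bar>c\<bar> * N x"
    and N_translate: "\<And>x t. x \<in> V \<Longrightarrow> N (x + t *\<^sub>R u) = N x"
    and N_zero: "\<And>x. x \<in> V \<Longrightarrow> N x = 0 \<Longrightarrow> \<exists>t. x = t *\<^sub>R u"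
    and N_cont: "continuous_on V N"
begin

definition target :: "'a set" where
  "target = {y \<in> V. N y \<le> 1 \<and> \<not> (N y = 1 \<and> minkowski y = 0)}"

definition to_target :: "'a \<Rightarrow> 'a" where
  "to_target v = (1 / (1 + N (v - p) - minkowski (v - p))) *\<^sub>R (v - p)"

definition from_target :: "'a \<Rightarrow> 'a" where
  "from_target y = p + (1 / (1 - N y + minkowski y)) *\<^sub>R y"

lemma diff_V: "v \<in> S \<Longrightarrow> v - p \<in> V"
  using SV pS V subspace_diff by blast

lemma gauge_le_one: "v \<in> S \<Longrightarrow> minkowski (v - p) \<le> 1"
  using gauge_le_iff[OF diff_V, of v 1] by simp

lemma gauge_add_u: "x \<in> V \<Longrightarrow> minkowski (x + t *\<^sub>R u) = minkowski x"
  by (rule gauge_translate) (simp_all add: S_translate)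

lemma gauge_zero_of_N: "x \<in> V \<Longrightarrow> N x = 0 \<Longrightarrow> minkowski x = 0"
  using N_zero[of x] gauge_eq_zero_iff[of x] S_translate[OF pS] by fastforce

text \<open>Since g is at most 1, only N = 0 together with g = 1 could make the denominator vanish;
  but N = 0 puts v - p on the line of u, where g = 0.\<close>

lemma to_target_denom:
  assumes "v \<in> S"
  shows "0 < 1 + N (v - p) - minkowski (v - p)"
  using gauge_zero_of_N[OF diff_V[OF assms]] N_nonneg[OF diff_V[OF assms]] gauge_le_one[OF assms]
  by (cases "N (v - p) = 0") auto

text \<open>On the ball the denominator vanishes exactly where N = 1 and g = 0, and these points
  have been removed.\<close>

lemma from_target_denom:
  assumes "y \<in> target"
  shows "0 < 1 - N y + minkowski y"
  using assms gauge_nonneg[of y] by (cases "N y = 1") (auto simp: target_def)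

lemma to_target_values:
  assumes v: "v \<in> S"
  defines "D \<equiv> 1 + N (v - p) - minkowski (v - p)"
  shows "to_target v \<in> V" "N (to_target v) = N (v - p) / D" "minkowski (to_target v) = minkowski (v - p) / D"
  using to_target_denom[OF v] diff_V[OF v] V
  by (auto simp: to_target_def D_def N_scale gauge_scale subspace_scale)

text \<open>The quotient N / D is at most 1 because g is at most 1 on S, with equality only for g =
  1.\<close>

lemma to_target_in:
  assumes v: "v \<in> S"
  shows "to_target v \<in> target"
proof -
  define a b where "a = N (v - p)" and "b = minkowski (v - p)"
  have D: "0 < 1 + a - b" "b \<le> 1" using to_target_denom[OF v] gauge_le_one[OF v] by (auto simp: a_def b_def)
  have "a / (1 + a - b) \<le> 1" using D by simp
  moreover have "b / (1 + a - b) \<noteq> 0" if "a / (1 + a - b) = 1"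
  proof -
    have "b = 1" using that D by simp
    then show ?thesis using D by simp
  qed
  ultimately show ?thesis using to_target_values[OF v] by (auto simp: target_def a_def b_def)
qed

lemma from_target_in:
  assumes y: "y \<in> target"
  shows "from_target y \<in> S"
proof -
  have yV: "y \<in> V" and le: "N y \<le> 1" using y by (auto simp: target_def)
  define D where "D = 1 - N y + minkowski y"
  have D: "0 < D" using from_target_denom[OF y] by (simp add: D_def)
  have "minkowski ((1 / D) *\<^sub>R y) = minkowski y / D" using gauge_scale[OF yV, of "1 / D"] D by simp
  also have "\<dots> \<le> 1" using D le by (simp add: D_def)
  finally have "p + (1 / 1) *\<^sub>R ((1 / D) *\<^sub>R y) \<in> S"
    using gauge_le_iff[of "(1 / D) *\<^sub>R y" 1] yV V subspace_scale by fastforce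
  then show ?thesis by (simp add: from_target_def D_def)
qed

text \<open>By homogeneity both N and g are divided by D, which turns 1 - N + g into 1 / D, so the
  two radial factors cancel.\<close>

lemma from_to_target:
  assumes v: "v \<in> S"
  shows "from_target (to_target v) = v"
proof -
  define a b where "a = N (v - p)" and "b = minkowski (v - p)"
  have D: "0 < 1 + a - b" using to_target_denom[OF v] by (auto simp: a_def b_def)
  have "1 - a / (1 + a - b) + b / (1 + a - b) = 1 / (1 + a - b)" using D by (simp add: field_simps)
  then show ?thesis
    unfolding from_target_def to_target_values[OF v] a_def[symmetric] b_def[symmetric]
    using D by (simp add: to_target_def a_def[symmetric] b_def[symmetric])
qed

lemma to_from_target:
  assumes y: "y \<in> target"
  shows "to_target (from_target y) = y"
proof -
  have yV: "y \<in> V" using y by (auto simp: target_def)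
  define a b where "a = N y" and "b = minkowski y"
  have D: "0 < 1 - a + b" using from_target_denom[OF y] by (simp add: a_def b_def)
  have d: "from_target y - p = (1 / (1 - a + b)) *\<^sub>R y" by (simp add: from_target_def a_def b_def)
  have "N (from_target y - p) = a / (1 - a + b)" "minkowski (from_target y - p) = b / (1 - a + b)"
    unfolding d using yV D by (simp_all add: N_scale gauge_scale a_def[symmetric] b_def[symmetric])
  moreover have "1 + a / (1 - a + b) - b / (1 - a + b) = 1 / (1 - a + b)" using D by (simp add: field_simps)
  ultimately show ?thesis unfolding to_target_def d using D by simp
qed

lemma continuous_on_to_target: "continuous_on S to_target"
proof -
  have d: "continuous_on S (\<lambda>v. v - p)" by (intro continuous_intros)
  have "(\<lambda>v. v - p) ` S \<subseteq> V" using diff_V by blast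
  note c = continuous_on_compose2[OF N_cont d this] continuous_on_compose2[OF continuous_on_gauge d this]
  show ?thesis
    unfolding to_target_def using to_target_denom
    by (intro continuous_intros c) (metis less_irrefl)
qed

lemma continuous_on_from_target: "continuous_on target from_target"
proof -
  have "target \<subseteq> V" by (auto simp: target_def)
  note c = continuous_on_subset[OF N_cont this] continuous_on_subset[OF continuous_on_gauge this]
  show ?thesis
    unfolding from_target_def using from_target_denom
    by (intro continuous_intros c) (metis less_irrefl)
qed

lemma to_target_translate:
  assumes v: "v \<in> S"
  shows "\<exists>s. to_target (v + t *\<^sub>R u) = to_target v + s *\<^sub>R u"
proof -
  have eq: "v + t *\<^sub>R u - p = (v - p) + t *\<^sub>R u" by simp
  show ?thesis
    unfolding to_target_def eq N_translate[OF diff_V[OF v]] gauge_add_u[OF diff_V[OF v]]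
    by (simp only: scaleR_add_right scaleR_scaleR) blast
qed

lemma from_target_translate:
  assumes y: "y \<in> V"
  shows "\<exists>s. from_target (y + t *\<^sub>R u) = from_target y + s *\<^sub>R u"
  unfolding from_target_def N_translate[OF y] gauge_add_u[OF y]
  by (simp only: scaleR_add_right scaleR_scaleR add.assoc[symmetric]) blast

lemma target_translate:
  assumes y: "y \<in> target"
  shows "y + t *\<^sub>R u \<in> target"
proof -
  have yV: "y \<in> V" using y by (auto simp: target_def)
  then have "y + t *\<^sub>R u \<in> V" using uV V subspace_add subspace_scale by blast
  then show ?thesis
    using y unfolding target_def by (simp add: N_translate[OF yV] gauge_add_u[OF yV])
qed

end

section \<open>Quotient by a line and descent of homeomorphisms\<close>

lemma equiv_line_rel:
  assumes V: "subspace V" and u: "u \<in> V"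
  shows "equiv V (line_rel V u)"
proof (rule equivI)
  show "line_rel V u \<subseteq> V \<times> V" by (auto simp: line_rel_def)
  show "refl_on V (line_rel V u)" by (auto simp: line_rel_def refl_on_def intro: exI[of _ 0])
  show "sym (line_rel V u)"
  proof (rule symI)
    fix v w assume "(v, w) \<in> line_rel V u"
    then obtain t where t: "v \<in> V" "w \<in> V" "w = v + t *\<^sub>R u" by (auto simp: line_rel_def)
    then have "v = w + (- t) *\<^sub>R u" by simp
    then show "(w, v) \<in> line_rel V u" unfolding line_rel_def using t by blast
  qed
  show "trans (line_rel V u)"
  proof (rule transI)
    fix x y z assume "(x, y) \<in> line_rel V u" "(y, z) \<in> line_rel V u"
    then obtain t s where *: "x \<in> V" "z \<in> V" "y = x + t *\<^sub>R u" "z = y + s *\<^sub>R u" by (auto simp: line_rel_def)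
    then have "z = x + (t + s) *\<^sub>R u" by (simp add: scaleR_add_left add.assoc)
    then show "(x, z) \<in> line_rel V u" unfolding line_rel_def using * by blast
  qed
qed

lemma line_rel_class_eq_iff:
  assumes V: "subspace V" and u: "u \<in> V" and "v \<in> V" "w \<in> V"
  shows "line_rel V u `` {v} = line_rel V u `` {w} \<longleftrightarrow> (\<exists>t. w = v + t *\<^sub>R u)"
  using eq_equiv_class_iff[OF equiv_line_rel[OF V u] assms(3,4)] assms(3,4) by (auto simp: line_rel_def)

text \<open>The saturation of W is the union of its translates along u. Openness is what survives
  restriction to an arbitrary saturated set.\<close>

lemma open_map_line_rel:
  fixes V :: "'a::real_normed_vector set"
  assumes V: "subspace V" and u: "u \<in> V"
  shows "open_map (top_of_set V) (quotient_topology (top_of_set V) (line_rel V u)) (\<lambda>v. line_rel V u `` {v})"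
  unfolding open_map_def
proof (intro allI impI)
  fix W assume W: "openin (top_of_set V) W"
  then have WV: "W \<subseteq> V" by (rule openin_imp_subset)
  have "{v \<in> V. line_rel V u `` {v} \<in> (\<lambda>v. line_rel V u `` {v}) ` W} = (\<Union>t. V \<inter> (\<lambda>v. v + t *\<^sub>R u) -` W)"
  proof -
    have "line_rel V u `` {v} \<in> (\<lambda>v. line_rel V u `` {v}) ` W \<longleftrightarrow> (\<exists>t. v + t *\<^sub>R u \<in> W)" if v: "v \<in> V" for v
    proof -
      have "line_rel V u `` {v} \<in> (\<lambda>v. line_rel V u `` {v}) ` W \<longleftrightarrow> (\<exists>w\<in>W. line_rel V u `` {v} = line_rel V u `` {w})"
        by blast
      also have "\<dots> \<longleftrightarrow> (\<exists>w\<in>W. \<exists>t. w = v + t *\<^sub>R u)"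
        using line_rel_class_eq_iff[OF V u v] WV by blast
      finally show ?thesis by blast
    qed
    then have "{v \<in> V. line_rel V u `` {v} \<in> (\<lambda>v. line_rel V u `` {v}) ` W} = {v \<in> V. \<exists>t. v + t *\<^sub>R u \<in> W}"
      by (intro Collect_cong conj_cong refl)
    then show ?thesis by auto
  qed
  moreover have "openin (top_of_set V) (V \<inter> (\<lambda>v. v + t *\<^sub>R u) -` W)" for t
  proof (rule continuous_openin_preimage[OF _ _ W])
    show "(\<lambda>v. v + t *\<^sub>R u) \<in> V \<rightarrow> V" using V u subspace_add subspace_scale by blast
  qed (intro continuous_intros)
  ultimately have "openin (top_of_set V) {v \<in> V. line_rel V u `` {v} \<in> (\<lambda>v. line_rel V u `` {v}) ` W}"
    by (simp only:) (rule openin_Union, auto)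
  then show "openin (quotient_topology (top_of_set V) (line_rel V u)) ((\<lambda>v. line_rel V u `` {v}) ` W)"
    using WV by (auto simp: openin_quotient_topology intro: quotientI)
qed

text \<open>Both maps descend by the universal property of quotients. On the side of Y the
  projection restricted to U must again be a quotient map, which \<open>op\<close> and the
  saturation of U ensure.\<close>

lemma quotient_topology_homeomorphic:
  assumes r: "equiv (topspace X) r" and s: "equiv (topspace Y) s"
    and op: "open_map Y (quotient_topology Y s) (\<lambda>y. s `` {y})"
    and U: "U \<subseteq> topspace Y" "\<And>y y'. y \<in> U \<Longrightarrow> (y, y') \<in> s \<Longrightarrow> y' \<in> U"
    and f: "continuous_map X (subtopology Y U) f" and g: "continuous_map (subtopology Y U) X g"
    and fr: "\<And>x x'. (x, x') \<in> r \<Longrightarrow> (f x, f x') \<in> s"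
    and gs: "\<And>y y'. y \<in> U \<Longrightarrow> (y, y') \<in> s \<Longrightarrow> (g y, g y') \<in> r"
    and gf: "\<And>x. x \<in> topspace X \<Longrightarrow> g (f x) = x" and fg: "\<And>y. y \<in> U \<Longrightarrow> f (g y) = y"
  shows "quotient_topology X r homeomorphic_space
    subtopology (quotient_topology Y s) ((\<lambda>y. s `` {y}) ` U)"
proof -
  let ?P = "(\<lambda>y. s `` {y}) ` U"
  let ?Z = "subtopology (quotient_topology Y s) ?P"
  have tU: "topspace (subtopology Y U) = U" using U by auto
  have tP: "topspace ?Z = ?P"
    using U(1) by (auto simp: topspace_quotient_topology intro: quotientI)
  have q1: "quotient_map X (quotient_topology X r) (\<lambda>x. r `` {x})" by (rule quotient_map_quotient_topology)
  have q2: "quotient_map (subtopology Y U) ?Z (\<lambda>y. s `` {y})"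
  proof (rule continuous_open_imp_quotient_map)
    show "continuous_map (subtopology Y U) ?Z (\<lambda>y. s `` {y})"
      using quotient_imp_continuous_map[OF quotient_map_quotient_topology, of Y s] tU
      by (auto simp: continuous_map_in_subtopology continuous_map_from_subtopology)
    have "{x \<in> topspace Y. s `` {x} \<in> ?P} = U"
    proof
      show "{x \<in> topspace Y. s `` {x} \<in> ?P} \<subseteq> U"
      proof clarify
        fix x y assume "x \<in> topspace Y" "y \<in> U" "s `` {x} = s `` {y}"
        then have "(y, x) \<in> s" using eq_equiv_class_iff[OF s] U(1) by blast
        then show "x \<in> U" using U(2) \<open>y \<in> U\<close> by blast
      qed
    qed (use U(1) in blast)
    then show "open_map (subtopology Y U) ?Z (\<lambda>y. s `` {y})" by (rule open_map_restriction[OF op])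
    show "(\<lambda>y. s `` {y}) ` topspace (subtopology Y U) = topspace ?Z" unfolding tU tP by simp
  qed
  have fX: "f x \<in> U" if "x \<in> topspace X" for x using continuous_map_image_subset_topspace[OF f] that tU by auto
  have gY: "g y \<in> topspace X" if "y \<in> U" for y using continuous_map_image_subset_topspace[OF g] that tU by auto
  have "\<And>x y. x \<in> topspace X \<Longrightarrow> y \<in> topspace X \<Longrightarrow> r `` {x} = r `` {y} \<Longrightarrow>
      ((\<lambda>y. s `` {y}) \<circ> f) x = ((\<lambda>y. s `` {y}) \<circ> f) y"
    using eq_equiv_class_iff[OF r] fr equiv_class_eq[OF s] by (metis comp_apply)
  then obtain F where F: "continuous_map (quotient_topology X r) ?Z F" "\<And>x. x \<in> topspace X \<Longrightarrow> F (r `` {x}) = s `` {f x}"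
    using quotient_map_lift_exists[OF q1 continuous_map_compose[OF f quotient_imp_continuous_map[OF q2]]]
    by (metis comp_apply)
  have "\<And>x y. x \<in> topspace (subtopology Y U) \<Longrightarrow> y \<in> topspace (subtopology Y U) \<Longrightarrow> s `` {x} = s `` {y} \<Longrightarrow>
      ((\<lambda>x. r `` {x}) \<circ> g) x = ((\<lambda>x. r `` {x}) \<circ> g) y"
    unfolding tU using eq_equiv_class_iff[OF s] gs U(1) equiv_class_eq[OF r] by (metis comp_apply subsetD)
  then obtain G where G: "continuous_map ?Z (quotient_topology X r) G" "\<And>y. y \<in> U \<Longrightarrow> G (s `` {y}) = r `` {g y}"
    using quotient_map_lift_exists[OF q2 continuous_map_compose[OF g quotient_imp_continuous_map[OF q1]]] tU
    by (metis comp_apply)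
  have "homeomorphic_maps (quotient_topology X r) ?Z F G"
    unfolding homeomorphic_maps_def
  proof (intro conjI ballI F(1) G(1))
    fix C assume "C \<in> topspace (quotient_topology X r)"
    then obtain x where "x \<in> topspace X" "C = r `` {x}" by (auto simp: topspace_quotient_topology quotient_def)
    then show "G (F C) = C" using F(2) G(2) fX gf by simp
  next
    fix C assume "C \<in> topspace ?Z"
    then obtain y where "y \<in> U" "C = s `` {y}" unfolding tP by blast
    then show "F (G C) = C" using F(2) G(2) gY fg by simp
  qed
  then show ?thesis unfolding homeomorphic_space_def by blast
qed

section \<open>The homeomorphism\<close>

lemma poly_mapping_eq_sum_single:
  fixes v :: "'b \<Rightarrow>\<^sub>0 real"
  assumes "finite K" "Poly_Mapping.keys v \<subseteq> K"
  shows "v = (\<Sum>x\<in>K. lk v x *\<^sub>R Poly_Mapping.single x 1)"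
proof (rule poly_mapping_eqI)
  fix k
  show "lk v k = lk (\<Sum>x\<in>K. lk v x *\<^sub>R Poly_Mapping.single x 1) k"
    using assms by (auto simp: lookup_sum lookup_scaleR lookup_single when_def if_distrib sum.delta in_keys_iff subset_iff cong: if_cong)
qed

text \<open>A seminorm is bounded by a weighted sum of absolute coordinates, which controls the
  difference of its values at two points. The coordinate vectors may lie outside V, so a linear
  projection P first sends them into V.\<close>

lemma continuous_on_seminorm:
  fixes V :: "('b \<Rightarrow>\<^sub>0 real) set" and N :: "('b \<Rightarrow>\<^sub>0 real) \<Rightarrow> real"
  assumes K: "finite K" and V: "subspace V" "\<And>v. v \<in> V \<Longrightarrow> Poly_Mapping.keys v \<subseteq> K"
    and nonneg: "\<And>v. v \<in> V \<Longrightarrow> 0 \<le> N v"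
    and scale: "\<And>v c. v \<in> V \<Longrightarrow> N (c *\<^sub>R v) = \<bar>c\<bar> * N v"
    and triangle: "\<And>v w. v \<in> V \<Longrightarrow> w \<in> V \<Longrightarrow> N (v + w) \<le> N v + N w"
  shows "continuous_on V N"
proof -
  have "inj_on (\<lambda>v. v) V" by simp
  then obtain P :: "('b \<Rightarrow>\<^sub>0 real) \<Rightarrow> ('b \<Rightarrow>\<^sub>0 real)" where
    P: "range P \<subseteq> V" "linear P" "\<And>v. v \<in> V \<Longrightarrow> P v = v"
    using real_vector.linear_exists_left_inverse_on[OF linear_id[unfolded id_def] V(1)] by auto
  define C where "C x = N (P (Poly_Mapping.single x 1))" for x
  have bound: "N (\<Sum>x\<in>L. c x *\<^sub>R P (Poly_Mapping.single x 1)) \<le> (\<Sum>x\<in>L. \<bar>c x\<bar> * C x)"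
    if "finite L" for L c
    using that
  proof (induction L rule: finite_induct)
    case empty
    then show ?case using scale[of 0 0] subspace_0[OF V(1)] by simp
  next
    case (insert a L)
    have PV: "P x \<in> V" for x using P(1) by blast
    have 1: "c a *\<^sub>R P (Poly_Mapping.single a 1) \<in> V" by (rule subspace_scale[OF V(1) PV])
    have 2: "(\<Sum>x\<in>L. c x *\<^sub>R P (Poly_Mapping.single x 1)) \<in> V"
      by (intro subspace_sum[OF V(1)] subspace_scale[OF V(1)] PV)
    show ?case using triangle[OF 1 2] insert scale[OF PV] by (simp add: C_def)
  qed
  have le: "N v \<le> (\<Sum>x\<in>K. \<bar>lk v x\<bar> * C x)" if v: "v \<in> V" for v
  proof -
    have "v = P (\<Sum>x\<in>K. lk v x *\<^sub>R Poly_Mapping.single x 1)"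
      using poly_mapping_eq_sum_single[OF K V(2)[OF v]] P(3)[OF v] by metis
    also have "\<dots> = (\<Sum>x\<in>K. lk v x *\<^sub>R P (Poly_Mapping.single x 1))"
      using P(2) by (simp add: linear_sum linear_scale)
    finally show ?thesis using bound[OF K, of "lk v"] by metis
  qed
  have diff: "\<bar>N w - N v\<bar> \<le> (\<Sum>x\<in>K. \<bar>lk (w - v) x\<bar> * C x)" if vw: "v \<in> V" "w \<in> V" for v w
  proof -
    have d: "w - v \<in> V" "v - w \<in> V" using vw V(1) subspace_diff by blast+
    have "N w \<le> N v + N (w - v)" using triangle[OF vw(1) d(1)] by simp
    moreover have "N v \<le> N w + N (v - w)" using triangle[OF vw(2) d(2)] by simp
    moreover have "N (v - w) = N (w - v)" using scale[OF d(1), of "- 1"] by simp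
    ultimately show ?thesis using le[OF d(1)] by linarith
  qed
  have lim: "((\<lambda>w. \<Sum>x\<in>K. \<bar>lk (w - v) x\<bar> * C x) \<longlongrightarrow> (\<Sum>x\<in>K. \<bar>lk (v - v) x\<bar> * C x)) (at v within V)" for v
  proof -
    have "continuous_on UNIV (\<lambda>w. \<Sum>x\<in>K. \<bar>lk (w - v) x\<bar> * C x)"
      by (intro continuous_intros)
    then have "((\<lambda>w. \<Sum>x\<in>K. \<bar>lk (w - v) x\<bar> * C x) \<longlongrightarrow> (\<Sum>x\<in>K. \<bar>lk (v - v) x\<bar> * C x)) (at v within UNIV)"
      unfolding continuous_on_def by blast
    then show ?thesis by (rule tendsto_within_subset) simp
  qed
  show ?thesis
    unfolding continuous_on_def
  proof
    fix v assume v: "v \<in> V"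
    have "\<forall>\<^sub>F w in at v within V. norm (N w - N v) \<le> (\<Sum>x\<in>K. \<bar>lk (w - v) x\<bar> * C x)"
      unfolding eventually_at_filter real_norm_def
      by (rule always_eventually) (intro allI impI diff[OF v])
    then have "((\<lambda>w. N w - N v) \<longlongrightarrow> 0) (at v within V)"
      by (rule Lim_null_comparison) (use lim[of v] in simp)
    then show "(N \<longlongrightarrow> N v) (at v within V)" by (rule LIM_zero_cancel)
  qed
qed

lemma continuous_on_single:
  assumes "continuous_on S (h :: _ \<Rightarrow> real)"
  shows "continuous_on S (\<lambda>z. Poly_Mapping.single x (h z))"
proof -
  have "dist (Poly_Mapping.single x a) (Poly_Mapping.single x b) = dist a b" for a b :: real
  proof -
    have "dist (Poly_Mapping.single x a) (Poly_Mapping.single x b) = (\<Sum>y\<in>{x}. dist (lk (Poly_Mapping.single x a) y) (lk (Poly_Mapping.single x b) y))"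
      unfolding dist_poly_mapping_def by (rule sum.mono_neutral_left) (auto simp: in_keys_iff lookup_single)
    then show ?thesis by simp
  qed
  then have "continuous_on UNIV (Poly_Mapping.single x :: real \<Rightarrow> _)" unfolding continuous_on_iff by auto
  then show ?thesis using continuous_on_compose2[OF _ assms] by blast
qed

lemma equiv_pos_scaling_rel:
  assumes "\<And>f c. f \<in> S \<Longrightarrow> 0 < c \<Longrightarrow> c *\<^sub>R f \<in> S"
  shows "equiv S (pos_scaling_rel S)"
proof (rule equivI)
  show "pos_scaling_rel S \<subseteq> S \<times> S" by (auto simp: pos_scaling_rel_def)
  show "refl_on S (pos_scaling_rel S)" by (auto simp: pos_scaling_rel_def refl_on_def intro: exI[of _ 1])
  show "sym (pos_scaling_rel S)"
  proof (rule symI)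
    fix f g assume "(f, g) \<in> pos_scaling_rel S"
    then obtain c where "f \<in> S" "g \<in> S" "0 < c" "g = c *\<^sub>R f" by (auto simp: pos_scaling_rel_def)
    moreover from this have "f = (1 / c) *\<^sub>R g" "0 < 1 / c" by simp_all
    ultimately show "(g, f) \<in> pos_scaling_rel S" unfolding pos_scaling_rel_def by blast
  qed
  show "trans (pos_scaling_rel S)"
  proof (rule transI)
    fix f g h assume "(f, g) \<in> pos_scaling_rel S" "(g, h) \<in> pos_scaling_rel S"
    then obtain c e where "f \<in> S" "h \<in> S" "0 < c" "0 < e" "h = (e * c) *\<^sub>R f" by (auto simp: pos_scaling_rel_def)
    moreover from this have "0 < e * c" by simp
    ultimately show "(f, h) \<in> pos_scaling_rel S" unfolding pos_scaling_rel_def by blast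
  qed
qed

section \<open>Polynomials and their logarithms\<close>

context M_convex_subset
begin

definition fact_expo :: "expo \<Rightarrow> real" where
  "fact_expo x = (\<Prod>i\<in>Poly_Mapping.keys x. fact (lk x i))"

lemma fact_expo_pos: "0 < fact_expo x"
  by (simp add: fact_expo_def prod_pos)

lemma norm_coeff_eq: "norm_coeff f x = lk f x * fact_expo x"
  by (simp add: norm_coeff_def fact_expo_def)

lemma norm_coeff_lorentzian:
  assumes "f \<in> lorentzian_set n d J"
  shows "x \<in> J \<Longrightarrow> 0 < norm_coeff f x" "x \<notin> J \<Longrightarrow> norm_coeff f x = 0"
  using assms by (auto simp: lorentzian_set_def lorentzian_def poly_support_def less_le)

lemma lorentzian_set_iff:
  "f \<in> lorentzian_set n d J \<longleftrightarrow> (\<forall>x. x \<in> J \<longrightarrow> 0 < lk f x) \<and> Poly_Mapping.keys f \<subseteq> J \<and> log_vec J (norm_coeff f) \<in> log_lorentzian"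
proof
  assume f: "f \<in> lorentzian_set n d J"
  have lor: "lorentzian n d f" "poly_support f = J" using f by (auto simp: lorentzian_set_def)
  have "exp_coeff (log_vec J (norm_coeff f)) = norm_coeff f"
    using exp_coeff_log_vec[of "norm_coeff f"] norm_coeff_lorentzian[OF f] by auto
  then have "log_vec J (norm_coeff f) \<in> log_lorentzian"
    using lor(1) keys_log_vec unfolding log_lorentzian_def lorentzian_def num_pos_eigenvalues_hessian by simp
  moreover have "0 < lk f x" if "x \<in> J" for x
    using norm_coeff_lorentzian(1)[OF f that] fact_expo_pos[of x] by (simp add: norm_coeff_eq zero_less_mult_iff)
  ultimately show "(\<forall>x. x \<in> J \<longrightarrow> 0 < lk f x) \<and> Poly_Mapping.keys f \<subseteq> J \<and> log_vec J (norm_coeff f) \<in> log_lorentzian"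
    using lor(2) by (simp add: poly_support_eq_keys)
next
  assume *: "(\<forall>x. x \<in> J \<longrightarrow> 0 < lk f x) \<and> Poly_Mapping.keys f \<subseteq> J \<and> log_vec J (norm_coeff f) \<in> log_lorentzian"
  have pos: "0 < norm_coeff f x" if "x \<in> J" for x using * that fact_expo_pos by (simp add: norm_coeff_eq)
  have zero: "norm_coeff f x = 0" if "x \<notin> J" for x using * that by (auto simp: norm_coeff_eq keys_subset_iff)
  have supp: "poly_support f = J" using pos zero unfolding poly_support_def by force
  have ec: "exp_coeff (log_vec J (norm_coeff f)) = norm_coeff f"
    using exp_coeff_log_vec[OF pos] zero by auto
  have "f \<noteq> 0" using supp J_nonempty by (auto simp: poly_support_eq_keys)
  moreover have "0 \<le> norm_coeff f x" for x using pos[of x] zero[of x] by (cases "x \<in> J") auto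
  moreover have "2 \<le> d \<longrightarrow> (\<forall>\<alpha>\<in>discrete_simplex n (d - 2). lorentz_form {..<n} (\<lambda>i j. norm_coeff f (\<alpha> + ee i + ee j)))"
    using * unfolding log_lorentzian_def mem_Collect_eq ec by blast
  ultimately show "f \<in> lorentzian_set n d J"
    unfolding lorentzian_set_def lorentzian_def num_pos_eigenvalues_hessian mem_Collect_eq supp
    using * J_conv J_sub by blast
qed

definition log_poly :: "real_mpoly \<Rightarrow> expo \<Rightarrow>\<^sub>0 real" where
  "log_poly f = log_vec J (norm_coeff f)"

definition exp_poly :: "(expo \<Rightarrow>\<^sub>0 real) \<Rightarrow> real_mpoly" where
  "exp_poly v = (\<Sum>x\<in>J. Poly_Mapping.single x (exp (lk v x) / fact_expo x))"

lemma lookup_exp_poly: "lk (exp_poly v) x = (if x \<in> J then exp (lk v x) / fact_expo x else 0)"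
  unfolding exp_poly_def by (rule lookup_sum_single)

lemma log_exp_poly:
  assumes "Poly_Mapping.keys v \<subseteq> J"
  shows "log_poly (exp_poly v) = v"
  using assms fact_expo_pos unfolding keys_subset_iff
  by (intro poly_mapping_eqI) (simp add: log_poly_def lookup_log_vec norm_coeff_eq lookup_exp_poly less_imp_neq[symmetric])

lemma exp_poly_lorentzian:
  assumes v: "v \<in> log_lorentzian"
  shows "exp_poly v \<in> lorentzian_set n d J"
proof -
  have "Poly_Mapping.keys v \<subseteq> J" using v by (simp add: log_lorentzian_def)
  then show ?thesis
    unfolding lorentzian_set_iff log_poly_def[symmetric] using v fact_expo_pos
    by (simp add: log_exp_poly keys_subset_iff[of "exp_poly v"] lookup_exp_poly)
qed

lemma log_poly_lorentzian: "f \<in> lorentzian_set n d J \<Longrightarrow> log_poly f \<in> log_lorentzian"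
  unfolding lorentzian_set_iff log_poly_def by blast

lemma exp_log_poly:
  assumes "f \<in> lorentzian_set n d J"
  shows "exp_poly (log_poly f) = f"
proof (rule poly_mapping_eqI)
  fix x
  have *: "0 < lk f x" if "x \<in> J" using assms that unfolding lorentzian_set_iff by blast
  have "lk f x = 0" if "x \<notin> J" using assms that unfolding lorentzian_set_iff keys_subset_iff by blast
  then show "lk (exp_poly (log_poly f)) x = lk f x"
    using * fact_expo_pos[of x] by (auto simp: lookup_exp_poly log_poly_def lookup_log_vec norm_coeff_eq)
qed

lemma exp_poly_add_ones: "exp_poly (v + t *\<^sub>R ones_vec J) = exp t *\<^sub>R exp_poly v"
  by (rule poly_mapping_eqI) (simp add: lookup_exp_poly lookup_scaleR lookup_add lookup_ones_vec exp_add)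

lemma log_poly_scale:
  assumes f: "f \<in> lorentzian_set n d J" and c: "0 < c"
  shows "log_poly (c *\<^sub>R f) = log_poly f + ln c *\<^sub>R ones_vec J"
proof (rule poly_mapping_eqI)
  fix x
  have "norm_coeff (c *\<^sub>R f) x = c * norm_coeff f x" by (simp add: norm_coeff_eq lookup_scaleR)
  then show "lk (log_poly (c *\<^sub>R f)) x = lk (log_poly f + ln c *\<^sub>R ones_vec J) x"
    using norm_coeff_lorentzian(1)[OF f, of x] c
    by (cases "x \<in> J") (simp_all add: log_poly_def lookup_log_vec lookup_scaleR lookup_add lookup_ones_vec ln_mult)
qed

lemma lorentzian_set_scale:
  assumes f: "f \<in> lorentzian_set n d J" and c: "0 < c"
  shows "c *\<^sub>R f \<in> lorentzian_set n d J"
proof -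
  have "exp_poly (log_poly f + ln c *\<^sub>R ones_vec J) \<in> lorentzian_set n d J"
    by (intro exp_poly_lorentzian log_lorentzian_add_ones log_poly_lorentzian f)
  then show ?thesis using c by (simp add: exp_poly_add_ones exp_log_poly[OF f])
qed

lemma continuous_on_log_poly: "continuous_on (lorentzian_set n d J) log_poly"
proof -
  have "lk f x * fact_expo x \<noteq> 0" if "f \<in> lorentzian_set n d J" "x \<in> J" for f x
    using norm_coeff_lorentzian(1)[OF that] unfolding norm_coeff_eq by (simp only: less_imp_neq[symmetric] not_False_eq_True)
  then show ?thesis
    unfolding log_poly_def log_vec_def norm_coeff_eq
    by (intro continuous_on_sum continuous_on_single continuous_intros) auto
qed

lemma continuous_on_exp_poly: "continuous_on S exp_poly"
  unfolding exp_poly_def using fact_expo_pos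
  by (intro continuous_on_sum continuous_on_single continuous_intros) (simp add: less_imp_neq[symmetric])

end

theorem theorem4p19:
  fixes n d :: nat and J :: "expo set"
    and N :: "(expo \<Rightarrow>\<^sub>0 real) set \<Rightarrow> real"
    and B X :: "(expo \<Rightarrow>\<^sub>0 real) set set"
  assumes "J \<subseteq> discrete_simplex n d" and "M_convex J"
    and "is_quotient_norm (V_space n d J) (ones_vec J) N"
    and "B = {C \<in> topspace (V_quotient n d J). N C \<le> 1}"
    and "X = B - (dressian n d J \<inter> (V_quotient n d J) frontier_of B)"
  shows "proj_lorentzian n d J homeomorphic_space subtopology (V_quotient n d J) X"
proof -
  interpret M_convex_subset n d J by (unfold_locales) (fact assms(1,2))+
  define V where "V = V_space n d J"
  define u where "u = ones_vec J"
  define cl where "cl v = line_rel V u `` {v}" for v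
  \<comment> \<open>N pulled back to V is a seminorm that is constant along u and vanishes only on
    multiples of u.\<close>
  define M where "M v = N (cl v)" for v
  note sV = subspace_V[folded V_def] and uV = ones_vec_V[folded u_def V_def]
  have keysV: "Poly_Mapping.keys v \<subseteq> J" if "v \<in> V" for v using that by (simp add: V_def V_space_iff)
  have cl_eq: "cl v = cl w \<longleftrightarrow> (\<exists>t. w = v + t *\<^sub>R u)" if "v \<in> V" "w \<in> V" for v w
    unfolding cl_def by (rule line_rel_class_eq_iff[OF sV uV that])
  have addV: "v + t *\<^sub>R u \<in> V" if "v \<in> V" for v t
    using sV uV that subspace_add subspace_scale by blast
  have M_norm: "\<forall>v\<in>V. 0 \<le> M v" "\<forall>v\<in>V. M v = 0 \<longleftrightarrow> cl v = cl 0" "\<forall>v\<in>V. \<forall>c. M (c *\<^sub>R v) = \<bar>c\<bar> * M v"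
    "\<forall>v\<in>V. \<forall>w\<in>V. M (v + w) \<le> M v + M w"
    using assms(3) unfolding is_quotient_norm_def M_def cl_def V_def u_def by blast+
  have M_cont: "continuous_on V M"
    using M_norm by (intro continuous_on_seminorm[OF finite_J sV keysV]) auto
  interpret radial_map V log_lorentzian center u M
  proof unfold_locales
    show "subspace V" "u \<in> V" "continuous_on V M" by (fact sV uV M_cont)+
    show "log_lorentzian \<subseteq> V" unfolding V_def by (rule log_lorentzian_subset_V)
    show "center \<in> log_lorentzian" "closed log_lorentzian" by (fact center_log_lorentzian closed_log_lorentzian)+
    show "\<exists>U. open U \<and> t *\<^sub>R v + (1 - t) *\<^sub>R center \<in> U \<and> U \<inter> V \<subseteq> log_lorentzian"
      if "v \<in> log_lorentzian" "0 < t" "t < 1" for v t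
      unfolding V_def by (rule log_lorentzian_interior[OF that])
    show "v + t *\<^sub>R u \<in> log_lorentzian" if "v \<in> log_lorentzian" for v t
      unfolding u_def by (rule log_lorentzian_add_ones[OF that])
    show "0 \<le> M v" if "v \<in> V" for v using M_norm(1) that by blast
    show "M (c *\<^sub>R v) = \<bar>c\<bar> * M v" if "v \<in> V" for v c using M_norm(3) that by blast
    show "M (v + t *\<^sub>R u) = M v" if "v \<in> V" for v t
      using cl_eq[OF that addV[OF that]] by (metis M_def)
    show "\<exists>t. v = t *\<^sub>R u" if "v \<in> V" "M v = 0" for v
      using M_norm(2) that cl_eq[OF subspace_0[OF sV] that(1)] by auto
  qed
  have Vq: "V_quotient n d J = quotient_topology (top_of_set V) (line_rel V u)"
    by (simp add: V_quotient_def V_def u_def)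
  have top: "topspace (V_quotient n d J) = cl ` V"
    unfolding Vq topspace_quotient_topology by (auto simp: quotient_def cl_def)
  have B: "B = cl ` {v \<in> V. M v \<le> 1}" unfolding assms(4) top by (auto simp: M_def)
  have qmap: "quotient_map (top_of_set V) (V_quotient n d J) cl"
    unfolding Vq cl_def[abs_def] by (rule quotient_map_quotient_topology)
  have openq: "openin (V_quotient n d J) W \<Longrightarrow> openin (top_of_set V) {v \<in> V. cl v \<in> W}" for W
    unfolding Vq openin_quotient_topology cl_def by simp
  \<comment> \<open>The gauge is constant along u, so it may be evaluated at any representative, in
    particular at one that satisfies the tropical relations.\<close>
  have dress: "cl v \<in> dressian n d J \<longleftrightarrow> minkowski v = 0" if v: "v \<in> V" for v
  proof -
    have dv: "dressian n d J = {cl w | w. Poly_Mapping.keys w \<subseteq> J \<and> weak_zero (exp_coeff w)}"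
      unfolding dressian_def strong_zero_iff[symmetric] cl_def V_def u_def by blast
    have g: "minkowski w = 0 \<longleftrightarrow> weak_zero (exp_coeff w)" if "w \<in> V" for w
      unfolding gauge_eq_zero_iff[OF that] weak_zero_iff_recession[OF keysV[OF that]] by simp
    show ?thesis
    proof
      assume "cl v \<in> dressian n d J"
      then obtain w where w: "cl v = cl w" "Poly_Mapping.keys w \<subseteq> J" "weak_zero (exp_coeff w)" unfolding dv by blast
      have wV: "w \<in> V"
        using weak_zero_imp_log_lorentzian[OF w(2,3)] log_lorentzian_subset_V by (auto simp: V_def)
      then obtain t where "w = v + t *\<^sub>R u" using cl_eq[OF v] w(1) by blast
      then show "minkowski v = 0" using g[OF wV] w(3) gauge_add_u[OF v] by simp
    next
      assume "minkowski v = 0"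
      then show "cl v \<in> dressian n d J" unfolding dv using g[OF v] keysV[OF v] by blast
    qed
  qed
  have front: "cl v \<in> V_quotient n d J frontier_of B \<longleftrightarrow> M v = 1" if v: "v \<in> V" "M v \<le> 1" for v
  proof -
    have clB: "cl v \<in> B" using v unfolding B by blast
    have "B \<subseteq> topspace (V_quotient n d J)" unfolding B top by blast
    then have closure: "cl v \<in> V_quotient n d J closure_of B" using closure_of_subset clB by blast
    have "cl v \<in> V_quotient n d J interior_of B \<longleftrightarrow> M v < 1"
    proof
      assume "M v < 1"
      have sub: "{w \<in> V. cl w \<in> cl ` {v \<in> V. M v < 1}} = {w \<in> V. M w < 1}"
        unfolding M_def by (auto simp: image_iff)
      have "openin (top_of_set V) (V \<inter> M -` {..<1})"
        by (rule continuous_openin_preimage_gen[OF M_cont]) simp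
      moreover have "V \<inter> M -` {..<1} = {w \<in> V. M w < 1}" by auto
      ultimately have "openin (V_quotient n d J) (cl ` {v \<in> V. M v < 1})"
        unfolding Vq openin_quotient_topology using sub by (auto simp: cl_def intro: quotientI)
      moreover have "cl ` {v \<in> V. M v < 1} \<subseteq> B" unfolding B by auto
      ultimately show "cl v \<in> V_quotient n d J interior_of B"
        using \<open>M v < 1\<close> v(1) by (auto simp: interior_of_def)
    next
      assume "cl v \<in> V_quotient n d J interior_of B"
      then obtain W where W: "openin (V_quotient n d J) W" "cl v \<in> W" "W \<subseteq> B" by (auto simp: interior_of_def)
      obtain T where T: "open T" "{w \<in> V. cl w \<in> W} = V \<inter> T"
        using openq[OF W(1)] by (auto simp: openin_open)
      have vT: "v \<in> T" using T(2) v(1) W(2) by blast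
      \<comment> \<open>An interior point of norm 1 could be pushed outwards to (1 + e) v without
        leaving B.\<close>
      have "((\<lambda>e. (1 + e) *\<^sub>R v) \<longlongrightarrow> (1 + 0) *\<^sub>R v) (at_right 0)" by (intro tendsto_intros)
      then have "\<forall>\<^sub>F e in at_right 0. (1 + e) *\<^sub>R v \<in> T" using T(1) vT topological_tendstoD by fastforce
      then have "\<forall>\<^sub>F e in at_right (0::real). 0 < e \<and> (1 + e) *\<^sub>R v \<in> T"
        using eventually_at_right_less[of 0] by eventually_elim auto
      from eventually_happens'[OF trivial_limit_at_right_real this]
      obtain e where e: "0 < e" "(1 + e) *\<^sub>R v \<in> T" by blast
      have eV: "(1 + e) *\<^sub>R v \<in> V" using sV v subspace_scale by blast
      then have "cl ((1 + e) *\<^sub>R v) \<in> B" using T(2) e W(3) by blast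
      then have "M ((1 + e) *\<^sub>R v) \<le> 1" unfolding assms(4) by (simp add: M_def)
      then have "(1 + e) * M v \<le> 1" using M_norm(3) v(1) e by simp
      then show "M v < 1"
        using e v(2) by (cases "M v = 1") auto
    qed
    then show ?thesis using closure v(2) by (auto simp: frontier_of_def)
  qed
  have Xeq: "X = cl ` target"
  proof
    show "X \<subseteq> cl ` target"
    proof
      fix C assume C: "C \<in> X"
      then obtain v where v: "v \<in> V" "M v \<le> 1" "C = cl v" unfolding assms(5) B by blast
      have "\<not> (M v = 1 \<and> minkowski v = 0)" using C v dress[OF v(1)] front[OF v(1,2)] unfolding assms(5) by blast
      then show "C \<in> cl ` target" using v by (auto simp: target_def)
    qed
    show "cl ` target \<subseteq> X"
    proof
      fix C assume "C \<in> cl ` target"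
      then obtain v where v: "v \<in> V" "M v \<le> 1" "\<not> (M v = 1 \<and> minkowski v = 0)" "C = cl v"
        by (auto simp: target_def)
      then show "C \<in> X" using dress[OF v(1)] front[OF v(1,2)] unfolding assms(5) B by blast
    qed
  qed
  let ?L = "lorentzian_set n d J"
  have tV: "target \<subseteq> V" by (auto simp: target_def)
  have "quotient_topology (top_of_set ?L) (pos_scaling_rel ?L) homeomorphic_space
    subtopology (quotient_topology (top_of_set V) (line_rel V u)) ((\<lambda>y. line_rel V u `` {y}) ` target)"
  proof (rule quotient_topology_homeomorphic)
    show "equiv (topspace (top_of_set ?L)) (pos_scaling_rel ?L)"
      using equiv_pos_scaling_rel[of ?L] lorentzian_set_scale by simp
    show "equiv (topspace (top_of_set V)) (line_rel V u)" using equiv_line_rel[OF sV uV] by simp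
    show "open_map (top_of_set V) (quotient_topology (top_of_set V) (line_rel V u)) (\<lambda>y. line_rel V u `` {y})"
      by (rule open_map_line_rel[OF sV uV])
    show "target \<subseteq> topspace (top_of_set V)" using tV by simp
    show "y' \<in> target" if "y \<in> target" "(y, y') \<in> line_rel V u" for y y'
      using that target_translate by (auto simp: line_rel_def)
    have sub: "subtopology (top_of_set V) target = top_of_set target"
      using tV by (simp add: subtopology_subtopology Int_absorb1)
    have "continuous_on ?L (to_target \<circ> log_poly)"
      by (rule continuous_on_compose[OF continuous_on_log_poly continuous_on_subset[OF continuous_on_to_target]])
        (use log_poly_lorentzian in auto)
    then show "continuous_map (top_of_set ?L) (subtopology (top_of_set V) target) (to_target \<circ> log_poly)"
      unfolding sub continuous_map_in_subtopology
      using log_poly_lorentzian to_target_in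
      by auto
    have "continuous_on target (exp_poly \<circ> from_target)"
      by (rule continuous_on_compose[OF continuous_on_from_target continuous_on_exp_poly])
    then show "continuous_map (subtopology (top_of_set V) target) (top_of_set ?L) (exp_poly \<circ> from_target)"
      unfolding sub continuous_map_in_subtopology
      using exp_poly_lorentzian from_target_in
      by auto
    show "((to_target \<circ> log_poly) f, (to_target \<circ> log_poly) f') \<in> line_rel V u"
      if "(f, f') \<in> pos_scaling_rel ?L" for f f'
    proof -
      from that obtain c where c: "f \<in> ?L" "f' \<in> ?L" "0 < c" "f' = c *\<^sub>R f" by (auto simp: pos_scaling_rel_def)
      have "log_poly f' = log_poly f + ln c *\<^sub>R u" unfolding c(4) u_def by (rule log_poly_scale[OF c(1,3)])
      then have "\<exists>s. to_target (log_poly f') = to_target (log_poly f) + s *\<^sub>R u"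
        using to_target_translate[OF log_poly_lorentzian[OF c(1)]] by simp
      then show ?thesis
        using to_target_in[OF log_poly_lorentzian[OF c(1)]] to_target_in[OF log_poly_lorentzian[OF c(2)]] tV
        by (auto simp: line_rel_def)
    qed
    show "((exp_poly \<circ> from_target) y, (exp_poly \<circ> from_target) y') \<in> pos_scaling_rel ?L"
      if "y \<in> target" "(y, y') \<in> line_rel V u" for y y'
    proof -
      from that obtain t where t: "y \<in> V" "y' = y + t *\<^sub>R u" by (auto simp: line_rel_def)
      obtain s where s: "from_target y' = from_target y + s *\<^sub>R u"
        using from_target_translate[OF t(1)] unfolding t(2) by blast
      have "y' \<in> target" using target_translate[OF that(1)] t(2) by simp
      moreover have "exp_poly (from_target y') = exp s *\<^sub>R exp_poly (from_target y)"
        unfolding s u_def by (rule exp_poly_add_ones)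
      ultimately show ?thesis
        using that(1) exp_poly_lorentzian[OF from_target_in] unfolding pos_scaling_rel_def comp_apply
        by (metis (mono_tags, lifting) case_prodI exp_gt_zero mem_Collect_eq)
    qed
    show "(exp_poly \<circ> from_target) ((to_target \<circ> log_poly) f) = f" if "f \<in> topspace (top_of_set ?L)" for f
      using that by (simp add: from_to_target log_poly_lorentzian exp_log_poly)
    show "(to_target \<circ> log_poly) ((exp_poly \<circ> from_target) y) = y" if "y \<in> target" for y
    proof -
      have "from_target y \<in> log_lorentzian" by (rule from_target_in[OF that])
      then have "log_poly (exp_poly (from_target y)) = from_target y"
        by (intro log_exp_poly) (simp add: log_lorentzian_def)
      then show ?thesis using to_from_target[OF that] by simp
    qed
  qed
  then show ?thesis
    unfolding proj_lorentzian_def Vq Xeq cl_def[abs_def] .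
qed

end
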